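(* Let $\tau\colon E\to M$ and $\tau'\colon E'\to M'$ be Lie algebroids and let $\Phi\colon E\to E'$ be a fiberwise surjective morphism of Lie algebroids. Consider a Lagrangian $L\in C^\infty(E)$ and a Lagrangian $L'\in C^\infty(E')$ such that $L=L'\circ\Phi$. If $a$ is a solution of Lagrange's equations for $L$, then $a'=\Phi\circ a$ is a solution of Lagrange's equations for $L'$.
   Context: A Lie algebroid is a (finite-dimensional, smooth) vector bundle $\tau\colon E\to M$ with a vector bundle map $\rho\colon E\to TM$ over $\mathrm{id}_M$ (the anchor) and a Lie bracket $[\cdot,\cdot]$ on its sections such that $[\sigma,f\eta]=(\rho(\sigma)f)\eta+f[\sigma,\eta]$. In local coordinates $(x^i)$ on $M$ and a local basis $\{e_\alpha\}$ of sections of $E$ (inducing coordinates $(x^i,y^\alpha)$ on $E$), write $\rho(e_\alpha)=\rho^i_\alpha\,\partial/\partial x^i$ and $[e_\alpha,e_\beta]=C^\gamma_{\alpha\beta}e_\gamma$. The exterior differential $d$ of the Lie algebroid on sections of $\wedge^\bullet E^*$ is given by the usual Koszul formula with $\rho$ and $[\cdot,\cdot]$. A vector bundle map $\Phi\colon E\to E'$ over $\varphi\colon M\to M'$ is a morphism of Lie algebroids if $\Phi^\star d\theta=d\Phi^\star\theta$ for every section $\theta$ of $\wedge^pE'^*$, $p\ge0$. It is fiberwise surjective if each linear map $E_m\to E'_{\varphi(m)}$ is surjective. An $E$-path (admissible curve) is a $C^1$ curve $a\colon J=[t_0,t_1]\to E$ whose base curve $\gamma=\tau\circ a$ satisfies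 $\rho\circ a=\dot\gamma$. A solution of Lagrange's equations for $L$ is an $E$-path $a$ which in all local coordinates $(x^i,y^\alpha)$ on $E$ induced by local coordinates $(x^i)$ on $M$ and a local basis $\{e_\alpha\}$ of sections of $E$ satisfies, along $a(t)=(x^i(t),y^\alpha(t))$, $$\frac{d}{dt}\Bigl(\frac{\partial L}{\partial y^\alpha}\Bigr)+\frac{\partial L}{\partial y^\gamma}C^\gamma_{\alpha\beta}y^\beta=\rho^i_\alpha\frac{\partial L}{\partial x^i},\qquad \dot x^i=\rho^i_\alpha y^\alpha ;$$ similarly for $L'$ on $E'$. *)

theory Defs
  imports "HOL-Analysis.Analysis"
begin

section \<open>Smooth functions of finitely many real variables\<close>

text \<open>
  Points of \<open>n\<close>-dimensional coordinate space are points of \<^const>\<open>Euclidean_space\<close> \<open>n\<close>, that is,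
  families \<open>nat \<Rightarrow> real\<close> vanishing at all indices \<open>\<ge> n\<close>. In this way dimension and rank are ordinary
  natural numbers, and \<open>0\<close> is allowed (a Lie algebra is a Lie algebroid over a point).
\<close>

definition partial_deriv :: "nat \<Rightarrow> ((nat \<Rightarrow> real) \<Rightarrow> real) \<Rightarrow> (nat \<Rightarrow> real) \<Rightarrow> real" where
  "partial_deriv i f z = deriv (\<lambda>s. f (z(i := s))) (z i)"

text \<open>For \<open>S\<close> open in \<open>Euclidean_space n\<close>: all iterated partial derivatives of order \<open>\<le> r\<close> exist and
  are continuous.\<close>

primrec Ck_on :: "nat \<Rightarrow> nat \<Rightarrow> (nat \<Rightarrow> real) set \<Rightarrow> ((nat \<Rightarrow> real) \<Rightarrow> real) \<Rightarrow> bool" where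
  "Ck_on n 0 S f \<longleftrightarrow> continuous_on S f"
| "Ck_on n (Suc r) S f \<longleftrightarrow> continuous_on S f \<and>
     (\<forall>i<n. (\<forall>z\<in>S. (\<lambda>s. f (z(i := s))) differentiable (at (z i))) \<and>
            Ck_on n r S (partial_deriv i f))"

definition Cinf_on :: "nat \<Rightarrow> (nat \<Rightarrow> real) set \<Rightarrow> ((nat \<Rightarrow> real) \<Rightarrow> real) \<Rightarrow> bool" where
  "Cinf_on n S f \<longleftrightarrow> (\<forall>r. Ck_on n r S f)"

section \<open>Smooth manifolds\<close>

record 'a manifold =
  mtop :: "'a topology"
  mdim :: nat
  matlas :: "('a set \<times> ('a \<Rightarrow> nat \<Rightarrow> real)) set"

abbreviation points :: "'a manifold \<Rightarrow> 'a set" where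
  "points M \<equiv> topspace (mtop M)"

text \<open>Local coordinates \<open>x\<close> with domain \<open>U\<close>, i.e. the members of the maximal atlas.\<close>

definition local_coords :: "'a manifold \<Rightarrow> 'a set \<Rightarrow> ('a \<Rightarrow> nat \<Rightarrow> real) \<Rightarrow> bool" where
  "local_coords M U x \<longleftrightarrow>
     openin (mtop M) U \<and> openin (Euclidean_space (mdim M)) (x ` U) \<and>
     homeomorphic_map (subtopology (mtop M) U) (subtopology (Euclidean_space (mdim M)) (x ` U)) x \<and>
     (\<forall>(V, y)\<in>matlas M. \<forall>j<mdim M.
        Cinf_on (mdim M) (x ` (U \<inter> V)) (\<lambda>z. y (inv_into U x z) j) \<and>
        Cinf_on (mdim M) (y ` (U \<inter> V)) (\<lambda>z. x (inv_into V y z) j))"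

definition smooth_manifold :: "'a manifold \<Rightarrow> bool" where
  "smooth_manifold M \<longleftrightarrow>
     Hausdorff_space (mtop M) \<and> second_countable (mtop M) \<and>
     (\<forall>(U, x)\<in>matlas M. local_coords M U x) \<and>
     (\<forall>p\<in>points M. \<exists>(U, x)\<in>matlas M. p \<in> U)"

text \<open>Here and below, \<open>W\<close> is an open subset of \<open>M\<close>; values outside \<open>W\<close> are irrelevant.\<close>

definition smooth_fun_on :: "'a manifold \<Rightarrow> 'a set \<Rightarrow> ('a \<Rightarrow> real) \<Rightarrow> bool" where
  "smooth_fun_on M W f \<longleftrightarrow>
     (\<forall>(U, x)\<in>matlas M. Cinf_on (mdim M) (x ` (U \<inter> W)) (\<lambda>z. f (inv_into U x z)))"

definition smooth_map_on :: "'a manifold \<Rightarrow> 'a set \<Rightarrow> 'b manifold \<Rightarrow> ('a \<Rightarrow> 'b) \<Rightarrow> bool" where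
  "smooth_map_on M W N f \<longleftrightarrow>
     continuous_map (subtopology (mtop M) W) (mtop N) f \<and>
     (\<forall>(V, y)\<in>matlas N. \<forall>j<mdim N. smooth_fun_on M {p\<in>W. f p \<in> V} (\<lambda>p. y (f p) j))"

text \<open>\<open>\<partial>f/\<partial>x\<^sup>i\<close> at the point \<open>p\<close>, in the coordinates \<open>x\<close> with domain \<open>U\<close>.\<close>

definition coord_deriv ::
  "'a set \<Rightarrow> ('a \<Rightarrow> nat \<Rightarrow> real) \<Rightarrow> nat \<Rightarrow> ('a \<Rightarrow> real) \<Rightarrow> 'a \<Rightarrow> real" where
  "coord_deriv U x i f p = partial_deriv i (\<lambda>z. f (inv_into U x z)) (x p)"

section \<open>Vector bundles\<close>

text \<open>The operations \<open>vadd\<close>, \<open>vscale\<close>, \<open>vzero\<close> are the fibrewise linear operations.\<close>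

record ('m, 'e) vbundle =
  vbase :: "'m manifold"
  vtotal :: "'e manifold"
  vproj :: "'e \<Rightarrow> 'm"
  vrank :: nat
  vadd :: "'e \<Rightarrow> 'e \<Rightarrow> 'e"
  vscale :: "real \<Rightarrow> 'e \<Rightarrow> 'e"
  vzero :: "'m \<Rightarrow> 'e"

definition fibre :: "('m, 'e, 'z) vbundle_scheme \<Rightarrow> 'm \<Rightarrow> 'e set" where
  "fibre E m = {v \<in> points (vtotal E). vproj E v = m}"

definition over :: "('m, 'e, 'z) vbundle_scheme \<Rightarrow> 'm set \<Rightarrow> 'e set" where
  "over E U = {v \<in> points (vtotal E). vproj E v \<in> U}"

definition real_vector_space_on ::
  "'e set \<Rightarrow> ('e \<Rightarrow> 'e \<Rightarrow> 'e) \<Rightarrow> (real \<Rightarrow> 'e \<Rightarrow> 'e) \<Rightarrow> 'e \<Rightarrow> bool" where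
  "real_vector_space_on V pl sm z \<longleftrightarrow>
     z \<in> V \<and> (\<forall>u\<in>V. \<forall>v\<in>V. pl u v \<in> V) \<and> (\<forall>c. \<forall>u\<in>V. sm c u \<in> V) \<and>
     (\<forall>u\<in>V. \<forall>v\<in>V. \<forall>w\<in>V. pl (pl u v) w = pl u (pl v w)) \<and>
     (\<forall>u\<in>V. \<forall>v\<in>V. pl u v = pl v u) \<and>
     (\<forall>u\<in>V. pl z u = u) \<and> (\<forall>u\<in>V. \<exists>v\<in>V. pl u v = z) \<and>
     (\<forall>c. \<forall>u\<in>V. \<forall>v\<in>V. sm c (pl u v) = pl (sm c u) (sm c v)) \<and>
     (\<forall>b c. \<forall>u\<in>V. sm (b + c) u = pl (sm b u) (sm c u)) \<and>
     (\<forall>b c. \<forall>u\<in>V. sm b (sm c u) = sm (b * c) u) \<and>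
     (\<forall>u\<in>V. sm 1 u = u)"

text \<open>\<open>lincomb E m r c e\<close> is the linear combination \<open>\<Sum>\<alpha><r. c\<^sub>\<alpha> e\<^sub>\<alpha>\<close> in the fibre over \<open>m\<close>.\<close>

primrec lincomb ::
  "('m, 'e, 'z) vbundle_scheme \<Rightarrow> 'm \<Rightarrow> nat \<Rightarrow> (nat \<Rightarrow> real) \<Rightarrow> (nat \<Rightarrow> 'e) \<Rightarrow> 'e" where
  "lincomb E m 0 c e = vzero E m"
| "lincomb E m (Suc r) c e = vadd E (lincomb E m r c e) (vscale E (c r) (e r))"

definition fibre_basis :: "('m, 'e, 'z) vbundle_scheme \<Rightarrow> 'm \<Rightarrow> (nat \<Rightarrow> 'e) \<Rightarrow> bool" where
  "fibre_basis E m e \<longleftrightarrow>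
     (\<forall>\<alpha><vrank E. e \<alpha> \<in> fibre E m) \<and>
     (\<forall>v\<in>fibre E m. \<exists>!c. (\<forall>\<alpha>\<ge>vrank E. c \<alpha> = 0) \<and> v = lincomb E m (vrank E) c e)"

text \<open>Smooth sections over an open set \<open>U\<close>; they are \<^const>\<open>extensional\<close>, so that equality of sections
  is equality on \<open>U\<close>.\<close>

definition sections :: "('m, 'e, 'z) vbundle_scheme \<Rightarrow> 'm set \<Rightarrow> ('m \<Rightarrow> 'e) set" where
  "sections E U = {\<sigma> \<in> extensional U.
     (\<forall>m\<in>U. \<sigma> m \<in> fibre E m) \<and> smooth_map_on (vbase E) U (vtotal E) \<sigma>}"

abbreviation gsections :: "('m, 'e, 'z) vbundle_scheme \<Rightarrow> ('m \<Rightarrow> 'e) set" where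
  "gsections E \<equiv> sections E (points (vbase E))"

definition local_basis ::
  "('m, 'e, 'z) vbundle_scheme \<Rightarrow> 'm set \<Rightarrow> (nat \<Rightarrow> 'm \<Rightarrow> 'e) \<Rightarrow> bool" where
  "local_basis E U e \<longleftrightarrow> openin (mtop (vbase E)) U \<and>
     (\<forall>\<alpha><vrank E. e \<alpha> \<in> sections E U) \<and> (\<forall>m\<in>U. fibre_basis E m (\<lambda>\<alpha>. e \<alpha> m))"

text \<open>\<open>basis_coord E e v \<alpha>\<close> is the component \<open>y\<^sup>\<alpha>\<close> of the vector \<open>v\<close> in the basis \<open>e\<close>.\<close>

definition basis_coord ::
  "('m, 'e, 'z) vbundle_scheme \<Rightarrow> (nat \<Rightarrow> 'm \<Rightarrow> 'e) \<Rightarrow> 'e \<Rightarrow> nat \<Rightarrow> real" where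
  "basis_coord E e v = (THE c. (\<forall>\<alpha>\<ge>vrank E. c \<alpha> = 0) \<and>
     v = lincomb E (vproj E v) (vrank E) c (\<lambda>\<alpha>. e \<alpha> (vproj E v)))"

text \<open>The coordinates \<open>(x\<^sup>i, y\<^sup>\<alpha>)\<close> on \<open>over E U\<close> induced by \<open>x\<close> and \<open>e\<close>: the \<open>x\<^sup>i\<close> occupy the indices
  \<open>i < n\<close>, and \<open>y\<^sup>\<alpha>\<close> the index \<open>n + \<alpha>\<close>, where \<open>n\<close> is the dimension of the base.\<close>

definition induced_coords ::
  "('m, 'e, 'z) vbundle_scheme \<Rightarrow> ('m \<Rightarrow> nat \<Rightarrow> real) \<Rightarrow> (nat \<Rightarrow> 'm \<Rightarrow> 'e) \<Rightarrow> 'e \<Rightarrow> nat \<Rightarrow> real" where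
  "induced_coords E x e v i =
     (let n = mdim (vbase E) in
      if i < n then x (vproj E v) i
      else if i < n + vrank E then basis_coord E e v (i - n) else 0)"

text \<open>In the last condition \<open>(x\<^sup>i, y\<^sup>\<alpha>)\<close> is a local trivialization \<open>over E U \<cong> U \<times> \<real>\<^sup>k\<close>, linear on the
  fibres, read in the chart \<open>x\<close> of the base.\<close>

definition vector_bundle :: "('m, 'e, 'z) vbundle_scheme \<Rightarrow> bool" where
  "vector_bundle E \<longleftrightarrow>
     smooth_manifold (vbase E) \<and> smooth_manifold (vtotal E) \<and>
     mdim (vtotal E) = mdim (vbase E) + vrank E \<and>
     smooth_map_on (vtotal E) (points (vtotal E)) (vbase E) (vproj E) \<and>
     (\<forall>m\<in>points (vbase E).
        real_vector_space_on (fibre E m) (vadd E) (vscale E) (vzero E m)) \<and>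
     (\<forall>m\<in>points (vbase E). \<exists>U x e. m \<in> U \<and> local_coords (vbase E) U x \<and>
        local_basis E U e \<and> local_coords (vtotal E) (over E U) (induced_coords E x e))"

definition vbundle_map ::
  "('m, 'e, 'z) vbundle_scheme \<Rightarrow> ('n, 'f, 'y) vbundle_scheme \<Rightarrow> ('m \<Rightarrow> 'n) \<Rightarrow> ('e \<Rightarrow> 'f) \<Rightarrow> bool" where
  "vbundle_map E E' \<phi> \<Phi> \<longleftrightarrow>
     smooth_map_on (vbase E) (points (vbase E)) (vbase E') \<phi> \<and>
     smooth_map_on (vtotal E) (points (vtotal E)) (vtotal E') \<Phi> \<and>
     (\<forall>v\<in>points (vtotal E). vproj E' (\<Phi> v) = \<phi> (vproj E v)) \<and>
     (\<forall>m\<in>points (vbase E).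
        (\<forall>u\<in>fibre E m. \<forall>v\<in>fibre E m. \<Phi> (vadd E u v) = vadd E' (\<Phi> u) (\<Phi> v)) \<and>
        (\<forall>c. \<forall>v\<in>fibre E m. \<Phi> (vscale E c v) = vscale E' c (\<Phi> v)))"

definition fibrewise_surjective ::
  "('m, 'e, 'z) vbundle_scheme \<Rightarrow> ('n, 'f, 'y) vbundle_scheme \<Rightarrow> ('m \<Rightarrow> 'n) \<Rightarrow> ('e \<Rightarrow> 'f) \<Rightarrow> bool" where
  "fibrewise_surjective E E' \<phi> \<Phi> \<longleftrightarrow>
     (\<forall>m\<in>points (vbase E). \<Phi> ` fibre E m = fibre E' (\<phi> m))"

section \<open>The tangent bundle\<close>

definition smooth_near :: "'m manifold \<Rightarrow> 'm \<Rightarrow> ('m \<Rightarrow> real) \<Rightarrow> bool" where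
  "smooth_near M m f \<longleftrightarrow> (\<exists>W. openin (mtop M) W \<and> m \<in> W \<and> smooth_fun_on M W f)"

text \<open>Tangent vectors at \<open>m\<close> are the operators \<open>v\<^sup>i \<partial>/\<partial>x\<^sup>i\<close> on functions that are smooth near \<open>m\<close>; they
  are set to \<open>0\<close> on all other functions, so that equality of operators is equality of tangent
  vectors.\<close>

definition tangent_space :: "'m manifold \<Rightarrow> 'm \<Rightarrow> (('m \<Rightarrow> real) \<Rightarrow> real) set" where
  "tangent_space M m =
     {D. \<exists>U x v. local_coords M U x \<and> m \<in> U \<and>
         D = (\<lambda>f. if smooth_near M m f then \<Sum>i<mdim M. v i * coord_deriv U x i f m else 0)}"

type_synonym 'm tangent = "'m \<times> (('m \<Rightarrow> real) \<Rightarrow> real)"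

definition tangent_points :: "'m manifold \<Rightarrow> 'm tangent set" where
  "tangent_points M = {(m, D). m \<in> points M \<and> D \<in> tangent_space M m}"

text \<open>The coordinates \<open>(x\<^sup>i, v\<^sup>i)\<close> with \<open>v\<^sup>i = D x\<^sup>i\<close>, at the indices \<open>i\<close> and \<open>n + i\<close>.\<close>

definition tangent_coords :: "'m manifold \<Rightarrow> ('m \<Rightarrow> nat \<Rightarrow> real) \<Rightarrow> 'm tangent \<Rightarrow> nat \<Rightarrow> real" where
  "tangent_coords M x = (\<lambda>(m, D) i.
     if i < mdim M then x m i
     else if i < 2 * mdim M then D (\<lambda>q. x q (i - mdim M)) else 0)"

definition tangent_bundle :: "'m manifold \<Rightarrow> ('m, 'm tangent) vbundle" where
  "tangent_bundle M =
     \<lparr> vbase = M,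
       vtotal =
         \<lparr> mtop = topology_generated_by
             {{p \<in> tangent_points M. fst p \<in> U \<and> tangent_coords M x p \<in> W} | U x W.
                (U, x) \<in> matlas M \<and> openin (Euclidean_space (2 * mdim M)) W},
           mdim = 2 * mdim M,
           matlas =
             {({p \<in> tangent_points M. fst p \<in> U}, tangent_coords M x) | U x. (U, x) \<in> matlas M} \<rparr>,
       vproj = fst,
       vrank = mdim M,
       vadd = (\<lambda>(m, D) (_, D'). (m, \<lambda>f. D f + D' f)),
       vscale = (\<lambda>c (m, D). (m, \<lambda>f. c * D f)),
       vzero = (\<lambda>m. (m, \<lambda>f. 0)) \<rparr>"

section \<open>Lie algebroids\<close>

record ('m, 'e) algebroid = "('m, 'e) vbundle" +
  anchor :: "'e \<Rightarrow> 'm tangent"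
  bracket :: "('m \<Rightarrow> 'e) \<Rightarrow> ('m \<Rightarrow> 'e) \<Rightarrow> ('m \<Rightarrow> 'e)"

definition sec_add ::
  "('m, 'e, 'z) vbundle_scheme \<Rightarrow> ('m \<Rightarrow> 'e) \<Rightarrow> ('m \<Rightarrow> 'e) \<Rightarrow> ('m \<Rightarrow> 'e)" where
  "sec_add E \<sigma> \<eta> = (\<lambda>m\<in>points (vbase E). vadd E (\<sigma> m) (\<eta> m))"

definition sec_scale ::
  "('m, 'e, 'z) vbundle_scheme \<Rightarrow> ('m \<Rightarrow> real) \<Rightarrow> ('m \<Rightarrow> 'e) \<Rightarrow> ('m \<Rightarrow> 'e)" where
  "sec_scale E f \<sigma> = (\<lambda>m\<in>points (vbase E). vscale E (f m) (\<sigma> m))"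

definition sec_zero :: "('m, 'e, 'z) vbundle_scheme \<Rightarrow> ('m \<Rightarrow> 'e)" where
  "sec_zero E = (\<lambda>m\<in>points (vbase E). vzero E m)"

text \<open>\<open>anchor_deriv E v f\<close> is \<open>\<rho>(v) f\<close>, the derivative of \<open>f\<close> along the tangent vector \<open>\<rho>(v)\<close>.\<close>

definition anchor_deriv :: "('m, 'e) algebroid \<Rightarrow> 'e \<Rightarrow> ('m \<Rightarrow> real) \<Rightarrow> real" where
  "anchor_deriv E v f = snd (anchor E v) f"

definition lie_bracket_on_sections :: "('m, 'e) algebroid \<Rightarrow> bool" where
  "lie_bracket_on_sections E \<longleftrightarrow>
     (\<forall>\<sigma>\<in>gsections E. \<forall>\<eta>\<in>gsections E. bracket E \<sigma> \<eta> \<in> gsections E) \<and>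
     (\<forall>\<sigma>\<in>gsections E. \<forall>\<eta>\<in>gsections E. \<forall>\<zeta>\<in>gsections E.
        bracket E (sec_add E \<sigma> \<eta>) \<zeta> = sec_add E (bracket E \<sigma> \<zeta>) (bracket E \<eta> \<zeta>) \<and>
        bracket E \<zeta> (sec_add E \<sigma> \<eta>) = sec_add E (bracket E \<zeta> \<sigma>) (bracket E \<zeta> \<eta>)) \<and>
     (\<forall>c. \<forall>\<sigma>\<in>gsections E. \<forall>\<eta>\<in>gsections E.
        bracket E (sec_scale E (\<lambda>_. c) \<sigma>) \<eta> = sec_scale E (\<lambda>_. c) (bracket E \<sigma> \<eta>) \<and>
        bracket E \<sigma> (sec_scale E (\<lambda>_. c) \<eta>) = sec_scale E (\<lambda>_. c) (bracket E \<sigma> \<eta>)) \<and>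
     (\<forall>\<sigma>\<in>gsections E. bracket E \<sigma> \<sigma> = sec_zero E) \<and>
     (\<forall>\<sigma>\<in>gsections E. \<forall>\<eta>\<in>gsections E. \<forall>\<zeta>\<in>gsections E.
        sec_add E (bracket E \<sigma> (bracket E \<eta> \<zeta>))
          (sec_add E (bracket E \<eta> (bracket E \<zeta> \<sigma>)) (bracket E \<zeta> (bracket E \<sigma> \<eta>))) = sec_zero E)"

definition lie_algebroid :: "('m, 'e) algebroid \<Rightarrow> bool" where
  "lie_algebroid E \<longleftrightarrow>
     vector_bundle E \<and>
     vbundle_map E (tangent_bundle (vbase E)) (\<lambda>m. m) (anchor E) \<and>
     lie_bracket_on_sections E \<and>
     (\<forall>\<sigma>\<in>gsections E. \<forall>\<eta>\<in>gsections E. \<forall>f. smooth_fun_on (vbase E) (points (vbase E)) f \<longrightarrow>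
        bracket E \<sigma> (sec_scale E f \<eta>) =
          sec_add E (sec_scale E (\<lambda>m. anchor_deriv E (\<sigma> m) f) \<eta>) (sec_scale E f (bracket E \<sigma> \<eta>)))"

section \<open>The exterior differential and morphisms\<close>

text \<open>A section \<open>\<theta>\<close> of \<open>\<And>\<^sup>pE\<^sup>*\<close> is evaluated at a point \<open>m\<close> on a list of \<open>p\<close> vectors of the fibre
  over \<open>m\<close>; its values on other lists are irrelevant. Smoothness of the section means smoothness of its
  components in local bases of \<open>E\<close>.\<close>

definition is_form :: "('m, 'e, 'z) vbundle_scheme \<Rightarrow> nat \<Rightarrow> ('m \<Rightarrow> 'e list \<Rightarrow> real) \<Rightarrow> bool" where
  "is_form E p \<theta> \<longleftrightarrow>
     (\<forall>m\<in>points (vbase E). \<forall>vs. length vs = p \<and> set vs \<subseteq> fibre E m \<longrightarrow>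
        (\<forall>i<p. \<forall>u\<in>fibre E m.
           \<theta> m (vs[i := vadd E (vs ! i) u]) = \<theta> m vs + \<theta> m (vs[i := u])) \<and>
        (\<forall>i<p. \<forall>c. \<theta> m (vs[i := vscale E c (vs ! i)]) = c * \<theta> m vs) \<and>
        (\<forall>j<p. \<forall>i<j. vs ! i = vs ! j \<longrightarrow> \<theta> m vs = 0)) \<and>
     (\<forall>U e. local_basis E U e \<longrightarrow>
        (\<forall>\<alpha>s. length \<alpha>s = p \<and> set \<alpha>s \<subseteq> {..<vrank E} \<longrightarrow>
           smooth_fun_on (vbase E) U (\<lambda>m. \<theta> m (map (\<lambda>\<alpha>. e \<alpha> m) \<alpha>s))))"

definition omit :: "nat \<Rightarrow> 'a list \<Rightarrow> 'a list" where
  "omit i xs = take i xs @ drop (Suc i) xs"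

text \<open>The Koszul formula for \<open>(d\<theta>)(\<sigma>\<^sub>0, \<dots>, \<sigma>\<^sub>p)\<close> at \<open>m\<close>, where \<open>\<sigma>s = [\<sigma>\<^sub>0, \<dots>, \<sigma>\<^sub>p]\<close>.\<close>

definition koszul ::
  "('m, 'e) algebroid \<Rightarrow> ('m \<Rightarrow> 'e list \<Rightarrow> real) \<Rightarrow> ('m \<Rightarrow> 'e) list \<Rightarrow> 'm \<Rightarrow> real" where
  "koszul E \<theta> \<sigma>s m =
     (\<Sum>i<length \<sigma>s. (- 1) ^ i *
        anchor_deriv E ((\<sigma>s ! i) m) (\<lambda>q. \<theta> q (map (\<lambda>\<sigma>. \<sigma> q) (omit i \<sigma>s)))) +
     (\<Sum>j<length \<sigma>s. \<Sum>i<j. (- 1) ^ (i + j) *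
        \<theta> m (bracket E (\<sigma>s ! i) (\<sigma>s ! j) m # map (\<lambda>\<sigma>. \<sigma> m) (omit i (omit j \<sigma>s))))"

text \<open>The right-hand side of the Koszul formula is tensorial in the sections, so the value of \<open>d\<theta>\<close> on
  vectors of the fibre over \<open>m\<close> is obtained from arbitrary sections through these vectors.\<close>

definition ext_diff ::
  "('m, 'e) algebroid \<Rightarrow> ('m \<Rightarrow> 'e list \<Rightarrow> real) \<Rightarrow> 'm \<Rightarrow> 'e list \<Rightarrow> real" where
  "ext_diff E \<theta> m vs = koszul E \<theta> (map (\<lambda>v. SOME \<sigma>. \<sigma> \<in> gsections E \<and> \<sigma> m = v) vs) m"

definition pullback_form ::
  "('m \<Rightarrow> 'n) \<Rightarrow> ('e \<Rightarrow> 'f) \<Rightarrow> ('n \<Rightarrow> 'f list \<Rightarrow> real) \<Rightarrow> 'm \<Rightarrow> 'e list \<Rightarrow> real" where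
  "pullback_form \<phi> \<Phi> \<theta> m vs = \<theta> (\<phi> m) (map \<Phi> vs)"

definition algebroid_morphism ::
  "('m, 'e) algebroid \<Rightarrow> ('n, 'f) algebroid \<Rightarrow> ('m \<Rightarrow> 'n) \<Rightarrow> ('e \<Rightarrow> 'f) \<Rightarrow> bool" where
  "algebroid_morphism E E' \<phi> \<Phi> \<longleftrightarrow>
     vbundle_map E E' \<phi> \<Phi> \<and>
     (\<forall>p \<theta>. is_form E' p \<theta> \<longrightarrow>
        (\<forall>m\<in>points (vbase E). \<forall>vs. length vs = Suc p \<and> set vs \<subseteq> fibre E m \<longrightarrow>
           pullback_form \<phi> \<Phi> (ext_diff E' \<theta>) m vs = ext_diff E (pullback_form \<phi> \<Phi> \<theta>) m vs))"

section \<open>Admissible curves and Lagrange's equations\<close>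

text \<open>Curves are defined on a compact interval \<open>J = {t0..t1}\<close>; derivatives at the end points are one-sided.\<close>

definition C1_curve :: "'a manifold \<Rightarrow> real set \<Rightarrow> (real \<Rightarrow> 'a) \<Rightarrow> bool" where
  "C1_curve N J a \<longleftrightarrow>
     continuous_map (top_of_set J) (mtop N) a \<and>
     (\<forall>(U, x)\<in>matlas N. \<forall>i<mdim N. \<exists>g.
        (\<forall>t\<in>{t\<in>J. a t \<in> U}. ((\<lambda>s. x (a s) i) has_real_derivative g t) (at t within J)) \<and>
        continuous_on {t\<in>J. a t \<in> U} g)"

definition velocity :: "'m manifold \<Rightarrow> real set \<Rightarrow> (real \<Rightarrow> 'm) \<Rightarrow> real \<Rightarrow> 'm tangent" where
  "velocity M J \<gamma> t =
     (\<gamma> t, \<lambda>f. if smooth_near M (\<gamma> t) f then vector_derivative (\<lambda>s. f (\<gamma> s)) (at t within J) else 0)"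

definition admissible_curve :: "('m, 'e) algebroid \<Rightarrow> real set \<Rightarrow> (real \<Rightarrow> 'e) \<Rightarrow> bool" where
  "admissible_curve E J a \<longleftrightarrow>
     C1_curve (vtotal E) J a \<and>
     (\<forall>t\<in>J. anchor E (a t) = velocity (vbase E) J (\<lambda>s. vproj E (a s)) t)"

text \<open>The bracket at \<open>m\<close> of two sections given only near \<open>m\<close>: replace them by global sections that
  agree with them near \<open>m\<close>. By the Leibniz rule the result does not depend on the choice.\<close>

definition agree_near :: "'m manifold \<Rightarrow> 'm \<Rightarrow> ('m \<Rightarrow> 'e) \<Rightarrow> ('m \<Rightarrow> 'e) \<Rightarrow> bool" where
  "agree_near M m \<sigma> \<eta> \<longleftrightarrow> (\<exists>W. openin (mtop M) W \<and> m \<in> W \<and> (\<forall>q\<in>W. \<sigma> q = \<eta> q))"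

definition local_bracket :: "('m, 'e) algebroid \<Rightarrow> ('m \<Rightarrow> 'e) \<Rightarrow> ('m \<Rightarrow> 'e) \<Rightarrow> 'm \<Rightarrow> 'e" where
  "local_bracket E \<sigma> \<eta> m =
     (SOME v. \<exists>\<sigma>'\<in>gsections E. \<exists>\<eta>'\<in>gsections E.
        agree_near (vbase E) m \<sigma>' \<sigma> \<and> agree_near (vbase E) m \<eta>' \<eta> \<and> v = bracket E \<sigma>' \<eta>' m)"

text \<open>\<open>structure_fun E e \<gamma> \<alpha> \<beta> m\<close> is \<open>C\<^sup>\<gamma>\<^sub>\<alpha>\<^sub>\<beta>(m)\<close>, and \<open>anchor_coeff E x e i \<alpha> m\<close> is \<open>\<rho>\<^sup>i\<^sub>\<alpha>(m)\<close>.\<close>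

definition structure_fun ::
  "('m, 'e) algebroid \<Rightarrow> (nat \<Rightarrow> 'm \<Rightarrow> 'e) \<Rightarrow> nat \<Rightarrow> nat \<Rightarrow> nat \<Rightarrow> 'm \<Rightarrow> real" where
  "structure_fun E e \<gamma> \<alpha> \<beta> m = basis_coord E e (local_bracket E (e \<alpha>) (e \<beta>) m) \<gamma>"

definition anchor_coeff ::
  "('m, 'e) algebroid \<Rightarrow> ('m \<Rightarrow> nat \<Rightarrow> real) \<Rightarrow> (nat \<Rightarrow> 'm \<Rightarrow> 'e) \<Rightarrow> nat \<Rightarrow> nat \<Rightarrow> 'm \<Rightarrow> real" where
  "anchor_coeff E x e i \<alpha> m = anchor_deriv E (e \<alpha> m) (\<lambda>q. x q i)"

definition dL_dx ::
  "('m, 'e) algebroid \<Rightarrow> 'm set \<Rightarrow> ('m \<Rightarrow> nat \<Rightarrow> real) \<Rightarrow> (nat \<Rightarrow> 'm \<Rightarrow> 'e) \<Rightarrow> ('e \<Rightarrow> real) \<Rightarrow> nat \<Rightarrow> 'e \<Rightarrow> real"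
  where
  "dL_dx E U x e L i v = coord_deriv (over E U) (induced_coords E x e) i L v"

definition dL_dy ::
  "('m, 'e) algebroid \<Rightarrow> 'm set \<Rightarrow> ('m \<Rightarrow> nat \<Rightarrow> real) \<Rightarrow> (nat \<Rightarrow> 'm \<Rightarrow> 'e) \<Rightarrow> ('e \<Rightarrow> real) \<Rightarrow> nat \<Rightarrow> 'e \<Rightarrow> real"
  where
  "dL_dy E U x e L \<alpha> v = coord_deriv (over E U) (induced_coords E x e) (mdim (vbase E) + \<alpha>) L v"

definition lagrange_solution ::
  "('m, 'e) algebroid \<Rightarrow> ('e \<Rightarrow> real) \<Rightarrow> real set \<Rightarrow> (real \<Rightarrow> 'e) \<Rightarrow> bool" where
  "lagrange_solution E L J a \<longleftrightarrow>
     admissible_curve E J a \<and>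
     (\<forall>U x e. local_coords (vbase E) U x \<and> local_basis E U e \<longrightarrow>
        (\<forall>t\<in>{t\<in>J. vproj E (a t) \<in> U}.
           let m = vproj E (a t); n = mdim (vbase E); k = vrank E; y = basis_coord E e (a t) in
           (\<forall>\<alpha><k. \<exists>D.
              ((\<lambda>s. dL_dy E U x e L \<alpha> (a s)) has_real_derivative D) (at t within J) \<and>
              D + (\<Sum>\<gamma><k. \<Sum>\<beta><k. dL_dy E U x e L \<gamma> (a t) * structure_fun E e \<gamma> \<alpha> \<beta> m * y \<beta>) =
                (\<Sum>i<n. anchor_coeff E x e i \<alpha> m * dL_dx E U x e L i (a t))) \<and>
           (\<forall>i<n. ((\<lambda>s. x (vproj E (a s)) i) has_real_derivative
                     (\<Sum>\<alpha><k. anchor_coeff E x e i \<alpha> m * y \<alpha>)) (at t within J))))"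

end

theory Submission
  imports Defs "Jordan_Normal_Form.Determinant"
begin

text \<open>
  Let \<open>A\<close> be the matrix of \<open>\<Phi>\<close> in local bases of \<open>E\<close> and \<open>E'\<close>. Since \<open>L = L' \<circ> \<Phi>\<close>, the momenta are related by
  \<open>p\<^sub>\<alpha> = \<Sum>\<^sub>\<gamma> A\<^sup>\<gamma>\<^sub>\<alpha> p'\<^sub>\<gamma>\<close>. Applied to functions, \<open>d\<Phi>\<^sup>* = \<Phi>\<^sup>* d\<close> says that \<open>\<Phi>\<close> intertwines the anchors; applied to
  the dual basis of \<open>E'\<close>, it expresses the antisymmetrized derivative of \<open>A\<close> along the anchor by the structure
  functions of \<open>E\<close> and \<open>E'\<close>. Contract Lagrange's equations of \<open>L\<close> at \<open>a(t)\<close> with a vector \<open>u\<close> such that \<open>\<Phi> u\<close> is a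
  given basis vector of \<open>E'\<close>: the derivatives of \<open>A\<close> coming from \<open>dp/dt\<close> and from \<open>\<partial>L/\<partial>x\<close> cancel against the
  structure functions, and Lagrange's equation of \<open>L'\<close> in that direction remains. By fibrewise surjectivity every
  basis vector of \<open>E'\<close> is reached. The momenta \<open>p'\<close> are differentiable in \<open>t\<close> because \<open>L'\<close> is smooth and
  \<open>\<Phi> \<circ> a\<close> is \<open>C\<^sup>1\<close>.

  Forms and brackets live on global sections, so local data have to be extended by bump functions.
\<close>

section \<open>Calculus on coordinate space\<close>

text \<open>Two obstacles shape the development. The definition of a vector bundle provides, near
  each point, one frame whose induced coordinates form a chart of the total space, whereas
  Lagrange's equations quantify over all charts x of the base and all local bases e. Derivatives of
  L in arbitrary induced coordinates are therefore reached through an explicit parametrization,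
  linear in the fibre coordinates, and components in an arbitrary basis through Cramer's rule.
  Secondly, the differential picks global sections by choice. The coordinate formula for the bracket
  shows that in degree 1 the derivatives of these sections cancel, so that the identity for \<Phi>
  can be read off at a point.

  The relation between \<partial>L/\<partial>x and \<partial>L'/\<partial>x' is obtained without a
  tangent map of \<Phi>: a vector v is extended to a local section w with constant components, and
  the derivation \<rho>(u) is applied to the two expressions L o w and L' o \<Phi> o w of one
  function.\<close>

abbreviation ES :: "nat \<Rightarrow> (nat \<Rightarrow> real) set" where
  "ES n \<equiv> {x. \<forall>i\<ge>n. x i = 0}"

lemma openin_ES_open: "openin (Euclidean_space n) S \<longleftrightarrow> (\<exists>T. open T \<and> S = T \<inter> ES n)"
  by (auto simp: Euclidean_space_def openin_subtopology euclidean_product_topology)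

lemma openin_ES_subset: "openin (Euclidean_space n) S \<Longrightarrow> S \<subseteq> ES n"
  using openin_subset topspace_Euclidean_space by blast

lemma ES_open: "openin (Euclidean_space n) (ES n)"
  using openin_topspace[of "Euclidean_space n"] by (simp add: topspace_Euclidean_space)

lemma open_box_fun:
  fixes z :: "nat \<Rightarrow> real"
  shows "open {w. \<forall>i<n. \<bar>w i - z i\<bar> < d}"
proof -
  have "{w. \<forall>i<n. \<bar>w i - z i\<bar> < d} = (\<Inter>i\<in>{..<n}. {w. \<bar>w i - z i\<bar> < d})" by auto
  moreover have "open {w. \<bar>w i - z i\<bar> < d}" for i
    by (intro open_Collect_less continuous_on_rabs continuous_on_diff continuous_on_const continuous_on_product_coordinates)
  ultimately show ?thesis by (simp add: open_INT)
qed

text \<open>All coordinates from n on vanish both in z and in w, so a basic open set of the product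
  topology effectively constrains the first n coordinates only, and the least of n radii
  serves.\<close>

lemma openin_ES_boxD:
  assumes "openin (Euclidean_space n) S" "z \<in> S"
  obtains d where "d > 0" "\<And>w. w \<in> ES n \<Longrightarrow> (\<And>i. i < n \<Longrightarrow> \<bar>w i - z i\<bar> < d) \<Longrightarrow> w \<in> S"
proof -
  obtain T where T: "open T" "S = T \<inter> ES n" using assms openin_ES_open by auto
  have "openin (product_topology (\<lambda>i::nat. euclideanreal) UNIV) T"
    using T by (simp add: euclidean_product_topology)
  moreover have "z \<in> T" using assms(2) T by simp
  ultimately obtain U where U: "\<forall>i\<in>UNIV. openin euclideanreal (U i)" "z \<in> Pi\<^sub>E UNIV U" "Pi\<^sub>E UNIV U \<subseteq> T"
    unfolding openin_product_topology_alt by blast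
  have "\<exists>d. \<forall>i. d i > 0 \<and> (\<forall>x. \<bar>x - z i\<bar> < d i \<longrightarrow> x \<in> U i)"
  proof (rule choice, rule allI)
    fix i
    have "z i \<in> U i" using U(2) by (auto simp: PiE_iff)
    then show "\<exists>d>0. \<forall>x. \<bar>x - z i\<bar> < d \<longrightarrow> x \<in> U i"
      using U(1) by (auto simp: open_dist dist_real_def)
  qed
  then obtain d where d: "\<And>i. d i > 0" "\<And>i x. \<bar>x - z i\<bar> < d i \<Longrightarrow> x \<in> U i" by auto
  \<comment> \<open>The element 1 keeps the minimum defined for n = 0.\<close>
  define e where "e = Min (insert 1 (d ` {..<n}))"
  have e: "e > 0" "\<And>i. i < n \<Longrightarrow> e \<le> d i" unfolding e_def using d(1) by auto
  show ?thesis
  proof (rule that[OF e(1)])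
    fix w assume w: "w \<in> ES n" "\<And>i. i < n \<Longrightarrow> \<bar>w i - z i\<bar> < e"
    have "w i \<in> U i" for i
    proof (cases "i < n")
      case True then show ?thesis using w(2) e(2) d(2) by fastforce
    next
      case False
      then have "w i = z i" using w(1) assms(2) T(2) by simp
      then show ?thesis using U(2) by (auto simp: PiE_iff)
    qed
    then show "w \<in> S" using T w(1) U(3) by (auto simp: PiE_iff)
  qed
qed

lemma openin_ES_boxI:
  assumes "S \<subseteq> ES n"
    and "\<And>z. z \<in> S \<Longrightarrow> \<exists>d>0. \<forall>w\<in>ES n. (\<forall>i<n. \<bar>w i - z i\<bar> < d) \<longrightarrow> w \<in> S"
  shows "openin (Euclidean_space n) S"
proof (subst openin_subopen, rule ballI)
  fix z assume z: "z \<in> S"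
  then obtain d where d: "d > 0" "\<forall>w\<in>ES n. (\<forall>i<n. \<bar>w i - z i\<bar> < d) \<longrightarrow> w \<in> S"
    using assms(2)[OF z] by blast
  define T where "T = {w. \<forall>i<n. \<bar>w i - z i\<bar> < d} \<inter> ES n"
  have "openin (Euclidean_space n) T" unfolding T_def openin_ES_open using open_box_fun by blast
  moreover have "z \<in> T" unfolding T_def using z d(1) assms(1) by auto
  moreover have "T \<subseteq> S" unfolding T_def using d(2) by blast
  ultimately show "\<exists>T. openin (Euclidean_space n) T \<and> z \<in> T \<and> T \<subseteq> S" by blast
qed

lemma continuous_on_ES_D:
  fixes f :: "(nat \<Rightarrow> real) \<Rightarrow> real"
  assumes "openin (Euclidean_space n) S" "continuous_on S f" "z \<in> S" "e > 0"
  obtains d where "d > 0"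
    "\<And>w. w \<in> ES n \<Longrightarrow> (\<And>i. i < n \<Longrightarrow> \<bar>w i - z i\<bar> < d) \<Longrightarrow> w \<in> S \<and> \<bar>f w - f z\<bar> < e"
proof -
  have "openin (top_of_set S) (S \<inter> f -` ball (f z) e)"
    using assms(2) continuous_openin_preimage_gen by blast
  then obtain T where T: "open T" "S \<inter> f -` ball (f z) e = S \<inter> T" by (auto simp: openin_open)
  obtain U where U: "open U" "S = U \<inter> ES n" using assms(1) openin_ES_open by auto
  have "openin (Euclidean_space n) (S \<inter> f -` ball (f z) e)"
    unfolding T openin_ES_open using T U by (intro exI[of _ "U \<inter> T"]) auto
  then obtain d where "d > 0" "\<And>w. w \<in> ES n \<Longrightarrow> (\<And>i. i < n \<Longrightarrow> \<bar>w i - z i\<bar> < d) \<Longrightarrow> w \<in> S \<inter> f -` ball (f z) e"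
    by (rule openin_ES_boxD[of _ _ z]) (use assms in auto)
  then show ?thesis using that by (auto simp: dist_real_def abs_minus_commute)
qed

lemma fun_upd_ES: "z \<in> ES n \<Longrightarrow> i < n \<Longrightarrow> z(i := s) \<in> ES n"
  by auto

text \<open>A partial derivative at z is thereby determined by the values of the function on
  S.\<close>

lemma openin_ES_line:
  assumes "openin (Euclidean_space n) S" "z \<in> S" "i < n"
  shows "\<forall>\<^sub>F s in nhds (z i). z(i := s) \<in> S"
proof -
  obtain d where d: "d > 0" "\<And>w. w \<in> ES n \<Longrightarrow> (\<And>j. j < n \<Longrightarrow> \<bar>w j - z j\<bar> < d) \<Longrightarrow> w \<in> S"
    by (rule openin_ES_boxD[OF assms(1,2)]) blast
  have "z(i := s) \<in> S" if "dist s (z i) < d" for s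
  proof (rule d(2))
    show "z(i := s) \<in> ES n" using openin_ES_subset[OF assms(1)] assms(2,3) by (intro fun_upd_ES) blast+
    show "\<bar>(z(i := s)) j - z j\<bar> < d" for j using that d(1) by (cases "j = i") (auto simp: dist_real_def)
  qed
  then show ?thesis unfolding eventually_nhds_metric using d(1) by (intro exI[of _ d]) blast
qed

section \<open>Functions of class C^k: locality and algebra\<close>

lemma Ck_on_continuous: "Ck_on n r S f \<Longrightarrow> continuous_on S f"
  by (cases r) auto

lemma Ck_on_partial_DERIV:
  assumes "Ck_on n (Suc r) S f" "z \<in> S" "i < n"
  shows "((\<lambda>s. f (z(i := s))) has_real_derivative partial_deriv i f z) (at (z i))"
  using assms unfolding partial_deriv_def by (auto simp: DERIV_deriv_iff_real_differentiable)

lemma partial_derivI: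
  "((\<lambda>s. f (z(i := s))) has_real_derivative D) (at (z i)) \<Longrightarrow> partial_deriv i f z = D"
  unfolding partial_deriv_def by (rule DERIV_imp_deriv)

lemma Ck_on_mono: "Ck_on n r S f \<Longrightarrow> T \<subseteq> S \<Longrightarrow> Ck_on n r T f"
  by (induction r arbitrary: f) (auto intro: continuous_on_subset)

lemma Ck_on_SucD: "Ck_on n (Suc r) S f \<Longrightarrow> Ck_on n r S f"
  by (induction r arbitrary: f) auto

lemma Ck_on_Suc_1: "Ck_on n (Suc r) S f \<Longrightarrow> Ck_on n (Suc 0) S f"
proof (induction r)
  case (Suc r)
  show ?case by (rule Suc.IH[OF Ck_on_SucD[OF Suc.prems]])
qed

lemma Ck_on_partial: "Ck_on n (Suc r) S f \<Longrightarrow> i < n \<Longrightarrow> Ck_on n r S (partial_deriv i f)"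
  by simp

lemma Ck_on_SucI:
  assumes "continuous_on S f"
    and "\<And>i z. i < n \<Longrightarrow> z \<in> S \<Longrightarrow> ((\<lambda>s. f (z(i := s))) has_real_derivative partial_deriv i f z) (at (z i))"
    and "\<And>i. i < n \<Longrightarrow> Ck_on n r S (partial_deriv i f)"
  shows "Ck_on n (Suc r) S f"
  using assms by (auto simp: real_differentiable_def)

lemma partial_deriv_cong:
  assumes "openin (Euclidean_space n) S" "\<And>z. z \<in> S \<Longrightarrow> f z = g z" "z \<in> S" "i < n"
  shows "partial_deriv i f z = partial_deriv i g z"
  unfolding partial_deriv_def
  by (rule deriv_cong_ev[OF _ refl]) (use openin_ES_line[OF assms(1,3,4)] assms(2) in \<open>auto elim: eventually_mono\<close>)

lemma Ck_on_cong_imp: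
  assumes "openin (Euclidean_space n) S"
  shows "Ck_on n r S f \<Longrightarrow> (\<And>z. z \<in> S \<Longrightarrow> f z = g z) \<Longrightarrow> Ck_on n r S g"
proof (induction r arbitrary: f g)
  case 0
  then show ?case by (simp cong: continuous_on_cong)
next
  case (Suc r)
  note eq = Suc.prems(2)
  have pd: "partial_deriv i f z = partial_deriv i g z" if "z \<in> S" "i < n" for z i
    using partial_deriv_cong[OF assms eq that] by simp
  show ?case
  proof (rule Ck_on_SucI)
    show "continuous_on S g" using Suc.prems by (simp cong: continuous_on_cong)
    fix i assume i: "i < n"
    show "Ck_on n r S (partial_deriv i g)"
      using Suc.IH[of "partial_deriv i f"] Suc.prems(1) pd i by auto
    fix z assume z: "z \<in> S"
    show "((\<lambda>s. g (z(i := s))) has_real_derivative partial_deriv i g z) (at (z i))"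
      unfolding pd[OF z i, symmetric]
    proof (rule DERIV_cong_ev[THEN iffD1, OF refl _ refl])
      show "\<forall>\<^sub>F s in nhds (z i). f (z(i := s)) = g (z(i := s))"
        using openin_ES_line[OF assms z i] by (rule eventually_mono) (rule eq)
    qed (rule Ck_on_partial_DERIV[OF Suc.prems(1) z i])
  qed
qed

lemma Ck_on_cong:
  assumes "openin (Euclidean_space n) S" "\<And>z. z \<in> S \<Longrightarrow> f z = g z"
  shows "Ck_on n r S f \<longleftrightarrow> Ck_on n r S g"
proof
  show "Ck_on n r S f \<Longrightarrow> Ck_on n r S g" using Ck_on_cong_imp[OF assms(1), of r f g] assms(2) by blast
  show "Ck_on n r S g \<Longrightarrow> Ck_on n r S f" using Ck_on_cong_imp[OF assms(1), of r g f] assms(2) by force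
qed

text \<open>f is a total function, so its partial derivatives do not refer to the set;
  differentiability is tested at single points, and only continuity has to be glued.\<close>

lemma Ck_on_local:
  assumes "openin (Euclidean_space n) S"
    and "\<And>z. z \<in> S \<Longrightarrow> \<exists>T. openin (Euclidean_space n) T \<and> z \<in> T \<and> Ck_on n r (S \<inter> T) f"
  shows "Ck_on n r S f"
  using assms(2)
proof (induction r arbitrary: f)
  have cont: "continuous_on S f"
    if loc: "\<And>z. z \<in> S \<Longrightarrow> \<exists>T. openin (Euclidean_space n) T \<and> z \<in> T \<and> continuous_on (S \<inter> T) f"
    for f :: "(nat \<Rightarrow> real) \<Rightarrow> real"
  proof (subst continuous_on_eq_continuous_within, rule ballI)
    fix z assume z: "z \<in> S"
    obtain T where T: "openin (Euclidean_space n) T" "z \<in> T" "continuous_on (S \<inter> T) f"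
      using loc[OF z] by auto
    obtain O1 where O1: "open O1" "T = O1 \<inter> ES n" using T(1) openin_ES_open by auto
    have "at z within (S \<inter> T) = at z within S"
      by (rule at_within_nhd[of _ O1]) (use O1 T z openin_ES_subset[OF assms(1)] in auto)
    then show "continuous (at z within S) f"
      using T(2,3) z by (metis Int_iff continuous_on_eq_continuous_within)
  qed
  {
    case 0
    show ?case unfolding Ck_on.simps by (rule cont, rule "0"[unfolded Ck_on.simps])
  next
    case (Suc r)
    show ?case
    proof (rule Ck_on_SucI)
      show "continuous_on S f"
      proof (rule cont)
        fix z assume "z \<in> S"
        from Suc.prems[OF this] show "\<exists>T. openin (Euclidean_space n) T \<and> z \<in> T \<and> continuous_on (S \<inter> T) f"
          using Ck_on_continuous by blast
      qed
      fix i assume i: "i < n"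
      show "Ck_on n r S (partial_deriv i f)"
      proof (rule Suc.IH)
        fix z assume "z \<in> S"
        from Suc.prems[OF this] show "\<exists>T. openin (Euclidean_space n) T \<and> z \<in> T \<and> Ck_on n r (S \<inter> T) (partial_deriv i f)"
          using Ck_on_partial[OF _ i] by blast
      qed
      fix z assume z: "z \<in> S"
      obtain T where "z \<in> T" "Ck_on n (Suc r) (S \<inter> T) f" using Suc.prems[OF z] by auto
      then show "((\<lambda>s. f (z(i := s))) has_real_derivative partial_deriv i f z) (at (z i))"
        using Ck_on_partial_DERIV z i by blast
    qed
  }
qed

lemma Ck_on_const: "Ck_on n r S (\<lambda>z. c)"
proof (induction r arbitrary: c)
  case (Suc r)
  have "partial_deriv i (\<lambda>z. c) = (\<lambda>z. 0)" for i
    by (rule ext, rule partial_derivI) auto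
  with Suc show ?case by (auto intro!: Ck_on_SucI)
qed auto

lemma Ck_on_coord: "Ck_on n r S (\<lambda>z. z j)"
proof -
  have cont: "continuous_on S (\<lambda>z::nat \<Rightarrow> real. z j)"
    by (rule continuous_on_subset[OF continuous_on_product_coordinates]) simp
  have d: "((\<lambda>s. (z(i := s)) j) has_real_derivative (if i = j then 1 else 0)) (at (z i))" for z :: "nat \<Rightarrow> real" and i
    by (cases "i = j") (auto intro!: derivative_eq_intros)
  have pd: "partial_deriv i (\<lambda>z. z j) = (\<lambda>z. if i = j then 1 else 0)" for i
    by (rule ext, rule partial_derivI[OF d])
  \<comment> \<open>One order more than asked: the partial derivatives are constants, which replaces
    an induction on r.\<close>
  have "Ck_on n (Suc r) S (\<lambda>z. z j)"
    by (rule Ck_on_SucI[OF cont]) (unfold pd, rule d, rule Ck_on_const)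
  then show ?thesis by (rule Ck_on_SucD)
qed

lemma Ck_on_add:
  assumes "openin (Euclidean_space n) S"
  shows "Ck_on n r S f \<Longrightarrow> Ck_on n r S g \<Longrightarrow> Ck_on n r S (\<lambda>z. f z + g z)"
proof (induction r arbitrary: f g)
  case 0
  then show ?case by (auto intro: continuous_intros)
next
  case (Suc r)
  have d: "((\<lambda>s. f (z(i := s)) + g (z(i := s))) has_real_derivative
      partial_deriv i f z + partial_deriv i g z) (at (z i))" if "z \<in> S" "i < n" for z i
    by (intro DERIV_add Ck_on_partial_DERIV[OF Suc.prems(1) that] Ck_on_partial_DERIV[OF Suc.prems(2) that])
  have pd: "partial_deriv i (\<lambda>z. f z + g z) z = partial_deriv i f z + partial_deriv i g z"
    if "z \<in> S" "i < n" for z i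
    by (rule partial_derivI[OF d[OF that]])
  show ?case
  proof (rule Ck_on_SucI)
    show "continuous_on S (\<lambda>z. f z + g z)"
      using Suc.prems[THEN Ck_on_continuous] by (intro continuous_intros)
    fix i assume i: "i < n"
    show "Ck_on n r S (partial_deriv i (\<lambda>z. f z + g z))"
      using Ck_on_cong[OF assms pd] Suc.IH[OF Suc.prems[THEN Ck_on_partial, OF i]] i by simp
    fix z assume z: "z \<in> S"
    show "((\<lambda>s. f (z(i := s)) + g (z(i := s))) has_real_derivative partial_deriv i (\<lambda>z. f z + g z) z) (at (z i))"
      using d[OF z i] unfolding pd[OF z i] .
  qed
qed

lemma Ck_on_mult:
  assumes "openin (Euclidean_space n) S"
  shows "Ck_on n r S f \<Longrightarrow> Ck_on n r S g \<Longrightarrow> Ck_on n r S (\<lambda>z. f z * g z)"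
proof (induction r arbitrary: f g)
  case 0
  then show ?case by (auto intro: continuous_intros)
next
  case (Suc r)
  have d: "((\<lambda>s. f (z(i := s)) * g (z(i := s))) has_real_derivative
      partial_deriv i f z * g z + partial_deriv i g z * f z) (at (z i))" if "z \<in> S" "i < n" for z i
    using DERIV_mult[OF Ck_on_partial_DERIV[OF Suc.prems(1) that] Ck_on_partial_DERIV[OF Suc.prems(2) that]]
    by (simp only: fun_upd_triv)
  have pd: "partial_deriv i (\<lambda>z. f z * g z) z = partial_deriv i f z * g z + partial_deriv i g z * f z"
    if "z \<in> S" "i < n" for z i
    by (rule partial_derivI[OF d[OF that]])
  show ?case
  proof (rule Ck_on_SucI)
    show "continuous_on S (\<lambda>z. f z * g z)"
      using Suc.prems[THEN Ck_on_continuous] by (intro continuous_intros)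
    fix i assume i: "i < n"
    have "Ck_on n r S (\<lambda>z. partial_deriv i f z * g z + partial_deriv i g z * f z)"
      using Suc.prems[THEN Ck_on_partial, OF i] Suc.prems[THEN Ck_on_SucD]
      by (intro Ck_on_add[OF assms] Suc.IH)
    then show "Ck_on n r S (partial_deriv i (\<lambda>z. f z * g z))"
      using Ck_on_cong[OF assms pd] i by simp
    fix z assume z: "z \<in> S"
    show "((\<lambda>s. f (z(i := s)) * g (z(i := s))) has_real_derivative partial_deriv i (\<lambda>z. f z * g z) z) (at (z i))"
      using d[OF z i] unfolding pd[OF z i] .
  qed
qed

lemma Ck_on_sum:
  assumes "openin (Euclidean_space n) S" "\<And>j. j \<in> A \<Longrightarrow> Ck_on n r S (f j)"
  shows "Ck_on n r S (\<lambda>z. \<Sum>j\<in>A. f j z)"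
  using assms(2)
  by (induction A rule: infinite_finite_induct) (auto intro: Ck_on_const Ck_on_add[OF assms(1)])

text \<open>Difference quotients along the successive coordinate directions; the mean value theorem makes
  them converge, which turns the chain rule into the product rule for limits.\<close>

lemma Ck_on_slopes:
  assumes S: "openin (Euclidean_space n) S" and f: "Ck_on n (Suc 0) S f" and z: "z \<in> S"
  obtains \<psi> where "\<And>w. w \<in> ES n \<Longrightarrow> f w - f z = (\<Sum>i<n. \<psi> i w * (w i - z i))"
    and "\<And>e. e > 0 \<Longrightarrow> \<exists>d>0. \<forall>w\<in>ES n. (\<forall>i<n. \<bar>w i - z i\<bar> < d) \<longrightarrow> (\<forall>i<n. \<bar>\<psi> i w - partial_deriv i f z\<bar> < e)"
proof -
  have zE: "z \<in> ES n" using z openin_ES_subset[OF S] by auto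
  \<comment> \<open>A path from z to w along the axes: the first j coordinates are already those of
    w.\<close>
  define h where "h j w = (\<lambda>i. if i < j then w i else z i)" for j and w :: "nat \<Rightarrow> real"
  have hS: "h (Suc j) w = (h j w)(j := w j)" "h j w = (h j w)(j := z j)" for j w
    by (auto simp: h_def)
  \<comment> \<open>Where the quotient would be 0/0, its intended limit is taken as the value; the
    product with \<open>w j - z j\<close> is the increment of f in either case.\<close>
  define \<psi> where "\<psi> j w = (if w j = z j then partial_deriv j f z
      else (f (h (Suc j) w) - f (h j w)) / (w j - z j))" for j w
  show thesis
  proof (rule that)
    fix w assume w: "w \<in> ES n"
    have "\<psi> j w * (w j - z j) = f (h (Suc j) w) - f (h j w)" for j
      by (metis (no_types, lifting) \<psi>_def cancel_comm_monoid_add_class.diff_cancel divide_eq_0_iff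
          eq_iff_diff_eq_0 hS(1,2) mult_eq_0_iff nonzero_mult_div_cancel_right times_divide_eq_left)
    then have "(\<Sum>i<n. \<psi> i w * (w i - z i)) = f (h n w) - f (h 0 w)"
      by (simp add: sum_lessThan_telescope[of "\<lambda>j. f (h j w)"])
    moreover have "h n w = w" "h 0 w = z" using w zE by (auto simp: h_def)
    ultimately show "f w - f z = (\<Sum>i<n. \<psi> i w * (w i - z i))" by simp
  next
    fix e :: real assume e: "e > 0"
    have "\<exists>d. \<forall>i. d i > 0 \<and> (i < n \<longrightarrow> (\<forall>w\<in>ES n. (\<forall>j<n. \<bar>w j - z j\<bar> < d i) \<longrightarrow>
        w \<in> S \<and> \<bar>partial_deriv i f w - partial_deriv i f z\<bar> < e))"
    proof (rule choice, rule allI)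
      fix i
      show "\<exists>d>0. i < n \<longrightarrow> (\<forall>w\<in>ES n. (\<forall>j<n. \<bar>w j - z j\<bar> < d) \<longrightarrow>
        w \<in> S \<and> \<bar>partial_deriv i f w - partial_deriv i f z\<bar> < e)"
      proof (cases "i < n")
        case True
        then have "continuous_on S (partial_deriv i f)" using f by simp
        obtain d where "d > 0"
          "\<And>w. w \<in> ES n \<Longrightarrow> (\<And>j. j < n \<Longrightarrow> \<bar>w j - z j\<bar> < d) \<Longrightarrow> w \<in> S \<and> \<bar>partial_deriv i f w - partial_deriv i f z\<bar> < e"
          by (rule continuous_on_ES_D[OF S \<open>continuous_on S (partial_deriv i f)\<close> z e]) blast
        then show ?thesis by (intro exI[of _ d]) blast
      qed (auto intro: exI[of _ 1])
    qed
    then obtain d where d': "\<forall>i. d i > 0 \<and> (i < n \<longrightarrow> (\<forall>w\<in>ES n. (\<forall>j<n. \<bar>w j - z j\<bar> < d i) \<longrightarrow>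
        w \<in> S \<and> \<bar>partial_deriv i f w - partial_deriv i f z\<bar> < e))" ..
    have d: "\<And>i. d i > 0" "\<And>i w. i < n \<Longrightarrow> w \<in> ES n \<Longrightarrow> (\<And>j. j < n \<Longrightarrow> \<bar>w j - z j\<bar> < d i) \<Longrightarrow>
        w \<in> S \<and> \<bar>partial_deriv i f w - partial_deriv i f z\<bar> < e" using d' by blast+
    define D where "D = Min (insert 1 (d ` {..<n}))"
    have D: "D > 0" "\<And>i. i < n \<Longrightarrow> D \<le> d i" unfolding D_def using d(1) by auto
    have "\<bar>\<psi> i w - partial_deriv i f z\<bar> < e"
      if w: "w \<in> ES n" "\<And>j. j < n \<Longrightarrow> \<bar>w j - z j\<bar> < D" and i: "i < n" for w i
    proof (cases "w i = z i")
      case True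
      then show ?thesis using e by (simp add: \<psi>_def)
    next
      case False
      \<comment> \<open>f on the axis-parallel segment to which the mean value theorem is applied.
        The segment stays in the box of radius \<open>d i\<close>, where the partial derivative
        differs from its value at z by less than e.\<close>
      define g where "g s = f ((h i w)(i := s))" for s
      have box: "\<bar>((h i w)(i := s)) j - z j\<bar> < d i"
        if "\<bar>s - z i\<bar> \<le> \<bar>w i - z i\<bar>" "j < n" for s j
        using that w(2)[of j] D(2)[OF i] d(1)[of i] by (auto simp: h_def)
      have inE: "(h i w)(i := s) \<in> ES n" for s using w(1) zE i by (auto simp: h_def)
      have g: "(g has_real_derivative partial_deriv i f ((h i w)(i := s))) (at s)"
        and close: "\<bar>partial_deriv i f ((h i w)(i := s)) - partial_deriv i f z\<bar> < e"
        if "\<bar>s - z i\<bar> \<le> \<bar>w i - z i\<bar>" for s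
      proof -
        have *: "(h i w)(i := s) \<in> S \<and> \<bar>partial_deriv i f ((h i w)(i := s)) - partial_deriv i f z\<bar> < e"
          by (rule d(2)[OF i inE box[OF that]])
        then show "\<bar>partial_deriv i f ((h i w)(i := s)) - partial_deriv i f z\<bar> < e" ..
        show "(g has_real_derivative partial_deriv i f ((h i w)(i := s))) (at s)"
          using Ck_on_partial_DERIV[OF f conjunct1[OF *] i] by (simp only: g_def[abs_def] fun_upd_upd fun_upd_same)
      qed
      have "\<exists>s. \<bar>s - z i\<bar> \<le> \<bar>w i - z i\<bar> \<and>
          g (w i) - g (z i) = (w i - z i) * partial_deriv i f ((h i w)(i := s))"
      proof (cases "z i < w i")
        case True
        from MVT2[OF this, of g "\<lambda>s. partial_deriv i f ((h i w)(i := s))"] obtain s where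
          "z i < s" "s < w i" "g (w i) - g (z i) = (w i - z i) * partial_deriv i f ((h i w)(i := s))"
          using g by force
        then show ?thesis by (intro exI[of _ s]) auto
      next
        case F: False
        then have "w i < z i" using False by simp
        from MVT2[OF this, of g "\<lambda>s. partial_deriv i f ((h i w)(i := s))"] obtain s where
          "w i < s" "s < z i" "g (z i) - g (w i) = (z i - w i) * partial_deriv i f ((h i w)(i := s))"
          using g by force
        then show ?thesis by (intro exI[of _ s]) (auto simp: algebra_simps)
      qed
      then obtain s where s: "\<bar>s - z i\<bar> \<le> \<bar>w i - z i\<bar>"
        "g (w i) - g (z i) = (w i - z i) * partial_deriv i f ((h i w)(i := s))" by auto
      have "\<psi> i w = (g (w i) - g (z i)) / (w i - z i)"
        using False hS by (simp add: \<psi>_def g_def)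
      also have "\<dots> = partial_deriv i f ((h i w)(i := s))" using False by (simp add: s(2))
      finally show ?thesis using close[OF s(1)] by simp
    qed
    then show "\<exists>d>0. \<forall>w\<in>ES n. (\<forall>i<n. \<bar>w i - z i\<bar> < d) \<longrightarrow> (\<forall>i<n. \<bar>\<psi> i w - partial_deriv i f z\<bar> < e)"
      using D(1) by blast
  qed
qed

text \<open>After division by s - t the slopes converge to the partial derivatives, and the
  difference quotients of the components to c'. The filter \<open>at t within J\<close> includes the
  one-sided derivatives at the end points of an interval.\<close>

lemma Ck_on_curve_DERIV:
  assumes S: "openin (Euclidean_space n) S" and f: "Ck_on n (Suc 0) S f" and z: "c t \<in> S"
    and cE: "\<forall>\<^sub>F s in at t within J. c s \<in> ES n"
    and c: "\<And>i. i < n \<Longrightarrow> ((\<lambda>s. c s i) has_real_derivative c' i) (at t within J)"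
  shows "((\<lambda>s. f (c s)) has_real_derivative (\<Sum>i<n. partial_deriv i f (c t) * c' i)) (at t within J)"
proof -
  obtain \<psi> where \<psi>: "\<And>w. w \<in> ES n \<Longrightarrow> f w - f (c t) = (\<Sum>i<n. \<psi> i w * (w i - c t i))"
    "\<And>e. e > 0 \<Longrightarrow> \<exists>d>0. \<forall>w\<in>ES n. (\<forall>i<n. \<bar>w i - c t i\<bar> < d) \<longrightarrow> (\<forall>i<n. \<bar>\<psi> i w - partial_deriv i f (c t)\<bar> < e)"
    by (rule Ck_on_slopes[OF S f z]) blast
  have lim: "((\<lambda>s. \<psi> i (c s)) \<longlongrightarrow> partial_deriv i f (c t)) (at t within J)" if i: "i < n" for i
  proof (rule tendstoI)
    fix e :: real assume "e > 0"
    then obtain d where d: "d > 0" "\<forall>w\<in>ES n. (\<forall>i<n. \<bar>w i - c t i\<bar> < d) \<longrightarrow> (\<forall>i<n. \<bar>\<psi> i w - partial_deriv i f (c t)\<bar> < e)"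
      using \<psi>(2) by blast
    have "\<forall>\<^sub>F s in at t within J. \<bar>c s j - c t j\<bar> < d" if "j < n" for j
      using tendstoD[OF DERIV_continuous[OF c[OF that], unfolded continuous_within] d(1)]
      by (simp add: dist_real_def)
    then have "\<forall>\<^sub>F s in at t within J. \<forall>j\<in>{..<n}. \<bar>c s j - c t j\<bar> < d"
      by (intro eventually_ball_finite) auto
    with cE show "\<forall>\<^sub>F s in at t within J. dist (\<psi> i (c s)) (partial_deriv i f (c t)) < e"
    proof eventually_elim
      case (elim s)
      then show ?case using d(2) i by (auto simp: dist_real_def)
    qed
  qed
  have "((\<lambda>s. \<Sum>i<n. \<psi> i (c s) * ((c s i - c t i) / (s - t))) \<longlongrightarrow>
      (\<Sum>i<n. partial_deriv i f (c t) * c' i)) (at t within J)"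
    by (intro tendsto_sum tendsto_mult lim) (use c in \<open>auto simp: has_field_derivative_iff\<close>)
  moreover have "\<forall>\<^sub>F s in at t within J. (\<Sum>i<n. \<psi> i (c s) * ((c s i - c t i) / (s - t)))
      = (f (c s) - f (c t)) / (s - t)"
    using cE
  proof eventually_elim
    case (elim s)
    then show ?case using \<psi>(1) by (simp add: sum_divide_distrib)
  qed
  ultimately show ?thesis
    unfolding has_field_derivative_iff by (rule Lim_transform_eventually)
qed

section \<open>Composition and the chain rule\<close>

definition tuple :: "nat \<Rightarrow> (nat \<Rightarrow> 'a \<Rightarrow> real) \<Rightarrow> 'a \<Rightarrow> nat \<Rightarrow> real" where
  "tuple m g z = (\<lambda>j. if j < m then g j z else 0)"

lemma tuple_ES: "tuple m g z \<in> ES m"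
  by (simp add: tuple_def)

lemma Ck_on_compose_partial:
  assumes S: "openin (Euclidean_space n) S" and T: "openin (Euclidean_space m) T"
    and f: "Ck_on m (Suc 0) T f" and g: "\<And>j. j < m \<Longrightarrow> Ck_on n (Suc 0) S (g j)"
    and z: "z \<in> S" "tuple m g z \<in> T" and i: "i < n"
  shows "((\<lambda>s. f (tuple m g (z(i := s)))) has_real_derivative
      (\<Sum>j<m. partial_deriv j f (tuple m g z) * partial_deriv i (g j) z)) (at (z i))"
proof -
  have "((\<lambda>s. tuple m g (z(i := s)) j) has_real_derivative partial_deriv i (g j) z) (at (z i))"
    if "j < m" for j
    using Ck_on_partial_DERIV[OF g z(1) i] that by (simp add: tuple_def)
  then show ?thesis
    by (intro Ck_on_curve_DERIV[OF T f, of "\<lambda>s. tuple m g (z(i := s))" "z i" UNIV "\<lambda>j. partial_deriv i (g j) z",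
      unfolded fun_upd_triv] z(2) always_eventually allI tuple_ES)
qed

text \<open>A partial derivative of the composite is a sum of products; one factor is again a
  composite, with a partial derivative of f in place of f, so the induction on the order runs over
  all f. The padding by 0 in \<open>tuple\<close> is what places its values in
  \<open>ES m\<close>.\<close>

lemma Ck_on_compose:
  assumes S: "openin (Euclidean_space n) S" and T: "openin (Euclidean_space m) T"
    and ST: "\<And>z. z \<in> S \<Longrightarrow> tuple m g z \<in> T"
  shows "Ck_on m r T f \<Longrightarrow> (\<And>j. j < m \<Longrightarrow> Ck_on n r S (g j)) \<Longrightarrow> Ck_on n r S (\<lambda>z. f (tuple m g z))"
proof (induction r arbitrary: f)
  have cont: "continuous_on S (\<lambda>z. f (tuple m g z))"
    if "continuous_on T f" "\<And>j. j < m \<Longrightarrow> continuous_on S (g j)" for f :: "(nat \<Rightarrow> real) \<Rightarrow> real"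
  proof (rule continuous_on_compose2[OF that(1)])
    show "continuous_on S (tuple m g)"
    proof (rule continuous_on_coordinatewise_then_product)
      fix j show "continuous_on S (\<lambda>z. tuple m g z j)"
        unfolding tuple_def using that(2)[of j] by (cases "j < m") simp_all
    qed
    show "tuple m g ` S \<subseteq> T" using ST by blast
  qed
  {
    case 0
    show ?case unfolding Ck_on.simps by (rule cont) (use 0 in simp_all)
  next
    case (Suc r)
    have d: "((\<lambda>s. f (tuple m g (z(i := s)))) has_real_derivative
      (\<Sum>j<m. partial_deriv j f (tuple m g z) * partial_deriv i (g j) z)) (at (z i))"
      if "z \<in> S" "i < n" for z i
      using Ck_on_compose_partial[OF S T, of f g z i] Ck_on_Suc_1[OF Suc.prems(1)] Ck_on_Suc_1[OF Suc.prems(2)] ST that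
      by blast
    have pd: "partial_deriv i (\<lambda>z. f (tuple m g z)) z =
      (\<Sum>j<m. partial_deriv j f (tuple m g z) * partial_deriv i (g j) z)" if "z \<in> S" "i < n" for z i
      by (rule partial_derivI[OF d[OF that]])
    show ?case
    proof (rule Ck_on_SucI)
      show "continuous_on S (\<lambda>z. f (tuple m g z))"
        using Suc.prems[THEN Ck_on_continuous] by (rule cont)
      fix i assume i: "i < n"
      have "Ck_on n r S (\<lambda>z. \<Sum>j<m. partial_deriv j f (tuple m g z) * partial_deriv i (g j) z)"
        using Ck_on_partial[OF Suc.prems(1)] Ck_on_partial[OF Suc.prems(2) i] Ck_on_SucD[OF Suc.prems(2)]
        by (intro Ck_on_sum[OF S] Ck_on_mult[OF S] Suc.IH) blast+
      then show "Ck_on n r S (partial_deriv i (\<lambda>z. f (tuple m g z)))"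
        using Ck_on_cong[OF S pd] i by simp
      fix z assume z: "z \<in> S"
      show "((\<lambda>s. f (tuple m g (z(i := s)))) has_real_derivative
          partial_deriv i (\<lambda>z. f (tuple m g z)) z) (at (z i))"
        using d[OF z i] unfolding pd[OF z i] .
    qed
  }
qed

text \<open>The sequence F of successive derivatives stands in for smoothness of a function of one
  variable; differentiating the composite moves from \<open>F k\<close> to
  \<open>F (Suc k)\<close>.\<close>

lemma Ck_on_compose_real:
  fixes F :: "nat \<Rightarrow> real \<Rightarrow> real"
  assumes S: "openin (Euclidean_space n) S"
    and F: "\<And>k t. t \<in> T \<Longrightarrow> (F k has_real_derivative F (Suc k) t) (at t)"
    and ST: "\<And>z. z \<in> S \<Longrightarrow> g z \<in> T"
  shows "Ck_on n r S g \<Longrightarrow> Ck_on n r S (\<lambda>z. F k (g z))"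
proof (induction r arbitrary: k)
  have cont: "continuous_on S (\<lambda>z. F k (g z))" if g: "continuous_on S g" for k
  proof (rule continuous_on_compose2[OF _ g])
    show "continuous_on T (F k)"
      by (rule continuous_at_imp_continuous_on, rule ballI, rule DERIV_isCont, rule F)
    show "g ` S \<subseteq> T" using ST by blast
  qed
  {
    case 0
    show ?case unfolding Ck_on.simps by (rule cont, rule "0"[unfolded Ck_on.simps])
  next
    case (Suc r)
    have d: "((\<lambda>s. F k (g (z(i := s)))) has_real_derivative F (Suc k) (g z) * partial_deriv i g z) (at (z i))"
      if "z \<in> S" "i < n" for z i
    proof -
      have *: "(F k has_real_derivative F (Suc k) (g z)) (at (g (z(i := z i))))"
        unfolding fun_upd_triv by (rule F[OF ST[OF that(1)]])
      show ?thesis using DERIV_chain2[OF * Ck_on_partial_DERIV[OF Suc.prems that]] .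
    qed
    have pd: "partial_deriv i (\<lambda>z. F k (g z)) z = F (Suc k) (g z) * partial_deriv i g z"
      if "z \<in> S" "i < n" for z i
      by (rule partial_derivI[OF d[OF that]])
    show ?case
    proof (rule Ck_on_SucI)
      show "continuous_on S (\<lambda>z. F k (g z))" by (rule cont[OF Ck_on_continuous[OF Suc.prems]])
      fix i assume i: "i < n"
      have "Ck_on n r S (\<lambda>z. F (Suc k) (g z) * partial_deriv i g z)"
        by (rule Ck_on_mult[OF S Suc.IH[OF Ck_on_SucD[OF Suc.prems]] Ck_on_partial[OF Suc.prems i]])
      then show "Ck_on n r S (partial_deriv i (\<lambda>z. F k (g z)))"
        using Ck_on_cong[OF S pd] i by simp
      fix z assume z: "z \<in> S"
      show "((\<lambda>s. F k (g (z(i := s)))) has_real_derivative partial_deriv i (\<lambda>z. F k (g z)) z) (at (z i))"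
        using d[OF z i] unfolding pd[OF z i] .
    qed
  }
qed

lemma Ck_on_inverse:
  assumes S: "openin (Euclidean_space n) S" and g: "Ck_on n r S g" and nz: "\<And>z. z \<in> S \<Longrightarrow> g z \<noteq> 0"
  shows "Ck_on n r S (\<lambda>z. 1 / g z)"
proof -
  \<comment> \<open>The k-th derivative of 1/t.\<close>
  define F where "F k t = (-1) ^ k * fact k / t ^ Suc k" for k and t :: real
  have F: "(F k has_real_derivative F (Suc k) t) (at t)" if "t \<in> - {0}" for k t
  proof -
    have "((\<lambda>t. (-1) ^ k * fact k * inverse (t ^ Suc k)) has_real_derivative
        (-1) ^ k * fact k * (- (inverse (t ^ Suc k) * (real (Suc k) * t ^ k) * inverse (t ^ Suc k)))) (at t)"
      using that by (auto intro!: derivative_eq_intros simp del: power_Suc)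
    moreover have "(-1) ^ k * fact k * (- (inverse (t ^ Suc k) * (real (Suc k) * t ^ k) * inverse (t ^ Suc k)))
        = F (Suc k) t"
      using that by (simp add: F_def field_simps)
    moreover have "(\<lambda>t. (-1) ^ k * fact k * inverse (t ^ Suc k)) = F k"
      by (simp add: F_def fun_eq_iff divide_inverse)
    ultimately show ?thesis by simp
  qed
  have "Ck_on n r S (\<lambda>z. F 0 (g z))"
    by (rule Ck_on_compose_real[where F = F and T = "- {0}", OF S F _ g]) (simp_all add: nz)
  then show ?thesis by (simp add: F_def)
qed

section \<open>Bump functions on coordinate space\<close>

text \<open>The classical smooth function that vanishes to infinite order at 0 although it is
  positive for t > 0.\<close>

definition flat :: "real \<Rightarrow> real" where
  "flat t = (if t > 0 then exp (- (1 / t)) else 0)"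

text \<open>For t > 0 the k-th derivative of exp(-1/t) is \<open>poly (flat_poly k) (1 / t)\<close>
  times exp(-1/t). With u = 1/t one has d/dt = -u^2 d/du, which gives the recursion;
  \<open>[:0, 0, 1:]\<close> is u^2.\<close>

primrec flat_poly :: "nat \<Rightarrow> real poly" where
  "flat_poly 0 = 1"
| "flat_poly (Suc k) = [:0, 0, 1:] * (flat_poly k - pderiv (flat_poly k))"

lemma poly_times_exp_tendsto_0: "((\<lambda>u::real. poly p u * exp (- u)) \<longlongrightarrow> 0) at_top"
proof -
  have "((\<lambda>u. \<Sum>i\<le>degree p. coeff p i * (u ^ i / exp u)) \<longlongrightarrow> (\<Sum>i\<le>degree p. coeff p i * 0)) at_top"
    by (intro tendsto_sum tendsto_mult tendsto_const tendsto_power_div_exp_0)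
  then show ?thesis by (simp add: poly_altdef sum_distrib_right exp_minus divide_inverse mult.assoc)
qed

lemma flat_poly_DERIV:
  "((\<lambda>t. if t > 0 then poly (flat_poly k) (1 / t) * exp (- (1 / t)) else 0) has_real_derivative
    (if t > 0 then poly (flat_poly (Suc k)) (1 / t) * exp (- (1 / t)) else 0)) (at t)"
  (is "(?F k has_real_derivative ?F (Suc k) t) (at t)")
proof -
  consider "t > 0" | "t < 0" | "t = 0" by linarith
  then show ?thesis
  proof cases
    case 1
    have "((\<lambda>t. poly (flat_poly k) (1 / t) * exp (- (1 / t))) has_real_derivative
        poly (pderiv (flat_poly k)) (1 / t) * (- 1 / t\<^sup>2) * exp (- (1 / t))
        + exp (- (1 / t)) * (1 / t\<^sup>2) * poly (flat_poly k) (1 / t)) (at t)"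
      using 1 by (auto intro!: derivative_eq_intros DERIV_chain2[OF poly_DERIV] simp: power2_eq_square)
    moreover have "poly (pderiv (flat_poly k)) (1 / t) * (- 1 / t\<^sup>2) * exp (- (1 / t))
        + exp (- (1 / t)) * (1 / t\<^sup>2) * poly (flat_poly k) (1 / t) = ?F (Suc k) t"
      using 1 by (simp add: power2_eq_square field_simps)
    ultimately have "((\<lambda>t. poly (flat_poly k) (1 / t) * exp (- (1 / t))) has_real_derivative ?F (Suc k) t) (at t)"
      by simp
    then show ?thesis
    proof (rule has_field_derivative_transform_within_open)
      show "open {0::real<..}" "t \<in> {0<..}" using 1 by auto
    qed auto
  next
    case 2
    have "((\<lambda>t. 0) has_real_derivative ?F (Suc k) t) (at t)" using 2 by simp
    then show ?thesis
    proof (rule has_field_derivative_transform_within_open)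
      show "open {..<0::real}" "t \<in> {..<0}" using 2 by auto
    qed auto
  next
    case 3
    have "((\<lambda>y. ?F k y / y) \<longlongrightarrow> 0) (at_left 0)"
    proof (rule tendsto_eventually)
      show "\<forall>\<^sub>F y in at_left 0. ?F k y / y = 0"
        unfolding eventually_at_left_field by (intro exI[of _ "-1"]) auto
    qed
    moreover have "((\<lambda>y. ?F k y / y) \<longlongrightarrow> 0) (at_right 0)"
    proof -
      \<comment> \<open>The difference quotient at 0 has an additional factor 1/y.
        \<open>pCons 0\<close> multiplies the polynomial by its variable, so that the limit at
        infinity applies with u = 1/y.\<close>
      have "((\<lambda>y::real. poly (pCons 0 (flat_poly k)) (inverse y) * exp (- (inverse y))) \<longlongrightarrow> 0) (at_right 0)"
        by (rule filterlim_compose[OF poly_times_exp_tendsto_0 filterlim_inverse_at_top_right])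
      moreover have "\<forall>\<^sub>F y in at_right 0. poly (pCons 0 (flat_poly k)) (inverse y) * exp (- (inverse y)) = ?F k y / y"
        unfolding eventually_at_right_field by (intro exI[of _ 1]) (auto simp: field_simps)
      ultimately show ?thesis by (rule Lim_transform_eventually)
    qed
    ultimately have "((\<lambda>y. ?F k y / y) \<longlongrightarrow> 0) (at 0)"
      using filterlim_split_at by blast
    then show ?thesis unfolding 3 has_field_derivative_iff by simp
  qed
qed

lemma Ck_on_flat:
  assumes "openin (Euclidean_space n) S" "Ck_on n r S g"
  shows "Ck_on n r S (\<lambda>z. flat (g z))"
proof -
  define F where "F k t = (if t > 0 then poly (flat_poly k) (1 / t) * exp (- (1 / t)) else 0)" for k t
  have "Ck_on n r S (\<lambda>z. F 0 (g z))"
  proof (rule Ck_on_compose_real[where F = F and T = UNIV, OF assms(1) _ _ assms(2)])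
    show "(F k has_real_derivative F (Suc k) t) (at t)" for k t
      unfolding F_def[abs_def] by (rule flat_poly_DERIV)
  qed simp
  then show ?thesis by (simp add: F_def flat_def cong: if_cong)
qed

text \<open>A smooth transition from the value 0 for t \<le> 0 to the value 1 for t \<ge> 1. The
  denominator is positive because t or 1 - t is.\<close>

definition step :: "real \<Rightarrow> real" where
  "step t = flat t / (flat t + flat (1 - t))"

lemma flat_pos: "t > 0 \<Longrightarrow> flat t > 0" and flat_nonneg: "flat t \<ge> 0" and flat_0: "t \<le> 0 \<Longrightarrow> flat t = 0"
  by (auto simp: flat_def)

lemma flat_sum_pos: "flat t + flat (1 - t) > 0"
proof (cases "t > 0")
  case True then show ?thesis using flat_pos[of t] flat_nonneg[of "1 - t"] by linarith
next
  case False then show ?thesis using flat_pos[of "1 - t"] flat_nonneg[of t] by linarith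
qed

lemma step_1: "t \<ge> 1 \<Longrightarrow> step t = 1"
  using flat_pos[of t] by (simp add: step_def flat_0)

lemma step_0: "t \<le> 0 \<Longrightarrow> step t = 0"
  by (simp add: step_def flat_0)

lemma Ck_on_step:
  assumes S: "openin (Euclidean_space n) S" and g: "Ck_on n r S g"
  shows "Ck_on n r S (\<lambda>z. step (g z))"
proof -
  have f: "Ck_on n r S (\<lambda>z. flat (g z))" by (rule Ck_on_flat[OF S g])
  have "Ck_on n r S (\<lambda>z. 1 + (-1) * g z)"
    by (intro Ck_on_add[OF S] Ck_on_mult[OF S] Ck_on_const g)
  then have "Ck_on n r S (\<lambda>z. flat (1 + (-1) * g z))" by (rule Ck_on_flat[OF S])
  then have f1: "Ck_on n r S (\<lambda>z. flat (1 - g z))" by simp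
  have "flat (g z) + flat (1 - g z) \<noteq> 0" for z using flat_sum_pos[of "g z"] by linarith
  then have "Ck_on n r S (\<lambda>z. flat (g z) * (1 / (flat (g z) + flat (1 - g z))))"
    by (intro Ck_on_mult[OF S f] Ck_on_inverse[OF S] Ck_on_add[OF S f f1])
  then show ?thesis by (simp add: step_def)
qed

section \<open>Smooth functions and a bump function on coordinate space\<close>

lemma Cinf_on_mono: "Cinf_on n S f \<Longrightarrow> T \<subseteq> S \<Longrightarrow> Cinf_on n T f"
  unfolding Cinf_on_def using Ck_on_mono by blast

lemma Cinf_on_cong:
  assumes "openin (Euclidean_space n) S" "\<And>z. z \<in> S \<Longrightarrow> f z = g z"
  shows "Cinf_on n S f \<longleftrightarrow> Cinf_on n S g"
  unfolding Cinf_on_def using Ck_on_cong[OF assms] by simp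

lemma Cinf_on_cong_imp:
  "openin (Euclidean_space n) S \<Longrightarrow> Cinf_on n S f \<Longrightarrow> (\<And>z. z \<in> S \<Longrightarrow> f z = g z) \<Longrightarrow> Cinf_on n S g"
  using Cinf_on_cong[of n S f g] by simp

lemma Cinf_on_local:
  assumes "openin (Euclidean_space n) S"
    and "\<And>z. z \<in> S \<Longrightarrow> \<exists>T. openin (Euclidean_space n) T \<and> z \<in> T \<and> Cinf_on n (S \<inter> T) f"
  shows "Cinf_on n S f"
  unfolding Cinf_on_def
proof (rule allI, rule Ck_on_local[OF assms(1)])
  fix r z assume "z \<in> S"
  from assms(2)[OF this] show "\<exists>T. openin (Euclidean_space n) T \<and> z \<in> T \<and> Ck_on n r (S \<inter> T) f"
    unfolding Cinf_on_def by blast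
qed

lemma Cinf_on_const: "Cinf_on n S (\<lambda>z. c)"
  by (simp add: Cinf_on_def Ck_on_const)

lemma Cinf_on_coord: "Cinf_on n S (\<lambda>z. z j)"
  by (simp add: Cinf_on_def Ck_on_coord)

lemma Cinf_on_add: "openin (Euclidean_space n) S \<Longrightarrow> Cinf_on n S f \<Longrightarrow> Cinf_on n S g \<Longrightarrow> Cinf_on n S (\<lambda>z. f z + g z)"
  by (simp add: Cinf_on_def Ck_on_add)

lemma Cinf_on_mult: "openin (Euclidean_space n) S \<Longrightarrow> Cinf_on n S f \<Longrightarrow> Cinf_on n S g \<Longrightarrow> Cinf_on n S (\<lambda>z. f z * g z)"
  by (simp add: Cinf_on_def Ck_on_mult)

lemma Cinf_on_sum:
  "openin (Euclidean_space n) S \<Longrightarrow> (\<And>j. j \<in> A \<Longrightarrow> Cinf_on n S (f j)) \<Longrightarrow> Cinf_on n S (\<lambda>z. \<Sum>j\<in>A. f j z)"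
  by (simp add: Cinf_on_def Ck_on_sum)

lemma Cinf_on_prod:
  assumes "openin (Euclidean_space n) S" "\<And>j. j \<in> A \<Longrightarrow> Cinf_on n S (f j)"
  shows "Cinf_on n S (\<lambda>z. \<Prod>j\<in>A. f j z)"
  using assms(2)
  by (induction A rule: infinite_finite_induct) (auto intro: Cinf_on_const Cinf_on_mult[OF assms(1)])

lemma Cinf_on_inverse:
  "openin (Euclidean_space n) S \<Longrightarrow> Cinf_on n S g \<Longrightarrow> (\<And>z. z \<in> S \<Longrightarrow> g z \<noteq> 0) \<Longrightarrow> Cinf_on n S (\<lambda>z. 1 / g z)"
  by (simp add: Cinf_on_def Ck_on_inverse)

lemma Cinf_on_step:
  "openin (Euclidean_space n) S \<Longrightarrow> Cinf_on n S g \<Longrightarrow> Cinf_on n S (\<lambda>z. step (g z))"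
  by (simp add: Cinf_on_def Ck_on_step)

lemma Cinf_on_compose:
  assumes "openin (Euclidean_space n) S" "openin (Euclidean_space m) T" "\<And>z. z \<in> S \<Longrightarrow> tuple m g z \<in> T"
    and "Cinf_on m T f" "\<And>j. j < m \<Longrightarrow> Cinf_on n S (g j)"
  shows "Cinf_on n S (\<lambda>z. f (tuple m g z))"
  unfolding Cinf_on_def
proof
  fix r show "Ck_on n r S (\<lambda>z. f (tuple m g z))"
    by (rule Ck_on_compose[OF assms(1-3)]) (use assms(4,5) in \<open>simp_all add: Cinf_on_def\<close>)
qed

lemma Cinf_on_partial: "Cinf_on n S f \<Longrightarrow> i < n \<Longrightarrow> Cinf_on n S (partial_deriv i f)"
  unfolding Cinf_on_def using Ck_on_partial by blast

lemma Cinf_on_continuous: "Cinf_on n S f \<Longrightarrow> continuous_on S f"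
  unfolding Cinf_on_def using Ck_on_continuous by blast

text \<open>One smooth step per coordinate, multiplied together. The compact set K is part of the
  result because its image in a Hausdorff manifold has to be closed when the function is extended by
  0.\<close>

lemma Cinf_on_bump:
  assumes S: "openin (Euclidean_space n) S" and z: "z0 \<in> S"
  obtains b K d where "Cinf_on n (ES n) b" "d > 0" "compact K" "K \<subseteq> S"
    "\<And>w. w \<in> ES n \<Longrightarrow> w \<notin> K \<Longrightarrow> b w = 0"
    "\<And>w. w \<in> ES n \<Longrightarrow> (\<And>i. i < n \<Longrightarrow> \<bar>w i - z0 i\<bar> < d) \<Longrightarrow> b w = 1 \<and> w \<in> K"
proof -
  have zE: "z0 \<in> ES n" using z openin_ES_subset[OF S] by blast
  obtain d0 where d0: "d0 > 0" "\<And>w. w \<in> ES n \<Longrightarrow> (\<And>i. i < n \<Longrightarrow> \<bar>w i - z0 i\<bar> < d0) \<Longrightarrow> w \<in> S"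
    by (rule openin_ES_boxD[OF S z]) blast
  \<comment> \<open>A third, so that the closed box of half-width 2 d still lies in S.\<close>
  define d where "d = d0 / 3"
  have d: "d > 0" "2 * d < d0" using d0(1) by (auto simp: d_def)
  \<comment> \<open>The square, unlike the absolute value, is smooth at the centre. The argument of
    \<open>step\<close> is at least 1 up to distance d and negative beyond distance 2 d.\<close>
  define b where "b w = (\<Prod>i<n. step (2 - ((w i - z0 i) / d)\<^sup>2))" for w :: "nat \<Rightarrow> real"
  \<comment> \<open>The factors {0} at indices from n on make K a product of compact sets, so that
    Tychonoff's theorem applies.\<close>
  define I where "I i = (if i < n then {z0 i - 2 * d .. z0 i + 2 * d} else {0})" for i
  define K where "K = Pi\<^sub>E UNIV I"
  have I: "w i \<in> I i \<longleftrightarrow> (if i < n then \<bar>w i - z0 i\<bar> \<le> 2 * d else w i = 0)" for w i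
    by (auto simp: I_def abs_le_iff)
  have K: "w \<in> K \<longleftrightarrow> w \<in> ES n \<and> (\<forall>i<n. \<bar>w i - z0 i\<bar> \<le> 2 * d)" for w
  proof -
    have "w \<in> K \<longleftrightarrow> (\<forall>i. if i < n then \<bar>w i - z0 i\<bar> \<le> 2 * d else w i = 0)"
      unfolding K_def PiE_UNIV_domain Pi_iff I by simp
    then show ?thesis by (auto simp: not_less)
  qed
  show thesis
  proof (rule that)
    have "Cinf_on n (ES n) (\<lambda>w. 2 + (-1) * (((w i + (- z0 i)) * (1/d)) * ((w i + (- z0 i)) * (1/d))))" for i
      by (intro Cinf_on_add[OF ES_open] Cinf_on_mult[OF ES_open] Cinf_on_const Cinf_on_coord)
    then have "Cinf_on n (ES n) (\<lambda>w. 2 - ((w i - z0 i) / d)\<^sup>2)" for i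
      by (simp add: power2_eq_square)
    then show "Cinf_on n (ES n) b"
      unfolding b_def[abs_def] by (intro Cinf_on_prod[OF ES_open] Cinf_on_step[OF ES_open])
    show "d > 0" by (rule d)
    have "compactin (product_topology (\<lambda>i::nat. euclideanreal) UNIV) K"
      unfolding K_def compactin_PiE by (rule disjI2) (auto simp: I_def)
    then show "compact K" by (simp add: euclidean_product_topology)
    show "K \<subseteq> S"
    proof
      fix w assume "w \<in> K"
      then have w: "w \<in> ES n" "\<And>i. i < n \<Longrightarrow> \<bar>w i - z0 i\<bar> \<le> 2 * d" unfolding K by blast+
      show "w \<in> S" by (rule d0(2)[OF w(1)]) (use w(2) d(2) in force)
    qed
    show "b w = 0" if "w \<in> ES n" "w \<notin> K" for w
    proof -
      have "\<not> (\<forall>i<n. \<bar>w i - z0 i\<bar> \<le> 2 * d)" using that K by blast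
      then obtain i where i: "i < n" "\<bar>w i - z0 i\<bar> > 2 * d" by (auto simp: not_le)
      then have "\<bar>(w i - z0 i) / d\<bar> > 2" using d(1) by (simp add: field_simps)
      then have "((w i - z0 i) / d)\<^sup>2 \<ge> 2\<^sup>2" by (subst abs_le_square_iff[symmetric]) simp
      then have "step (2 - ((w i - z0 i) / d)\<^sup>2) = 0" by (intro step_0) simp
      then show ?thesis unfolding b_def using i(1) by (intro prod_zero) auto
    qed
    show "b w = 1 \<and> w \<in> K" if w: "w \<in> ES n" "\<And>i. i < n \<Longrightarrow> \<bar>w i - z0 i\<bar> < d" for w
    proof
      have "step (2 - ((w i - z0 i) / d)\<^sup>2) = 1" if "i < n" for i
      proof -
        have "\<bar>(w i - z0 i) / d\<bar> \<le> \<bar>1\<bar>" using w(2)[OF that] d(1) by (simp add: field_simps)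
        then have "((w i - z0 i) / d)\<^sup>2 \<le> 1\<^sup>2" by (subst (asm) abs_le_square_iff)
        then show ?thesis by (intro step_1) simp
      qed
      then show "b w = 1" unfolding b_def by simp
      have "\<bar>w i - z0 i\<bar> \<le> 2 * d" if "i < n" for i using w(2)[OF that] d(1) by linarith
      then show "w \<in> K" unfolding K using w(1) by blast
    qed
  qed
qed

section \<open>Smooth functions and maps on manifolds\<close>

lemma local_coords_open: "local_coords M U x \<Longrightarrow> openin (mtop M) U"
  by (simp add: local_coords_def)

lemma local_coords_image_open: "local_coords M U x \<Longrightarrow> openin (Euclidean_space (mdim M)) (x ` U)"
  by (simp add: local_coords_def)

lemma local_coords_inj:
  assumes "local_coords M U x" shows "inj_on x U"
proof -
  have "homeomorphic_map (subtopology (mtop M) U) (subtopology (Euclidean_space (mdim M)) (x ` U)) x"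
    using assms by (simp add: local_coords_def)
  then have "inj_on x (topspace (subtopology (mtop M) U))" by (rule homeomorphic_imp_injective_map)
  moreover have "topspace (subtopology (mtop M) U) = U"
    using openin_subset[OF local_coords_open[OF assms]] by auto
  ultimately show ?thesis by simp
qed

lemma local_coords_inv: "local_coords M U x \<Longrightarrow> p \<in> U \<Longrightarrow> inv_into U x (x p) = p"
  using local_coords_inj by (rule inv_into_f_f)

lemma local_coords_inv_image: "local_coords M U x \<Longrightarrow> W \<subseteq> U \<Longrightarrow> z \<in> x ` W \<Longrightarrow> inv_into U x z \<in> W \<and> x (inv_into U x z) = z"
  using local_coords_inv by fastforce

lemma local_coords_ES: "local_coords M U x \<Longrightarrow> p \<in> U \<Longrightarrow> x p \<in> ES (mdim M)"
  using openin_ES_subset[OF local_coords_image_open] by blast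

lemma local_coords_open_image:
  assumes "local_coords M U x" "openin (mtop M) W"
  shows "openin (Euclidean_space (mdim M)) (x ` (U \<inter> W))"
proof -
  have "open_map (subtopology (mtop M) U) (subtopology (Euclidean_space (mdim M)) (x ` U)) x"
    using assms(1) by (intro homeomorphic_imp_open_map) (simp add: local_coords_def)
  moreover have "openin (subtopology (mtop M) U) (U \<inter> W)"
    using assms(2) by (auto simp: openin_subtopology)
  ultimately have "openin (subtopology (Euclidean_space (mdim M)) (x ` U)) (x ` (U \<inter> W))"
    unfolding open_map_def by blast
  then show ?thesis using openin_trans_full local_coords_image_open[OF assms(1)] by blast
qed

lemma local_coords_preimage_open:
  assumes "local_coords M U x" "openin (Euclidean_space (mdim M)) T"
  shows "openin (mtop M) {p \<in> U. x p \<in> T}"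
proof -
  have "continuous_map (subtopology (mtop M) U) (subtopology (Euclidean_space (mdim M)) (x ` U)) x"
    using assms(1) by (intro homeomorphic_imp_continuous_map) (simp add: local_coords_def)
  then have "continuous_map (subtopology (mtop M) U) (Euclidean_space (mdim M)) x"
    by (simp add: continuous_map_in_subtopology)
  from openin_continuous_map_preimage[OF this assms(2)]
  have "openin (subtopology (mtop M) U) {p \<in> topspace (subtopology (mtop M) U). x p \<in> T}" .
  moreover have "topspace (subtopology (mtop M) U) = U"
    using openin_subset[OF local_coords_open[OF assms(1)]] by auto
  ultimately have "openin (subtopology (mtop M) U) {p \<in> U. x p \<in> T}" by (simp only:)
  then show ?thesis by (rule openin_trans_full[OF _ local_coords_open[OF assms(1)]])
qed

section \<open>Smooth functions in charts of the atlas and in arbitrary charts\<close>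

lemma atlas_local_coords: "smooth_manifold M \<Longrightarrow> (U, x) \<in> matlas M \<Longrightarrow> local_coords M U x"
  unfolding smooth_manifold_def by blast

lemma atlas_at:
  assumes "smooth_manifold M" "p \<in> points M"
  obtains U x where "(U, x) \<in> matlas M" "p \<in> U" "local_coords M U x"
  using assms atlas_local_coords unfolding smooth_manifold_def by blast

lemma tuple_eq: "z \<in> ES m \<Longrightarrow> (\<And>j. j < m \<Longrightarrow> g j p = z j) \<Longrightarrow> tuple m g p = z"
  by (auto simp: tuple_def fun_eq_iff not_less)

lemma tuple_chart: "local_coords M U x \<Longrightarrow> p \<in> U \<Longrightarrow> tuple (mdim M) (\<lambda>j p. x p j) p = x p"
  by (rule tuple_eq[OF local_coords_ES]) auto

text \<open>f in the chart x is f in the chart y composed with the change of charts. Smoothness of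
  this change is a hypothesis, since \<open>local_coords\<close> compares a chart with members of
  the atlas and not with every other chart.\<close>

lemma Cinf_on_transition:
  assumes x: "local_coords M U x" and y: "local_coords M V y" and W: "openin (mtop M) W"
    and tr: "\<And>j. j < mdim M \<Longrightarrow> Cinf_on (mdim M) (x ` (U \<inter> V)) (\<lambda>z. y (inv_into U x z) j)"
    and f: "Cinf_on (mdim M) (y ` (V \<inter> W)) (\<lambda>z. f (inv_into V y z))"
  shows "Cinf_on (mdim M) (x ` (U \<inter> (V \<inter> W))) (\<lambda>z. f (inv_into U x z))"
proof -
  let ?n = "mdim M"
  have O1: "openin (Euclidean_space ?n) (x ` (U \<inter> (V \<inter> W)))"
    by (intro local_coords_open_image[OF x] openin_Int local_coords_open[OF y] W)
  have inv: "inv_into U x z \<in> U \<inter> (V \<inter> W)" if "z \<in> x ` (U \<inter> (V \<inter> W))" for z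
    using local_coords_inv_image[OF x _ that] by blast
  have t: "tuple ?n (\<lambda>j z. y (inv_into U x z) j) z = y (inv_into U x z)" if "z \<in> x ` (U \<inter> (V \<inter> W))" for z
    by (rule tuple_eq[OF local_coords_ES[OF y]]) (use inv[OF that] in auto)
  have "Cinf_on ?n (x ` (U \<inter> (V \<inter> W))) (\<lambda>z. f (inv_into V y (tuple ?n (\<lambda>j z. y (inv_into U x z) j) z)))"
  proof (rule Cinf_on_compose[OF O1 local_coords_open_image[OF y W] _ f])
    show "tuple ?n (\<lambda>j z. y (inv_into U x z) j) z \<in> y ` (V \<inter> W)" if "z \<in> x ` (U \<inter> (V \<inter> W))" for z
      unfolding t[OF that] using inv[OF that] by blast
    show "Cinf_on ?n (x ` (U \<inter> (V \<inter> W))) (\<lambda>z. y (inv_into U x z) j)" if "j < ?n" for j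
      by (rule Cinf_on_mono[OF tr[OF that]]) blast
  qed
  moreover have "f (inv_into V y (tuple ?n (\<lambda>j z. y (inv_into U x z) j) z)) = f (inv_into U x z)"
    if "z \<in> x ` (U \<inter> (V \<inter> W))" for z
    unfolding t[OF that] using local_coords_inv[OF y] inv[OF that] by simp
  ultimately show ?thesis by (rule Cinf_on_cong_imp[OF O1])
qed

text \<open>The definition tests charts of the atlas. Around each point such a chart is interposed,
  and smoothness is a local property.\<close>

lemma smooth_fun_on_chart:
  assumes M: "smooth_manifold M" and W: "openin (mtop M) W" and f: "smooth_fun_on M W f"
    and x: "local_coords M U x"
  shows "Cinf_on (mdim M) (x ` (U \<inter> W)) (\<lambda>z. f (inv_into U x z))"
proof (rule Cinf_on_local[OF local_coords_open_image[OF x W]])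
  fix z assume "z \<in> x ` (U \<inter> W)"
  then obtain p where p: "p \<in> U" "p \<in> W" "z = x p" by blast
  have "p \<in> points M" using p(2) openin_subset[OF W] by blast
  then obtain V y where y: "(V, y) \<in> matlas M" "p \<in> V" "local_coords M V y" by (rule atlas_at[OF M])
  have "Cinf_on (mdim M) (x ` (U \<inter> (V \<inter> W))) (\<lambda>z. f (inv_into U x z))"
  proof (rule Cinf_on_transition[OF x y(3) W])
    show "Cinf_on (mdim M) (y ` (V \<inter> W)) (\<lambda>z. f (inv_into V y z))"
      using f y(1) unfolding smooth_fun_on_def by blast
    show "Cinf_on (mdim M) (x ` (U \<inter> V)) (\<lambda>z. y (inv_into U x z) j)" if "j < mdim M" for j
      using x y(1) that unfolding local_coords_def by blast
  qed
  moreover have "x ` (U \<inter> W) \<inter> x ` (U \<inter> V) = x ` (U \<inter> (V \<inter> W))"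
    using local_coords_inj[OF x] unfolding inj_on_def by blast
  ultimately show "\<exists>T. openin (Euclidean_space (mdim M)) T \<and> z \<in> T \<and>
      Cinf_on (mdim M) (x ` (U \<inter> W) \<inter> T) (\<lambda>z. f (inv_into U x z))"
    using local_coords_open_image[OF x local_coords_open[OF y(3)]] p y(2)
    by (intro exI[of _ "x ` (U \<inter> V)"]) auto
qed

text \<open>Conversely, one chart around each point suffices, whether or not it belongs to the
  atlas.\<close>

lemma smooth_fun_onI:
  assumes M: "smooth_manifold M" and W: "openin (mtop M) W"
    and loc: "\<And>p. p \<in> W \<Longrightarrow> \<exists>U x W'. local_coords M U x \<and> openin (mtop M) W' \<and> p \<in> U \<and> p \<in> W' \<and>
      Cinf_on (mdim M) (x ` (U \<inter> (W \<inter> W'))) (\<lambda>z. f (inv_into U x z))"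
  shows "smooth_fun_on M W f"
  unfolding smooth_fun_on_def
proof clarify
  fix V y assume V: "(V, y) \<in> matlas M"
  have y: "local_coords M V y" by (rule atlas_local_coords[OF M V])
  show "Cinf_on (mdim M) (y ` (V \<inter> W)) (\<lambda>z. f (inv_into V y z))"
  proof (rule Cinf_on_local[OF local_coords_open_image[OF y W]])
    fix z assume "z \<in> y ` (V \<inter> W)"
    then obtain p where p: "p \<in> V" "p \<in> W" "z = y p" by blast
    then obtain U x W' where x: "local_coords M U x" "openin (mtop M) W'" "p \<in> U" "p \<in> W'"
      "Cinf_on (mdim M) (x ` (U \<inter> (W \<inter> W'))) (\<lambda>z. f (inv_into U x z))" using loc by blast
    have "Cinf_on (mdim M) (y ` (V \<inter> (U \<inter> (W \<inter> W')))) (\<lambda>z. f (inv_into V y z))"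
    proof (rule Cinf_on_transition[OF y x(1) openin_Int[OF W x(2)] _ x(5)])
      show "Cinf_on (mdim M) (y ` (V \<inter> U)) (\<lambda>z. x (inv_into V y z) j)" if "j < mdim M" for j
        using x(1) V that unfolding local_coords_def by (auto simp: Int_commute)
    qed
    moreover have "y ` (V \<inter> W) \<inter> y ` (V \<inter> (U \<inter> W')) = y ` (V \<inter> (U \<inter> (W \<inter> W')))"
      using local_coords_inj[OF y] unfolding inj_on_def by blast
    ultimately show "\<exists>T. openin (Euclidean_space (mdim M)) T \<and> z \<in> T \<and>
      Cinf_on (mdim M) (y ` (V \<inter> W) \<inter> T) (\<lambda>z. f (inv_into V y z))"
      using local_coords_open_image[OF y openin_Int[OF local_coords_open[OF x(1)] x(2)]] p x(3,4)
      by (intro exI[of _ "y ` (V \<inter> (U \<inter> W'))"]) auto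
  qed
qed

lemma smooth_fun_on_subset: "smooth_fun_on M W f \<Longrightarrow> W' \<subseteq> W \<Longrightarrow> smooth_fun_on M W' f"
  unfolding smooth_fun_on_def by (fast elim: Cinf_on_mono)

lemma smooth_fun_on_local:
  assumes M: "smooth_manifold M" and W: "openin (mtop M) W"
    and loc: "\<And>p. p \<in> W \<Longrightarrow> \<exists>W'. openin (mtop M) W' \<and> p \<in> W' \<and> smooth_fun_on M (W \<inter> W') f"
  shows "smooth_fun_on M W f"
proof (rule smooth_fun_onI[OF M W])
  fix p assume p: "p \<in> W"
  then obtain W' where W': "openin (mtop M) W'" "p \<in> W'" "smooth_fun_on M (W \<inter> W') f" using loc by blast
  have "p \<in> points M" using p openin_subset[OF W] by blast
  then obtain U x where x: "(U, x) \<in> matlas M" "p \<in> U" "local_coords M U x" by (rule atlas_at[OF M])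
  show "\<exists>U x W'. local_coords M U x \<and> openin (mtop M) W' \<and> p \<in> U \<and> p \<in> W' \<and>
      Cinf_on (mdim M) (x ` (U \<inter> (W \<inter> W'))) (\<lambda>z. f (inv_into U x z))"
    by (intro exI conjI) (rule x(3), rule W'(1), rule x(2), rule W'(2),
      rule smooth_fun_on_chart[OF M openin_Int[OF W W'(1)] W'(3) x(3)])
qed

lemma smooth_fun_on_cong:
  assumes M: "smooth_manifold M" and W: "openin (mtop M) W" and f: "smooth_fun_on M W f"
    and eq: "\<And>p. p \<in> W \<Longrightarrow> f p = g p"
  shows "smooth_fun_on M W g"
  unfolding smooth_fun_on_def
proof clarify
  fix V y assume V: "(V, y) \<in> matlas M"
  have y: "local_coords M V y" by (rule atlas_local_coords[OF M V])
  show "Cinf_on (mdim M) (y ` (V \<inter> W)) (\<lambda>z. g (inv_into V y z))"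
  proof (rule Cinf_on_cong_imp[OF local_coords_open_image[OF y W] smooth_fun_on_chart[OF M W f y]])
    show "f (inv_into V y z) = g (inv_into V y z)" if "z \<in> y ` (V \<inter> W)" for z
      using local_coords_inv_image[OF y _ that] eq by blast
  qed
qed

lemma smooth_fun_on_compose:
  assumes M: "smooth_manifold M" and W: "openin (mtop M) W"
    and g: "\<And>j. j < N \<Longrightarrow> smooth_fun_on M W (g j)" and T: "openin (Euclidean_space N) T"
    and WT: "\<And>p. p \<in> W \<Longrightarrow> tuple N g p \<in> T" and F: "Cinf_on N T F"
  shows "smooth_fun_on M W (\<lambda>p. F (tuple N g p))"
  unfolding smooth_fun_on_def
proof clarify
  fix V y assume V: "(V, y) \<in> matlas M"
  have y: "local_coords M V y" by (rule atlas_local_coords[OF M V])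
  have t: "tuple N g (inv_into V y z) = tuple N (\<lambda>j z. g j (inv_into V y z)) z" for z
    by (simp add: tuple_def)
  show "Cinf_on (mdim M) (y ` (V \<inter> W)) (\<lambda>z. F (tuple N g (inv_into V y z)))"
    unfolding t
  proof (rule Cinf_on_compose[OF local_coords_open_image[OF y W] T _ F])
    show "tuple N (\<lambda>j z. g j (inv_into V y z)) z \<in> T" if "z \<in> y ` (V \<inter> W)" for z
      using local_coords_inv_image[OF y _ that] WT unfolding t[symmetric] by blast
    show "Cinf_on (mdim M) (y ` (V \<inter> W)) (\<lambda>z. g j (inv_into V y z))" if "j < N" for j
      by (rule smooth_fun_on_chart[OF M W g[OF that] y])
  qed
qed

lemma smooth_fun_on_const: "smooth_fun_on M W (\<lambda>p. c)"
  by (simp add: smooth_fun_on_def Cinf_on_const split_beta)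

lemma smooth_fun_on_add:
  assumes M: "smooth_manifold M" and W: "openin (mtop M) W" and "smooth_fun_on M W f" "smooth_fun_on M W g"
  shows "smooth_fun_on M W (\<lambda>p. f p + g p)"
  unfolding smooth_fun_on_def
proof clarify
  fix V y assume V: "(V, y) \<in> matlas M"
  have y: "local_coords M V y" by (rule atlas_local_coords[OF M V])
  show "Cinf_on (mdim M) (y ` (V \<inter> W)) (\<lambda>z. f (inv_into V y z) + g (inv_into V y z))"
    using assms(3,4) V unfolding smooth_fun_on_def
    by (intro Cinf_on_add[OF local_coords_open_image[OF y W]]) blast+
qed

lemma smooth_fun_on_mult:
  assumes M: "smooth_manifold M" and W: "openin (mtop M) W" and "smooth_fun_on M W f" "smooth_fun_on M W g"
  shows "smooth_fun_on M W (\<lambda>p. f p * g p)"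
  unfolding smooth_fun_on_def
proof clarify
  fix V y assume V: "(V, y) \<in> matlas M"
  have y: "local_coords M V y" by (rule atlas_local_coords[OF M V])
  show "Cinf_on (mdim M) (y ` (V \<inter> W)) (\<lambda>z. f (inv_into V y z) * g (inv_into V y z))"
    using assms(3,4) V unfolding smooth_fun_on_def
    by (intro Cinf_on_mult[OF local_coords_open_image[OF y W]]) blast+
qed

lemma smooth_fun_on_sum:
  assumes "smooth_manifold M" "openin (mtop M) W" "\<And>j. j \<in> A \<Longrightarrow> smooth_fun_on M W (f j)"
  shows "smooth_fun_on M W (\<lambda>p. \<Sum>j\<in>A. f j p)"
  using assms(3)
  by (induction A rule: infinite_finite_induct)
    (auto intro: smooth_fun_on_const smooth_fun_on_add[OF assms(1,2)])

lemma smooth_fun_on_prod: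
  assumes "smooth_manifold M" "openin (mtop M) W" "\<And>j. j \<in> A \<Longrightarrow> smooth_fun_on M W (f j)"
  shows "smooth_fun_on M W (\<lambda>p. \<Prod>j\<in>A. f j p)"
  using assms(3)
  by (induction A rule: infinite_finite_induct)
    (auto intro: smooth_fun_on_const smooth_fun_on_mult[OF assms(1,2)])

lemma smooth_fun_on_inverse:
  assumes M: "smooth_manifold M" and W: "openin (mtop M) W" and g: "smooth_fun_on M W g"
    and nz: "\<And>p. p \<in> W \<Longrightarrow> g p \<noteq> 0"
  shows "smooth_fun_on M W (\<lambda>p. 1 / g p)"
  unfolding smooth_fun_on_def
proof clarify
  fix V y assume V: "(V, y) \<in> matlas M"
  have y: "local_coords M V y" by (rule atlas_local_coords[OF M V])
  show "Cinf_on (mdim M) (y ` (V \<inter> W)) (\<lambda>z. 1 / g (inv_into V y z))"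
  proof (rule Cinf_on_inverse[OF local_coords_open_image[OF y W] smooth_fun_on_chart[OF M W g y]])
    show "g (inv_into V y z) \<noteq> 0" if "z \<in> y ` (V \<inter> W)" for z
      using local_coords_inv_image[OF y _ that] nz by blast
  qed
qed

lemma smooth_fun_on_coord:
  assumes M: "smooth_manifold M" and x: "local_coords M U x"
  shows "smooth_fun_on M U (\<lambda>p. x p j)"
proof (cases "j < mdim M")
  case True
  show ?thesis unfolding smooth_fun_on_def
  proof clarify
    fix V y assume V: "(V, y) \<in> matlas M"
    show "Cinf_on (mdim M) (y ` (V \<inter> U)) (\<lambda>z. x (inv_into V y z) j)"
      using x V True unfolding local_coords_def by (auto simp: Int_commute)
  qed
next
  case False
  show ?thesis
    by (rule smooth_fun_on_cong[OF M local_coords_open[OF x] smooth_fun_on_const[of _ _ 0]])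
      (use local_coords_ES[OF x] False in auto)
qed

lemma smooth_fun_on_compose_chart:
  assumes M: "smooth_manifold M" and x: "local_coords M U x" and W: "openin (mtop M) W" "W \<subseteq> U"
    and F: "Cinf_on (mdim M) (x ` W) F"
  shows "smooth_fun_on M W (\<lambda>p. F (x p))"
proof -
  have UW: "U \<inter> W = W" using W by blast
  have "smooth_fun_on M W (\<lambda>p. F (tuple (mdim M) (\<lambda>j p. x p j) p))"
  proof (rule smooth_fun_on_compose[OF M W(1) _ _ _ F])
    show "smooth_fun_on M W (\<lambda>p. x p j)" for j
      by (rule smooth_fun_on_subset[OF smooth_fun_on_coord[OF M x] W(2)])
    show "openin (Euclidean_space (mdim M)) (x ` W)"
      using local_coords_open_image[OF x W(1)] unfolding UW .
    show "tuple (mdim M) (\<lambda>j p. x p j) p \<in> x ` W" if "p \<in> W" for p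
      using that W(2) by (subst tuple_chart[OF x]) auto
  qed
  then show ?thesis
    by (rule smooth_fun_on_cong[OF M W(1)]) (use W(2) tuple_chart[OF x] in \<open>force\<close>)
qed

lemma smooth_fun_on_open_preimage:
  assumes M: "smooth_manifold M" and W: "openin (mtop M) W" and f: "smooth_fun_on M W f" and B: "open B"
  shows "openin (mtop M) {p \<in> W. f p \<in> B}"
proof (subst openin_subopen, rule ballI)
  fix p assume p: "p \<in> {p \<in> W. f p \<in> B}"
  then have "p \<in> points M" using openin_subset[OF W] by blast
  then obtain U x where x: "(U, x) \<in> matlas M" "p \<in> U" "local_coords M U x" by (rule atlas_at[OF M])
  let ?S = "x ` (U \<inter> W)" let ?F = "\<lambda>z. f (inv_into U x z)"
  have "continuous_on ?S ?F" by (rule Cinf_on_continuous[OF smooth_fun_on_chart[OF M W f x(3)]])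
  then have "openin (top_of_set ?S) (?S \<inter> ?F -` B)" using B continuous_openin_preimage_gen by blast
  then obtain A where A: "open A" "?S \<inter> ?F -` B = ?S \<inter> A" by (auto simp: openin_open)
  obtain C where C: "open C" "?S = C \<inter> ES (mdim M)"
    using local_coords_open_image[OF x(3) W] openin_ES_open by auto
  have "openin (Euclidean_space (mdim M)) (?S \<inter> ?F -` B)"
    unfolding A(2) openin_ES_open using A(1) C by (intro exI[of _ "C \<inter> A"]) auto
  from local_coords_preimage_open[OF x(3) this]
  have "openin (mtop M) {q \<in> U. x q \<in> ?S \<inter> ?F -` B}" .
  moreover have "p \<in> {q \<in> U. x q \<in> ?S \<inter> ?F -` B}" using p x(2) local_coords_inv[OF x(3)] by auto
  moreover have "{q \<in> U. x q \<in> ?S \<inter> ?F -` B} \<subseteq> {p \<in> W. f p \<in> B}"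
    using local_coords_inv[OF x(3)] local_coords_inv_image[OF x(3), of "U \<inter> W"] by fastforce
  ultimately show "\<exists>T. openin (mtop M) T \<and> p \<in> T \<and> T \<subseteq> {p \<in> W. f p \<in> B}" by blast
qed

lemma smooth_fun_on_tuple_open_preimage:
  assumes M: "smooth_manifold M" and W: "openin (mtop M) W"
    and g: "\<And>j. j < N \<Longrightarrow> smooth_fun_on M W (g j)" and T: "openin (Euclidean_space N) T"
  shows "openin (mtop M) {p \<in> W. tuple N g p \<in> T}"
proof (subst openin_subopen, rule ballI)
  fix p assume p: "p \<in> {p \<in> W. tuple N g p \<in> T}"
  obtain d where d: "d > 0" "\<And>w. w \<in> ES N \<Longrightarrow> (\<And>i. i < N \<Longrightarrow> \<bar>w i - tuple N g p i\<bar> < d) \<Longrightarrow> w \<in> T"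
    by (rule openin_ES_boxD[OF T, of "tuple N g p"]) (use p in auto)
  define Q where "Q = W \<inter> (\<Inter>j\<in>{..<N}. {q \<in> W. g j q \<in> ball (g j p) d})"
  have pre: "openin (mtop M) {q \<in> W. g j q \<in> ball (g j p) d}" if "j < N" for j
    by (rule smooth_fun_on_open_preimage[OF M W g[OF that] open_ball])
  have "openin (mtop M) Q"
  \<comment> \<open>For N = 0 the intersection runs over the empty index set.\<close>
  proof (cases "N = 0")
    case True then show ?thesis using W by (simp add: Q_def)
  next
    case False
    then have "{..<N} \<noteq> {}" by auto
    then show ?thesis unfolding Q_def
      by (intro openin_Int[OF W] openin_INT2) (use pre in \<open>auto simp del: mem_ball\<close>)
  qed
  moreover have "p \<in> Q" using p d(1) by (auto simp: Q_def)
  moreover have "Q \<subseteq> {p \<in> W. tuple N g p \<in> T}"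
  proof
    fix q assume q: "q \<in> Q"
    have "tuple N g q \<in> T"
    proof (rule d(2)[OF tuple_ES])
      fix i assume i: "i < N"
      then have "g i q \<in> ball (g i p) d" using q unfolding Q_def by blast
      then show "\<bar>tuple N g q i - tuple N g p i\<bar> < d"
        using i by (simp add: tuple_def dist_real_def abs_minus_commute)
    qed
    then show "q \<in> {p \<in> W. tuple N g p \<in> T}" using q by (simp add: Q_def)
  qed
  ultimately show "\<exists>T'. openin (mtop M) T' \<and> p \<in> T' \<and> T' \<subseteq> {p \<in> W. tuple N g p \<in> T}" by blast
qed

section \<open>Smooth maps between manifolds\<close>

lemma smooth_map_on_point:
  "smooth_map_on M W N F \<Longrightarrow> p \<in> W \<Longrightarrow> W \<subseteq> points M \<Longrightarrow> F p \<in> points N"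
  unfolding smooth_map_on_def continuous_map_def by (auto simp: Pi_iff)

lemma smooth_map_on_open_preimage:
  assumes W: "openin (mtop M) W" and F: "smooth_map_on M W N F" and V: "openin (mtop N) V"
  shows "openin (mtop M) {p \<in> W. F p \<in> V}"
proof -
  have "continuous_map (subtopology (mtop M) W) (mtop N) F" using F by (simp add: smooth_map_on_def)
  from openin_continuous_map_preimage[OF this V]
  have "openin (subtopology (mtop M) W) {p \<in> topspace (subtopology (mtop M) W). F p \<in> V}" .
  moreover have "topspace (subtopology (mtop M) W) = W" using openin_subset[OF W] by auto
  ultimately have "openin (subtopology (mtop M) W) {p \<in> W. F p \<in> V}" by (simp only:)
  then show ?thesis by (rule openin_trans_full[OF _ W])
qed

text \<open>Smooth maps are tested on chart components of the target, and f o F is the coordinate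
  expression of f applied to these components.\<close>

lemma smooth_fun_on_pullback:
  assumes M: "smooth_manifold M" and N: "smooth_manifold N" and W: "openin (mtop M) W"
    and F: "smooth_map_on M W N F" and V: "openin (mtop N) V" and f: "smooth_fun_on N V f"
  shows "smooth_fun_on M {p \<in> W. F p \<in> V} (\<lambda>p. f (F p))"
proof (rule smooth_fun_on_local[OF M smooth_map_on_open_preimage[OF W F V]])
  fix p assume p: "p \<in> {p \<in> W. F p \<in> V}"
  then have "F p \<in> points N" using openin_subset[OF V] by blast
  then obtain Q y where y: "(Q, y) \<in> matlas N" "F p \<in> Q" "local_coords N Q y" by (rule atlas_at[OF N])
  let ?W = "{p \<in> W. F p \<in> V \<inter> Q}"
  have WO: "openin (mtop M) ?W"
    by (rule smooth_map_on_open_preimage[OF W F openin_Int[OF V local_coords_open[OF y(3)]]])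
  have t: "tuple (mdim N) (\<lambda>j p. y (F p) j) q = y (F q)" if "q \<in> ?W" for q
    by (rule tuple_eq[OF local_coords_ES[OF y(3)]]) (use that in auto)
  have "smooth_fun_on M ?W (\<lambda>p. f (inv_into Q y (tuple (mdim N) (\<lambda>j p. y (F p) j) p)))"
  proof (rule smooth_fun_on_compose[OF M WO])
    show "smooth_fun_on M ?W (\<lambda>p. y (F p) j)" if "j < mdim N" for j
    proof (rule smooth_fun_on_subset)
      show "smooth_fun_on M {p \<in> W. F p \<in> Q} (\<lambda>p. y (F p) j)"
        using F y(1) that unfolding smooth_map_on_def by blast
    qed blast
    show "openin (Euclidean_space (mdim N)) (y ` (Q \<inter> V))" by (rule local_coords_open_image[OF y(3) V])
    show "tuple (mdim N) (\<lambda>j p. y (F p) j) q \<in> y ` (Q \<inter> V)" if "q \<in> ?W" for q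
      unfolding t[OF that] using that by blast
    show "Cinf_on (mdim N) (y ` (Q \<inter> V)) (\<lambda>z. f (inv_into Q y z))"
      by (rule smooth_fun_on_chart[OF N V f y(3)])
  qed
  then have "smooth_fun_on M ?W (\<lambda>p. f (F p))"
  proof (rule smooth_fun_on_cong[OF M WO])
    show "f (inv_into Q y (tuple (mdim N) (\<lambda>j p. y (F p) j) q)) = f (F q)" if "q \<in> ?W" for q
      unfolding t[OF that] using local_coords_inv[OF y(3)] that by simp
  qed
  then have "smooth_fun_on M ({p \<in> W. F p \<in> V} \<inter> ?W) (\<lambda>p. f (F p))"
    by (rule smooth_fun_on_subset) blast
  then show "\<exists>W'. openin (mtop M) W' \<and> p \<in> W' \<and> smooth_fun_on M ({p \<in> W. F p \<in> V} \<inter> W') (\<lambda>p. f (F p))"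
    by (intro exI[of _ ?W] conjI WO) (use p y(2) in blast)+
qed

lemma smooth_map_onI:
  assumes M: "smooth_manifold M" and N: "smooth_manifold N" and W: "openin (mtop M) W"
    and loc: "\<And>p. p \<in> W \<Longrightarrow> \<exists>W' V y. openin (mtop M) W' \<and> p \<in> W' \<and> W' \<subseteq> W \<and> local_coords N V y \<and> F ` W' \<subseteq> V \<and>
      (\<forall>j<mdim N. smooth_fun_on M W' (\<lambda>q. y (F q) j))"
  shows "smooth_map_on M W N F"
proof -
  let ?n = "mdim N"
  have key: "\<exists>W' V y. openin (mtop M) W' \<and> p \<in> W' \<and> W' \<subseteq> W \<and> local_coords N V y \<and> F ` W' \<subseteq> V \<and>
      (\<forall>j<?n. smooth_fun_on M W' (\<lambda>q. y (F q) j)) \<and> (\<forall>q\<in>W'. tuple ?n (\<lambda>j q. y (F q) j) q = y (F q))"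
    if p: "p \<in> W" for p
  proof -
    obtain W' V y where *: "openin (mtop M) W'" "p \<in> W'" "W' \<subseteq> W" "local_coords N V y" "F ` W' \<subseteq> V"
      "\<forall>j<?n. smooth_fun_on M W' (\<lambda>q. y (F q) j)" using loc[OF p] by blast
    have "tuple ?n (\<lambda>j q. y (F q) j) q = y (F q)" if "q \<in> W'" for q
      by (rule tuple_eq[OF local_coords_ES[OF *(4)]]) (use *(5) that in auto)
    then show ?thesis using * by (intro exI conjI) auto
  qed
  have pre: "openin (mtop M) {p \<in> W. F p \<in> A}" if A: "openin (mtop N) A" for A
  proof (subst openin_subopen, rule ballI)
    fix p assume p: "p \<in> {p \<in> W. F p \<in> A}"
    then obtain W' V y where *: "openin (mtop M) W'" "p \<in> W'" "W' \<subseteq> W" "local_coords N V y" "F ` W' \<subseteq> V"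
      "\<forall>j<?n. smooth_fun_on M W' (\<lambda>q. y (F q) j)" "\<forall>q\<in>W'. tuple ?n (\<lambda>j q. y (F q) j) q = y (F q)"
      using key[of p] by blast
    let ?T = "{q \<in> W'. tuple ?n (\<lambda>j q. y (F q) j) q \<in> y ` (V \<inter> A)}"
    have "openin (mtop M) ?T"
      by (rule smooth_fun_on_tuple_open_preimage[OF M *(1) _ local_coords_open_image[OF *(4) A]])
        (use *(6) in blast)
    moreover have "p \<in> ?T" using p *(2,5,7) by auto
    moreover have "?T \<subseteq> {p \<in> W. F p \<in> A}"
      using *(3,5,7) local_coords_inj[OF *(4)] unfolding inj_on_def by fastforce
    ultimately show "\<exists>T. openin (mtop M) T \<and> p \<in> T \<and> T \<subseteq> {p \<in> W. F p \<in> A}" by blast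
  qed
  have top: "topspace (subtopology (mtop M) W) = W" using openin_subset[OF W] by auto
  show ?thesis unfolding smooth_map_on_def
  proof (intro conjI)
    have "F p \<in> points N" if p: "p \<in> W" for p
    proof -
      obtain W' V y where "p \<in> W'" "local_coords N V y" "F ` W' \<subseteq> V" using loc[OF p] by blast
      then show ?thesis using openin_subset[OF local_coords_open] by blast
    qed
    moreover have "openin (subtopology (mtop M) W) {p \<in> W. F p \<in> A}" if "openin (mtop N) A" for A
      using pre[OF that] by (auto simp: openin_subtopology_alt intro!: image_eqI[where x = "{p \<in> W. F p \<in> A}"])
    ultimately show "continuous_map (subtopology (mtop M) W) (mtop N) F"
      unfolding continuous_map_def top by auto
    show "\<forall>(V, y)\<in>matlas N. \<forall>j<mdim N. smooth_fun_on M {p \<in> W. F p \<in> V} (\<lambda>p. y (F p) j)"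
    proof clarify
      fix Q y' j assume Q: "(Q, y') \<in> matlas N" "j < mdim N"
      have y': "local_coords N Q y'" by (rule atlas_local_coords[OF N Q(1)])
      note QO = pre[OF local_coords_open[OF y']]
      show "smooth_fun_on M {p \<in> W. F p \<in> Q} (\<lambda>p. y' (F p) j)"
      proof (rule smooth_fun_on_local[OF M QO])
        fix p assume p: "p \<in> {p \<in> W. F p \<in> Q}"
        then obtain W' V y where *: "openin (mtop M) W'" "p \<in> W'" "W' \<subseteq> W" "local_coords N V y" "F ` W' \<subseteq> V"
          "\<forall>j<?n. smooth_fun_on M W' (\<lambda>q. y (F q) j)" "\<forall>q\<in>W'. tuple ?n (\<lambda>j q. y (F q) j) q = y (F q)"
          using key[of p] by blast
        let ?Z = "{p \<in> W. F p \<in> Q} \<inter> W'"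
        have ZO: "openin (mtop M) ?Z" by (rule openin_Int[OF QO *(1)])
        have "smooth_fun_on M ?Z (\<lambda>p. y' (inv_into V y (tuple ?n (\<lambda>j q. y (F q) j) p)) j)"
        proof (rule smooth_fun_on_compose[OF M ZO _ local_coords_open_image[OF *(4) local_coords_open[OF y']]])
          show "smooth_fun_on M ?Z (\<lambda>q. y (F q) i)" if "i < ?n" for i
            by (rule smooth_fun_on_subset[of _ W']) (use *(6) that in auto)
          show "tuple ?n (\<lambda>j q. y (F q) j) q \<in> y ` (V \<inter> Q)" if "q \<in> ?Z" for q
            using that *(5,7) by auto
          show "Cinf_on ?n (y ` (V \<inter> Q)) (\<lambda>z. y' (inv_into V y z) j)"
            by (rule smooth_fun_on_chart[OF N local_coords_open[OF y'] smooth_fun_on_coord[OF N y'] *(4)])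
        qed
        then have "smooth_fun_on M ?Z (\<lambda>p. y' (F p) j)"
        proof (rule smooth_fun_on_cong[OF M ZO])
          show "y' (inv_into V y (tuple ?n (\<lambda>j q. y (F q) j) q)) j = y' (F q) j" if q: "q \<in> ?Z" for q
          proof -
            have "tuple ?n (\<lambda>j q. y (F q) j) q = y (F q)" "F q \<in> V" using q *(5,7) by auto
            then show ?thesis using local_coords_inv[OF *(4)] by simp
          qed
        qed
        then show "\<exists>W'. openin (mtop M) W' \<and> p \<in> W' \<and> smooth_fun_on M ({p \<in> W. F p \<in> Q} \<inter> W') (\<lambda>p. y' (F p) j)"
          using *(1,2) by (intro exI[of _ W'] conjI)
      qed
    qed
  qed
qed

section \<open>Bump functions and extension of smooth functions\<close>

text \<open>A coordinate bump carried over by a chart. The compact set K is closed because M is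
  Hausdorff, so its complement is open and the extension by 0 is smooth there.\<close>

lemma smooth_bump:
  assumes M: "smooth_manifold M" and W: "openin (mtop M) W" and p: "p \<in> W"
  obtains b K W' where "smooth_fun_on M (points M) b" "closedin (mtop M) K" "K \<subseteq> W"
    "\<And>q. q \<notin> K \<Longrightarrow> b q = 0" "openin (mtop M) W'" "p \<in> W'" "W' \<subseteq> K" "\<And>q. q \<in> W' \<Longrightarrow> b q = 1"
proof -
  let ?n = "mdim M"
  have "p \<in> points M" using p openin_subset[OF W] by blast
  then obtain U x where x: "(U, x) \<in> matlas M" "p \<in> U" "local_coords M U x" by (rule atlas_at[OF M])
  have xp: "x p \<in> x ` (U \<inter> W)" using x(2) p by blast
  obtain \<beta> K0 d where \<beta>: "Cinf_on ?n (ES ?n) \<beta>" "d > 0" "compact K0" "K0 \<subseteq> x ` (U \<inter> W)"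
    "\<And>w. w \<in> ES ?n \<Longrightarrow> w \<notin> K0 \<Longrightarrow> \<beta> w = 0"
    "\<And>w. w \<in> ES ?n \<Longrightarrow> (\<And>i. i < ?n \<Longrightarrow> \<bar>w i - x p i\<bar> < d) \<Longrightarrow> \<beta> w = 1 \<and> w \<in> K0"
    by (rule Cinf_on_bump[OF local_coords_open_image[OF x(3) W] xp]) blast
  define b where "b q = (if q \<in> U then \<beta> (x q) else 0)" for q
  define K where "K = {q \<in> U. x q \<in> K0}"
  define T where "T = {w. \<forall>i<?n. \<bar>w i - x p i\<bar> < d} \<inter> ES ?n"
  have TO: "openin (Euclidean_space ?n) T" unfolding T_def openin_ES_open using open_box_fun by blast
  define W' where "W' = {q \<in> U. x q \<in> T}"
  have KW: "K \<subseteq> W" using \<beta>(4) local_coords_inj[OF x(3)] unfolding K_def inj_on_def by blast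
  have xK: "x ` K = K0" using \<beta>(4) unfolding K_def by auto
  have "compactin (subtopology (mtop M) U) K"
  proof (subst homeomorphic_map_compactness_eq)
    show "homeomorphic_map (subtopology (mtop M) U) (subtopology (Euclidean_space ?n) (x ` U)) x"
      using x(3) by (simp add: local_coords_def)
    have "K0 \<subseteq> ES ?n" using \<beta>(4) local_coords_ES[OF x(3)] by blast
    then have "compactin (Euclidean_space ?n) K0"
      using \<beta>(3) by (simp add: Euclidean_space_def compactin_subtopology euclidean_product_topology)
    moreover have "K0 \<subseteq> x ` U" using \<beta>(4) by blast
    moreover have "K \<subseteq> points M \<inter> U" using KW openin_subset[OF W] unfolding K_def by blast
    ultimately show "K \<subseteq> topspace (subtopology (mtop M) U) \<and> compactin (subtopology (Euclidean_space ?n) (x ` U)) (x ` K)"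
      unfolding xK by (simp add: compactin_subtopology)
  qed
  then have "compactin (mtop M) K" by (simp add: compactin_subtopology)
  then have Kc: "closedin (mtop M) K"
    using M compactin_imp_closedin unfolding smooth_manifold_def by blast
  have b0: "b q = 0" if "q \<notin> K" for q
    using that \<beta>(5) local_coords_ES[OF x(3)] by (auto simp: b_def K_def)
  show thesis
  proof (rule that)
    show "smooth_fun_on M (points M) b"
    proof (rule smooth_fun_on_local[OF M openin_topspace])
      fix q assume q: "q \<in> points M"
      show "\<exists>V. openin (mtop M) V \<and> q \<in> V \<and> smooth_fun_on M (points M \<inter> V) b"
      proof (cases "q \<in> U")
        case True
        have xE: "x ` U \<subseteq> ES ?n" using local_coords_ES[OF x(3)] by blast
        have "smooth_fun_on M U (\<lambda>p. \<beta> (x p))"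
          by (rule smooth_fun_on_compose_chart[OF M x(3) local_coords_open[OF x(3)] subset_refl Cinf_on_mono[OF \<beta>(1) xE]])
        then have "smooth_fun_on M U b"
          by (rule smooth_fun_on_cong[OF M local_coords_open[OF x(3)]]) (simp add: b_def)
        then have "smooth_fun_on M (points M \<inter> U) b" by (rule smooth_fun_on_subset) blast
        then show ?thesis using True local_coords_open[OF x(3)] by (intro exI[of _ U] conjI)
      next
        case False
        have KO: "openin (mtop M) (points M - K)" using Kc by blast
        have "smooth_fun_on M (points M - K) b"
          by (rule smooth_fun_on_cong[OF M KO smooth_fun_on_const[of _ _ 0]]) (use b0 in auto)
        then have "smooth_fun_on M (points M \<inter> (points M - K)) b" by (rule smooth_fun_on_subset) blast
        moreover have "q \<in> points M - K" using q False by (simp add: K_def)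
        ultimately show ?thesis using KO by (intro exI[of _ "points M - K"] conjI)
      qed
    qed
    show "openin (mtop M) W'" unfolding W'_def by (rule local_coords_preimage_open[OF x(3) TO])
    show "p \<in> W'" unfolding W'_def T_def using x(2) local_coords_ES[OF x(3,2)] \<beta>(2) by auto
    have *: "b q = 1 \<and> q \<in> K" if "q \<in> W'" for q
    proof -
      have q: "q \<in> U" "x q \<in> ES ?n" "\<And>i. i < ?n \<Longrightarrow> \<bar>x q i - x p i\<bar> < d"
        using that unfolding W'_def T_def by blast+
      show ?thesis using \<beta>(6)[OF q(2,3)] q(1) by (simp add: b_def K_def)
    qed
    show "W' \<subseteq> K" using * by blast
    show "b q = 1" if "q \<in> W'" for q using *[OF that] ..
  qed (rule Kc, rule KW, rule b0)
qed

text \<open>V is covered by V \<inter> W, where the function is a product, and by the complement of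
  K, where it is 0. A general V is allowed because the components of a form are tested on the domain
  of every local basis.\<close>

lemma smooth_fun_on_cutoff_on:
  assumes M: "smooth_manifold M" and V: "openin (mtop M) V" and W: "openin (mtop M) W" and f: "smooth_fun_on M (V \<inter> W) f"
    and b: "smooth_fun_on M (points M) b" and K: "closedin (mtop M) K" "K \<subseteq> W" "\<And>q. q \<notin> K \<Longrightarrow> b q = 0"
  shows "smooth_fun_on M V (\<lambda>q. if q \<in> W then b q * f q else 0)" (is "smooth_fun_on M _ ?g")
proof (rule smooth_fun_on_local[OF M V])
  fix q assume q: "q \<in> V"
  have VW: "openin (mtop M) (V \<inter> W)" by (rule openin_Int[OF V W])
  show "\<exists>U. openin (mtop M) U \<and> q \<in> U \<and> smooth_fun_on M (V \<inter> U) ?g"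
  proof (cases "q \<in> W")
    case True
    have "smooth_fun_on M (V \<inter> W) (\<lambda>q. b q * f q)"
      by (rule smooth_fun_on_mult[OF M VW smooth_fun_on_subset[OF b] f]) (rule openin_subset[OF VW])
    then have "smooth_fun_on M (V \<inter> W) ?g" by (rule smooth_fun_on_cong[OF M VW]) simp
    then show ?thesis using True W by (intro exI[of _ W] conjI)
  next
    case False
    have KO: "openin (mtop M) (points M - K)" using K(1) by blast
    have "smooth_fun_on M (V \<inter> (points M - K)) ?g"
      by (rule smooth_fun_on_cong[OF M openin_Int[OF V KO] smooth_fun_on_const[of _ _ 0]]) (simp add: K(3))
    moreover have "q \<in> points M - K" using q False K(2) openin_subset[OF V] by blast
    ultimately show ?thesis using KO by (intro exI[of _ "points M - K"] conjI)
  qed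
qed

lemma smooth_fun_on_cutoff:
  assumes M: "smooth_manifold M" and W: "openin (mtop M) W" and f: "smooth_fun_on M W f"
    and b: "smooth_fun_on M (points M) b" and K: "closedin (mtop M) K" "K \<subseteq> W" "\<And>q. q \<notin> K \<Longrightarrow> b q = 0"
  shows "smooth_fun_on M (points M) (\<lambda>q. if q \<in> W then b q * f q else 0)"
  by (rule smooth_fun_on_cutoff_on[OF M openin_topspace W smooth_fun_on_subset[OF f Int_lower2] b K])

lemma smooth_fun_extend:
  assumes M: "smooth_manifold M" and W: "openin (mtop M) W" and p: "p \<in> W" and f: "smooth_fun_on M W f"
  obtains g W' where "smooth_fun_on M (points M) g" "openin (mtop M) W'" "p \<in> W'" "W' \<subseteq> W"
    "\<And>q. q \<in> W' \<Longrightarrow> g q = f q"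
proof -
  obtain b K W' where b: "smooth_fun_on M (points M) b" "closedin (mtop M) K" "K \<subseteq> W"
    "\<And>q. q \<notin> K \<Longrightarrow> b q = 0" "openin (mtop M) W'" "p \<in> W'" "W' \<subseteq> K" "\<And>q. q \<in> W' \<Longrightarrow> b q = 1"
    by (rule smooth_bump[OF M W p]) blast
  show thesis
    by (rule that[OF smooth_fun_on_cutoff[OF M W f b(1-4)] b(5,6)]) (use b(3,7,8) in auto)
qed

section \<open>Smoothness of determinants and inverse matrices\<close>

lemma smooth_fun_on_det:
  assumes M: "smooth_manifold M" and W: "openin (mtop M) W"
    and A: "\<And>i j. i < k \<Longrightarrow> j < k \<Longrightarrow> smooth_fun_on M W (A i j)"
  shows "smooth_fun_on M W (\<lambda>q. Determinant.det (Matrix.mat k k (\<lambda>(i, j). A i j q)))"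
proof -
  have "smooth_fun_on M W (\<lambda>q. \<Sum>p | p permutes {0..<k}. signof p * (\<Prod>i = 0..<k. A i (p i) q))"
  proof (intro smooth_fun_on_sum[OF M W] smooth_fun_on_mult[OF M W] smooth_fun_on_prod[OF M W] smooth_fun_on_const A)
    fix p i assume "p \<in> {p. p permutes {0..<k}}" "i \<in> {0..<k}"
    then show "i < k" "p i < k" using permutes_in_image[of p "{0..<k}" i] by auto
  qed
  moreover have "Determinant.det (Matrix.mat k k (\<lambda>(i, j). A i j q)) = (\<Sum>p | p permutes {0..<k}. signof p * (\<Prod>i = 0..<k. A i (p i) q))" for q
  proof -
    have "(\<Prod>i = 0..<k. Matrix.mat k k (\<lambda>(i, j). A i j q) $$ (i, p i)) = (\<Prod>i = 0..<k. A i (p i) q)"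
      if "p permutes {0..<k}" for p
      using permutes_in_image[OF that] by (intro prod.cong) auto
    then show ?thesis by (subst det_def'[of _ k]) (auto intro: sum.cong)
  qed
  ultimately show ?thesis by simp
qed

text \<open>Cramer's rule. B is given as a pointwise inverse; multiplying A B = 1 by the adjugate
  shows that (det A) B is the adjugate of A, whose entries are polynomials in the entries of
  A.\<close>

lemma smooth_fun_on_matrix_inverse:
  fixes A B :: "nat \<Rightarrow> nat \<Rightarrow> 'm \<Rightarrow> real"
  assumes M: "smooth_manifold M" and W: "openin (mtop M) W"
    and A: "\<And>i j. i < k \<Longrightarrow> j < k \<Longrightarrow> smooth_fun_on M W (A i j)"
    and AB: "\<And>q i j. q \<in> W \<Longrightarrow> i < k \<Longrightarrow> j < k \<Longrightarrow> (\<Sum>l<k. A i l q * B l j q) = (if i = j then 1 else 0)"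
    and i: "i < k" and j: "j < k"
  shows "smooth_fun_on M W (B i j)"
proof -
  define MA where "MA q = Matrix.mat k k (\<lambda>(i, j). A i j q)" for q
  define MB where "MB q = Matrix.mat k k (\<lambda>(i, j). B i j q)" for q
  have cA: "MA q \<in> carrier_mat k k" and cB: "MB q \<in> carrier_mat k k" for q
    by (auto simp: MA_def MB_def)
  have prod: "MA q * MB q = 1\<^sub>m k" if q: "q \<in> W" for q
  proof (rule eq_matI)
    fix a b assume "a < dim_row (1\<^sub>m k :: real mat)" "b < dim_col (1\<^sub>m k :: real mat)"
    then have ab: "a < k" "b < k" by auto
    have "(MA q * MB q) $$ (a, b) = (\<Sum>l = 0..<k. A a l q * B l b q)"
      using ab by (simp add: MA_def MB_def scalar_prod_def)
    also have "\<dots> = 1\<^sub>m k $$ (a, b)" using AB[OF q ab] ab by (simp add: atLeast0LessThan)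
    finally show "(MA q * MB q) $$ (a, b) = 1\<^sub>m k $$ (a, b)" .
  qed (auto simp: MA_def MB_def)
  have det: "Determinant.det (MA q) \<noteq> 0" if "q \<in> W" for q
    using det_mult[OF cA cB, of q q] prod[OF that] by auto
  have Bq: "B i j q = (-1) ^ (j + i) * Determinant.det (mat_delete (MA q) j i) * (1 / Determinant.det (MA q))" if q: "q \<in> W" for q
  proof -
    have c: "adj_mat (MA q) \<in> carrier_mat k k" by (rule adj_mat(1)[OF cA])
    have "Determinant.det (MA q) \<cdot>\<^sub>m MB q = (adj_mat (MA q) * MA q) * MB q"
      unfolding adj_mat(3)[OF cA] by (simp add: mult_smult_assoc_mat[OF one_carrier_mat cB] left_mult_one_mat[OF cB])
    also have "\<dots> = adj_mat (MA q)"
      using assoc_mult_mat[OF c cA cB] prod[OF q] c by (simp add: right_mult_one_mat)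
    finally have "(Determinant.det (MA q) \<cdot>\<^sub>m MB q) $$ (i, j) = adj_mat (MA q) $$ (i, j)" by simp
    then have "Determinant.det (MA q) * B i j q = cofactor (MA q) j i"
      using i j cA[of q] by (simp add: MB_def adj_mat_def)
    then show ?thesis using det[OF q] by (simp add: cofactor_def field_simps)
  qed
  have "smooth_fun_on M W (\<lambda>q. Determinant.det (mat_delete (MA q) j i))"
  proof -
    \<comment> \<open>Row j and column i are skipped by shifting the later indices by one, so the
      minor is again the determinant of a matrix of smooth functions.\<close>
    let ?A = "\<lambda>a b. A (if a < j then a else Suc a) (if b < i then b else Suc b)"
    have "smooth_fun_on M W (\<lambda>q. Determinant.det (Matrix.mat (k - 1) (k - 1) (\<lambda>(a, b). ?A a b q)))"
      by (rule smooth_fun_on_det[OF M W], rule A) auto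
    moreover have "mat_delete (MA q) j i = Matrix.mat (k - 1) (k - 1) (\<lambda>(a, b). ?A a b q)" for q
      by (rule eq_matI) (auto simp: mat_delete_def MA_def)
    ultimately show ?thesis by simp
  qed
  moreover have "smooth_fun_on M W (\<lambda>q. Determinant.det (MA q))"
    unfolding MA_def by (rule smooth_fun_on_det[OF M W A])
  ultimately have "smooth_fun_on M W (\<lambda>q. (-1) ^ (j + i) * Determinant.det (mat_delete (MA q) j i) * (1 / Determinant.det (MA q)))"
    by (intro smooth_fun_on_mult[OF M W] smooth_fun_on_const smooth_fun_on_inverse[OF M W] det)
  then show ?thesis by (rule smooth_fun_on_cong[OF M W]) (simp add: Bq)
qed

section \<open>Vector bundles\<close>

lemma openin_points_subset: "openin (mtop M) U \<Longrightarrow> p \<in> U \<Longrightarrow> p \<in> points M"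
  using openin_subset by blast

locale vbundle =
  fixes E :: "('m, 'e, 'z) vbundle_scheme"
  assumes vb: "vector_bundle E"
begin

abbreviation "B \<equiv> vbase E"
abbreviation "T \<equiv> vtotal E"
abbreviation "n \<equiv> mdim (vbase E)"
abbreviation "k \<equiv> vrank E"
abbreviation "yc \<equiv> basis_coord E"

lemma base_manifold: "smooth_manifold B" and total_manifold: "smooth_manifold T"
  and mdim_total: "mdim T = n + k" and vproj_smooth: "smooth_map_on T (points T) B (vproj E)"
  using vb by (auto simp: vector_bundle_def)

lemma fibre_vs: "m \<in> points B \<Longrightarrow> real_vector_space_on (fibre E m) (vadd E) (vscale E) (vzero E m)"
  using vb by (auto simp: vector_bundle_def)

lemma vproj_base: "v \<in> points T \<Longrightarrow> vproj E v \<in> points B"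
  by (rule smooth_map_on_point[OF vproj_smooth]) auto

lemma fibre_self: "v \<in> points T \<Longrightarrow> v \<in> fibre E (vproj E v)"
  by (simp add: fibre_def)

lemma fibre_vproj: "v \<in> fibre E m \<Longrightarrow> vproj E v = m"
  by (simp add: fibre_def)

lemma fibre_total: "v \<in> fibre E m \<Longrightarrow> v \<in> points T"
  by (simp add: fibre_def)

lemma fibre_base: "v \<in> fibre E m \<Longrightarrow> m \<in> points B"
  using vproj_base by (auto simp: fibre_def)

context
  fixes m assumes m: "m \<in> points B"
begin

lemmas vs_axioms = fibre_vs[OF m, unfolded real_vector_space_on_def]
lemmas vzero_fibre = vs_axioms[THEN conjunct1, rule_format]
lemmas vadd_fibre = vs_axioms[THEN conjunct2, THEN conjunct1, rule_format]
lemmas vscale_fibre = vs_axioms[THEN conjunct2, THEN conjunct2, THEN conjunct1, rule_format]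
lemmas vadd_assoc = vs_axioms[THEN conjunct2, THEN conjunct2, THEN conjunct2, THEN conjunct1, rule_format]
lemmas vadd_comm = vs_axioms[THEN conjunct2, THEN conjunct2, THEN conjunct2, THEN conjunct2, THEN conjunct1, rule_format]
lemmas vadd_vzero_left = vs_axioms[THEN conjunct2, THEN conjunct2, THEN conjunct2, THEN conjunct2, THEN conjunct2, THEN conjunct1, rule_format]
lemmas vadd_inverse = vs_axioms[THEN conjunct2, THEN conjunct2, THEN conjunct2, THEN conjunct2, THEN conjunct2, THEN conjunct2, THEN conjunct1, rule_format]
lemmas vscale_vadd = vs_axioms[THEN conjunct2, THEN conjunct2, THEN conjunct2, THEN conjunct2, THEN conjunct2, THEN conjunct2, THEN conjunct2, THEN conjunct1, rule_format]
lemmas vscale_add = vs_axioms[THEN conjunct2, THEN conjunct2, THEN conjunct2, THEN conjunct2, THEN conjunct2, THEN conjunct2, THEN conjunct2, THEN conjunct2, THEN conjunct1, rule_format]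
lemmas vscale_mult = vs_axioms[THEN conjunct2, THEN conjunct2, THEN conjunct2, THEN conjunct2, THEN conjunct2, THEN conjunct2, THEN conjunct2, THEN conjunct2, THEN conjunct2, THEN conjunct1, rule_format]
lemmas vscale_1 = vs_axioms[THEN conjunct2, THEN conjunct2, THEN conjunct2, THEN conjunct2, THEN conjunct2, THEN conjunct2, THEN conjunct2, THEN conjunct2, THEN conjunct2, THEN conjunct2, rule_format]

lemma vadd_vzero_right: "u \<in> fibre E m \<Longrightarrow> vadd E u (vzero E m) = u"
  using vadd_comm[OF _ vzero_fibre] vadd_vzero_left by simp

lemma vscale_0: assumes u: "u \<in> fibre E m" shows "vscale E 0 u = vzero E m"
proof -
  let ?a = "vscale E 0 u"
  have a: "?a \<in> fibre E m" by (rule vscale_fibre[OF u])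
  obtain b where b: "b \<in> fibre E m" "vadd E ?a b = vzero E m" using vadd_inverse[OF a] by blast
  have "vadd E ?a ?a = ?a" using vscale_add[OF u, of 0 0] by simp
  then have "vadd E ?a b = vadd E ?a (vadd E ?a b)" using vadd_assoc[OF a a b(1)] by simp
  then show ?thesis unfolding b(2) using vadd_vzero_right[OF a] by simp
qed

lemma vscale_vzero: "vscale E c (vzero E m) = vzero E m"
  using vscale_mult[OF vzero_fibre, of c 0] vscale_0[OF vzero_fibre] by simp

lemma vadd_medial:
  assumes "a \<in> fibre E m" "b \<in> fibre E m" "c \<in> fibre E m" "d \<in> fibre E m"
  shows "vadd E (vadd E a b) (vadd E c d) = vadd E (vadd E a c) (vadd E b d)"
proof -
  have "vadd E (vadd E a b) (vadd E c d) = vadd E a (vadd E (vadd E b c) d)"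
    using assms by (simp add: vadd_assoc vadd_fibre)
  also have "vadd E b c = vadd E c b" using assms by (simp add: vadd_comm)
  also have "vadd E a (vadd E (vadd E c b) d) = vadd E (vadd E a c) (vadd E b d)"
    using assms by (simp add: vadd_assoc vadd_fibre)
  finally show ?thesis .
qed

lemma lincomb_fibre: "(\<And>\<alpha>. \<alpha> < r \<Longrightarrow> f \<alpha> \<in> fibre E m) \<Longrightarrow> lincomb E m r c f \<in> fibre E m"
  by (induction r) (auto intro: vzero_fibre vadd_fibre vscale_fibre)

lemma lincomb_add:
  "(\<And>\<alpha>. \<alpha> < r \<Longrightarrow> f \<alpha> \<in> fibre E m) \<Longrightarrow>
    lincomb E m r (\<lambda>\<alpha>. c \<alpha> + d \<alpha>) f = vadd E (lincomb E m r c f) (lincomb E m r d f)"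
  by (induction r) (auto simp: vadd_vzero_left vzero_fibre vscale_add vadd_medial lincomb_fibre vscale_fibre)

lemma lincomb_scale:
  "(\<And>\<alpha>. \<alpha> < r \<Longrightarrow> f \<alpha> \<in> fibre E m) \<Longrightarrow> lincomb E m r (\<lambda>\<alpha>. s * c \<alpha>) f = vscale E s (lincomb E m r c f)"
  by (induction r) (auto simp: vscale_vzero vscale_vadd vscale_mult lincomb_fibre vscale_fibre)

lemma lincomb_0: "(\<And>\<alpha>. \<alpha> < r \<Longrightarrow> f \<alpha> \<in> fibre E m) \<Longrightarrow> lincomb E m r (\<lambda>\<alpha>. 0) f = vzero E m"
  by (induction r) (auto simp: vscale_0 vadd_vzero_left vzero_fibre)

end

section \<open>Components of vectors in a frame\<close>

lemma lincomb_cong: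
  "(\<And>\<alpha>. \<alpha> < r \<Longrightarrow> c \<alpha> = d \<alpha>) \<Longrightarrow> (\<And>\<alpha>. \<alpha> < r \<Longrightarrow> f \<alpha> = g \<alpha>) \<Longrightarrow> lincomb E m r c f = lincomb E m r d g"
  by (induction r) auto

lemma lincomb_delta:
  assumes m: "m \<in> points B" and f: "\<And>\<alpha>. \<alpha> < r \<Longrightarrow> f \<alpha> \<in> fibre E m" and "\<beta> < r"
  shows "lincomb E m r (\<lambda>\<alpha>. if \<alpha> = \<beta> then 1 else 0) f = f \<beta>"
  using f assms(3)
proof (induction r)
  case (Suc r)
  show ?case
  proof (cases "\<beta> = r")
    case True
    have "lincomb E m r (\<lambda>\<alpha>. if \<alpha> = \<beta> then 1 else 0) f = lincomb E m r (\<lambda>\<alpha>. 0) f"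
      by (rule lincomb_cong) (auto simp: True)
    also have "\<dots> = vzero E m" by (rule lincomb_0[OF m]) (use Suc.prems in auto)
    finally show ?thesis using Suc.prems(1)[of r] True by (simp add: vscale_1[OF m] vadd_vzero_left[OF m])
  next
    case False
    then have "\<beta> < r" using Suc.prems by simp
    then show ?thesis
      using Suc.IH Suc.prems(1) False by (simp add: vscale_0[OF m] vadd_vzero_right[OF m])
  qed
qed simp

text \<open>The basis condition at a single point, separated from the smoothness of the sections and
  the openness of their domain, so that the linear algebra of one fibre can be done on its
  own.\<close>

definition frame :: "(nat \<Rightarrow> 'm \<Rightarrow> 'e) \<Rightarrow> 'm \<Rightarrow> bool" where
  "frame e m \<longleftrightarrow> fibre_basis E m (\<lambda>\<alpha>. e \<alpha> m)"

lemma frame_fibre: "frame e m \<Longrightarrow> \<alpha> < k \<Longrightarrow> e \<alpha> m \<in> fibre E m"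
  by (simp add: frame_def fibre_basis_def)

lemma frame_lincomb_fibre: "m \<in> points B \<Longrightarrow> frame e m \<Longrightarrow> lincomb E m k c (\<lambda>\<alpha>. e \<alpha> m) \<in> fibre E m"
  by (rule lincomb_fibre) (auto intro: frame_fibre)

lemma frame_coord:
  assumes b: "frame e m" and v: "v \<in> fibre E m"
  shows "\<alpha> \<ge> k \<Longrightarrow> yc e v \<alpha> = 0" "lincomb E m k (yc e v) (\<lambda>\<alpha>. e \<alpha> m) = v"
proof -
  have "\<exists>!c. (\<forall>\<alpha>\<ge>k. c \<alpha> = 0) \<and> v = lincomb E m k c (\<lambda>\<alpha>. e \<alpha> m)"
    using b v unfolding frame_def fibre_basis_def by simp
  from theI'[OF this] have *: "(\<forall>\<alpha>\<ge>k. yc e v \<alpha> = 0) \<and> v = lincomb E m k (yc e v) (\<lambda>\<alpha>. e \<alpha> m)"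
    unfolding basis_coord_def fibre_vproj[OF v] .
  show "\<alpha> \<ge> k \<Longrightarrow> yc e v \<alpha> = 0" using * by blast
  show "lincomb E m k (yc e v) (\<lambda>\<alpha>. e \<alpha> m) = v" using * by simp
qed

lemma basis_coord_unique:
  assumes b: "frame e m" and v: "v \<in> fibre E m"
    and c: "v = lincomb E m k c (\<lambda>\<alpha>. e \<alpha> m)" and \<alpha>: "\<alpha> < k"
  shows "yc e v \<alpha> = c \<alpha>"
proof -
  \<comment> \<open>Uniqueness in \<open>fibre_basis\<close> is among families that vanish from
    index k on, so c is truncated first.\<close>
  let ?c = "\<lambda>\<alpha>. if \<alpha> < k then c \<alpha> else 0"
  have "v = lincomb E m k ?c (\<lambda>\<alpha>. e \<alpha> m)" by (subst c) (rule lincomb_cong; simp)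
  then have 1: "(\<forall>\<alpha>\<ge>k. ?c \<alpha> = 0) \<and> v = lincomb E m k ?c (\<lambda>\<alpha>. e \<alpha> m)" by simp
  have 2: "(\<forall>\<alpha>\<ge>k. yc e v \<alpha> = 0) \<and> v = lincomb E m k (yc e v) (\<lambda>\<alpha>. e \<alpha> m)"
    using frame_coord[OF b v] by simp
  define P where "P d \<longleftrightarrow> (\<forall>\<alpha>\<ge>k. d \<alpha> = 0) \<and> v = lincomb E m k d (\<lambda>\<alpha>. e \<alpha> m)" for d
  have ex1: "\<exists>!d. P d" using b v unfolding frame_def fibre_basis_def P_def by simp
  have "P ?c" "P (yc e v)" using 1 2 unfolding P_def by simp_all
  then have "yc e v = ?c" using the1_equality[OF ex1] by metis
  then show ?thesis using \<alpha> by simp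
qed

context
  fixes m e assumes m: "m \<in> points B" and b: "frame e m"
begin

lemma basis_coord_lincomb_basis: "\<alpha> < k \<Longrightarrow> yc e (lincomb E m k c (\<lambda>\<alpha>. e \<alpha> m)) \<alpha> = c \<alpha>"
  by (rule basis_coord_unique[OF b frame_lincomb_fibre[OF m b]]) auto

lemma basis_coord_add:
  assumes u: "u \<in> fibre E m" and v: "v \<in> fibre E m"
  shows "yc e (vadd E u v) \<alpha> = yc e u \<alpha> + yc e v \<alpha>"
proof (cases "\<alpha> < k")
  case True
  have "lincomb E m k (\<lambda>\<alpha>. yc e u \<alpha> + yc e v \<alpha>) (\<lambda>\<alpha>. e \<alpha> m) = vadd E u v"
    using lincomb_add[OF m, of k "\<lambda>\<alpha>. e \<alpha> m" "yc e u" "yc e v"] frame_fibre[OF b] frame_coord(2)[OF b u]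
      frame_coord(2)[OF b v] by simp
  from basis_coord_unique[OF b vadd_fibre[OF m u v] this[symmetric] True] show ?thesis .
qed (use frame_coord(1)[OF b u] frame_coord(1)[OF b v] frame_coord(1)[OF b vadd_fibre[OF m u v]] in \<open>simp add: not_less\<close>)

lemma basis_coord_scale:
  assumes u: "u \<in> fibre E m"
  shows "yc e (vscale E s u) \<alpha> = s * yc e u \<alpha>"
proof (cases "\<alpha> < k")
  case True
  have "lincomb E m k (\<lambda>\<alpha>. s * yc e u \<alpha>) (\<lambda>\<alpha>. e \<alpha> m) = vscale E s u"
    using lincomb_scale[OF m, of k "\<lambda>\<alpha>. e \<alpha> m" s "yc e u"] frame_fibre[OF b] frame_coord(2)[OF b u] by simp
  from basis_coord_unique[OF b vscale_fibre[OF m u] this[symmetric] True] show ?thesis .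
qed (use frame_coord(1)[OF b u] frame_coord(1)[OF b vscale_fibre[OF m u]] in \<open>simp add: not_less\<close>)

lemma basis_coord_zero: "yc e (vzero E m) \<alpha> = 0"
  using basis_coord_scale[OF vzero_fibre[OF m], of 0] by (simp add: vscale_vzero[OF m])

lemma basis_coord_lincomb:
  "(\<And>i. i < r \<Longrightarrow> f i \<in> fibre E m) \<Longrightarrow> yc e (lincomb E m r c f) \<alpha> = (\<Sum>i<r. c i * yc e (f i) \<alpha>)"
  by (induction r)
    (auto simp: basis_coord_zero basis_coord_add basis_coord_scale lincomb_fibre[OF m] vscale_fibre[OF m])

lemma basis_coord_basis:
  assumes "\<beta> < k" "\<alpha> < k" shows "yc e (e \<beta> m) \<alpha> = (if \<alpha> = \<beta> then 1 else 0)"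
proof -
  have "lincomb E m k (\<lambda>\<alpha>. if \<alpha> = \<beta> then 1 else 0) (\<lambda>\<alpha>. e \<alpha> m) = e \<beta> m"
    by (rule lincomb_delta[OF m _ assms(1)]) (rule frame_fibre[OF b])
  from basis_coord_unique[OF b frame_fibre[OF b assms(1)] this[symmetric] assms(2)] show ?thesis .
qed

lemma basis_coord_change:
  assumes f: "frame f m" and v: "v \<in> fibre E m"
  shows "(\<Sum>\<gamma><k. yc f v \<gamma> * yc e (f \<gamma> m) \<alpha>) = yc e v \<alpha>"
  using basis_coord_lincomb[of k "\<lambda>\<gamma>. f \<gamma> m" "yc f v" \<alpha>] frame_fibre[OF f] frame_coord(2)[OF f v] by simp

end

section \<open>Smooth sections and local bases\<close>

lemma over_open: "openin (mtop B) U \<Longrightarrow> openin (mtop T) (over E U)"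
  using smooth_map_on_open_preimage[OF openin_topspace vproj_smooth] by (simp add: over_def)

lemma fibre_over: "v \<in> fibre E m \<Longrightarrow> v \<in> over E U \<longleftrightarrow> m \<in> U"
  by (auto simp: fibre_def over_def)

lemma local_basis_open: "local_basis E U e \<Longrightarrow> openin (mtop B) U"
  by (simp add: local_basis_def)

lemma local_basis_frame: "local_basis E U e \<Longrightarrow> m \<in> U \<Longrightarrow> frame e m"
  by (simp add: local_basis_def frame_def)

lemma local_basis_fibre: "local_basis E U e \<Longrightarrow> m \<in> U \<Longrightarrow> \<alpha> < k \<Longrightarrow> e \<alpha> m \<in> fibre E m"
  by (rule frame_fibre[OF local_basis_frame])

lemma local_basis_points: "local_basis E U e \<Longrightarrow> m \<in> U \<Longrightarrow> m \<in> points B"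
  by (rule openin_points_subset[OF local_basis_open])

lemma local_basis_section: "local_basis E U e \<Longrightarrow> \<alpha> < k \<Longrightarrow> e \<alpha> \<in> sections E U"
  by (simp add: local_basis_def)

lemma section_smooth: "\<sigma> \<in> sections E U \<Longrightarrow> smooth_map_on B U T \<sigma>"
  and section_fibre: "\<sigma> \<in> sections E U \<Longrightarrow> q \<in> U \<Longrightarrow> \<sigma> q \<in> fibre E q"
  by (auto simp: sections_def)

definition trivialization :: "'m set \<Rightarrow> ('m \<Rightarrow> nat \<Rightarrow> real) \<Rightarrow> (nat \<Rightarrow> 'm \<Rightarrow> 'e) \<Rightarrow> bool" where
  "trivialization U x e \<longleftrightarrow> local_coords B U x \<and> local_basis E U e \<and> local_coords T (over E U) (induced_coords E x e)"

lemma trivialization_at: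
  assumes "m \<in> points B" obtains U x e where "m \<in> U" "trivialization U x e"
proof -
  have "\<forall>m\<in>points B. \<exists>U x e. m \<in> U \<and> trivialization U x e"
    using vb unfolding vector_bundle_def trivialization_def by (elim conjE)
  then show ?thesis using assms that by (elim bspec[elim_format] exE conjE)
qed

text \<open>Indices beyond the rank give the constant 0, so that smoothness of components can be
  stated without a bound on \<alpha>.\<close>

lemma component_smooth_ge:
  assumes e: "local_basis E U e" and \<alpha>: "\<not> \<alpha> < k"
  shows "smooth_fun_on T (over E U) (\<lambda>v. yc e v \<alpha>)"
proof (rule smooth_fun_on_cong[OF total_manifold over_open[OF local_basis_open[OF e]] smooth_fun_on_const[of _ _ 0]])
  fix v assume "v \<in> over E U"
  then have "v \<in> fibre E (vproj E v)" "vproj E v \<in> U" by (auto simp: over_def fibre_def)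
  then show "0 = yc e v \<alpha>" using frame_coord(1)[OF local_basis_frame[OF e]] \<alpha> by simp
qed

lemma trivialization_component_smooth:
  assumes t: "trivialization U x e"
  shows "smooth_fun_on T (over E U) (\<lambda>v. yc e v \<alpha>)"
proof (cases "\<alpha> < k")
  case True
  have "smooth_fun_on T (over E U) (\<lambda>v. induced_coords E x e v (n + \<alpha>))"
    using t by (intro smooth_fun_on_coord[OF total_manifold]) (simp add: trivialization_def)
  then show ?thesis using True by (simp add: induced_coords_def)
next
  case False
  show ?thesis by (rule component_smooth_ge[OF _ False]) (use t in \<open>simp add: trivialization_def\<close>)
qed

lemma smooth_fun_on_base_pullback:
  assumes "openin (mtop B) V" "smooth_fun_on B V f"
  shows "smooth_fun_on T (over E V) (\<lambda>v. f (vproj E v))"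
  using smooth_fun_on_pullback[OF total_manifold base_manifold openin_topspace vproj_smooth assms]
  by (simp add: over_def)

text \<open>Passing from a trivialization to an arbitrary local basis requires the inverse of a smooth matrix.\<close>

lemma component_smooth:
  assumes e: "local_basis E U e"
  shows "smooth_fun_on T (over E U) (\<lambda>v. yc e v \<alpha>)"
proof (cases "\<alpha> < k")
  case False
  show ?thesis by (rule component_smooth_ge[OF e False])
next
  case True
  show ?thesis
  proof (rule smooth_fun_on_local[OF total_manifold over_open[OF local_basis_open[OF e]]])
    fix v0 assume v0: "v0 \<in> over E U"
    then have "vproj E v0 \<in> points B" using vproj_base by (simp add: over_def)
    then obtain V z f where V: "vproj E v0 \<in> V" "trivialization V z f" by (rule trivialization_at)
    have f: "local_basis E V f" using V(2) by (simp add: trivialization_def)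
    let ?W = "U \<inter> V"
    have WO: "openin (mtop B) ?W" by (intro openin_Int local_basis_open[OF e] local_basis_open[OF f])
    \<comment> \<open>The matrix of e in the frame f of a trivialization. It is smooth because the
      \<open>e \<beta>\<close> are smooth maps and components in f are coordinates of a
      chart.\<close>
    have A: "smooth_fun_on B ?W (\<lambda>q. yc f (e \<beta> q) \<gamma>)" if "\<beta> < k" for \<beta> \<gamma>
    proof -
      have "smooth_fun_on B {q \<in> U. e \<beta> q \<in> over E V} (\<lambda>q. yc f (e \<beta> q) \<gamma>)"
        by (rule smooth_fun_on_pullback[OF base_manifold total_manifold local_basis_open[OF e]
              section_smooth[OF local_basis_section[OF e that]] over_open[OF local_basis_open[OF f]]
              trivialization_component_smooth[OF V(2)]])
      moreover have "{q \<in> U. e \<beta> q \<in> over E V} = ?W"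
        using fibre_over[OF local_basis_fibre[OF e _ that]] by auto
      ultimately show ?thesis by simp
    qed
    \<comment> \<open>The components of f in e form the inverse of that matrix.\<close>
    have Bs: "smooth_fun_on B ?W (\<lambda>q. yc e (f \<gamma> q) \<alpha>)" if \<gamma>: "\<gamma> < k" for \<gamma>
    proof (rule smooth_fun_on_matrix_inverse[OF base_manifold WO,
          of k "\<lambda>\<gamma> \<beta> q. yc f (e \<beta> q) \<gamma>" "\<lambda>\<beta> \<gamma> q. yc e (f \<gamma> q) \<beta>"])
      show "smooth_fun_on B ?W (\<lambda>q. yc f (e \<beta> q) \<gamma>)" if "\<beta> < k" for \<beta> \<gamma> by (rule A[OF that])
      fix q i j assume q: "q \<in> ?W" and ij: "i < k" "j < k"
      have qB: "q \<in> points B" using q local_basis_points[OF e] by blast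
      have bf: "frame f q" and be: "frame e q"
        using q local_basis_frame[OF e] local_basis_frame[OF f] by auto
      have "(\<Sum>l<k. yc f (e l q) i * yc e (f j q) l) = yc f (f j q) i"
        using basis_coord_change[OF qB bf be frame_fibre[OF bf ij(2)], of i] by (simp add: mult.commute)
      then show "(\<Sum>l<k. yc f (e l q) i * yc e (f j q) l) = (if i = j then 1 else 0)"
        using basis_coord_basis[OF qB bf ij(2,1)] by simp
    qed (use True \<gamma> in auto)
    have OW: "openin (mtop T) (over E ?W)" by (rule over_open[OF WO])
    have "smooth_fun_on T (over E ?W) (\<lambda>v. \<Sum>\<gamma><k. yc f v \<gamma> * yc e (f \<gamma> (vproj E v)) \<alpha>)"
    proof (intro smooth_fun_on_sum[OF total_manifold OW] smooth_fun_on_mult[OF total_manifold OW])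
      fix \<gamma> assume "\<gamma> \<in> {..<k}"
      then show "smooth_fun_on T (over E ?W) (\<lambda>v. yc e (f \<gamma> (vproj E v)) \<alpha>)"
        by (intro smooth_fun_on_base_pullback[OF WO Bs]) simp
      show "smooth_fun_on T (over E ?W) (\<lambda>v. yc f v \<gamma>)"
        by (rule smooth_fun_on_subset[OF trivialization_component_smooth[OF V(2)]]) (auto simp: over_def)
    qed
    then have "smooth_fun_on T (over E ?W) (\<lambda>v. yc e v \<alpha>)"
    proof (rule smooth_fun_on_cong[OF total_manifold OW])
      fix v assume v: "v \<in> over E ?W"
      let ?q = "vproj E v"
      have q: "?q \<in> U" "?q \<in> V" "v \<in> fibre E ?q" using v by (auto simp: over_def fibre_def)
      have qB: "?q \<in> points B" by (rule local_basis_points[OF e q(1)])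
      note bf = local_basis_frame[OF f q(2)] and be = local_basis_frame[OF e q(1)]
      show "(\<Sum>\<gamma><k. yc f v \<gamma> * yc e (f \<gamma> ?q) \<alpha>) = yc e v \<alpha>"
        by (rule basis_coord_change[OF qB be bf q(3)])
    qed
    then have "smooth_fun_on T (over E U \<inter> over E ?W) (\<lambda>v. yc e v \<alpha>)"
      by (rule smooth_fun_on_subset) blast
    moreover have "v0 \<in> over E ?W" using v0 V(1) by (simp add: over_def)
    ultimately show "\<exists>W'. openin (mtop T) W' \<and> v0 \<in> W' \<and> smooth_fun_on T (over E U \<inter> W') (\<lambda>v. yc e v \<alpha>)"
      using OW by (intro exI[of _ "over E ?W"] conjI)
  qed
qed

lemma section_component_smooth:
  assumes e: "local_basis E U e" and W: "openin (mtop B) W" and s: "smooth_map_on B W T \<sigma>"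
    and f: "\<And>q. q \<in> W \<Longrightarrow> \<sigma> q \<in> fibre E q"
  shows "smooth_fun_on B (W \<inter> U) (\<lambda>q. yc e (\<sigma> q) \<alpha>)"
proof -
  have "smooth_fun_on B {q \<in> W. \<sigma> q \<in> over E U} (\<lambda>q. yc e (\<sigma> q) \<alpha>)"
    by (rule smooth_fun_on_pullback[OF base_manifold total_manifold W s over_open[OF local_basis_open[OF e]] component_smooth[OF e]])
  moreover have "{q \<in> W. \<sigma> q \<in> over E U} = W \<inter> U" using fibre_over[OF f] by auto
  ultimately show ?thesis by simp
qed

text \<open>Charts of the total space are available from trivializations, so the components in e are
  first converted into components in the frame g of a trivialization; the conversion matrix is
  smooth because the \<open>e \<alpha>\<close> are smooth sections.\<close>

lemma smooth_sectionI:
  assumes W: "openin (mtop B) W" and f: "\<And>q. q \<in> W \<Longrightarrow> \<sigma> q \<in> fibre E q"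
    and loc: "\<And>p. p \<in> W \<Longrightarrow> \<exists>U e W'. local_basis E U e \<and> openin (mtop B) W' \<and> p \<in> W' \<and> W' \<subseteq> W \<inter> U \<and>
      (\<forall>\<alpha><k. smooth_fun_on B W' (\<lambda>q. yc e (\<sigma> q) \<alpha>))"
  shows "smooth_map_on B W T \<sigma>"
proof (rule smooth_map_onI[OF base_manifold total_manifold W])
  fix p assume p: "p \<in> W"
  from loc[OF p] obtain U e W' where e: "local_basis E U e" "openin (mtop B) W'" "p \<in> W'" "W' \<subseteq> W \<inter> U"
    "\<forall>\<alpha><k. smooth_fun_on B W' (\<lambda>q. yc e (\<sigma> q) \<alpha>)" by (elim exE conjE) (rule that)
  have "p \<in> points B" by (rule openin_points_subset[OF e(2,3)])
  then obtain V z g where V: "p \<in> V" "trivialization V z g" by (rule trivialization_at)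
  then have z: "local_coords B V z" and g: "local_basis E V g" and i: "local_coords T (over E V) (induced_coords E z g)"
    by (auto simp: trivialization_def)
  let ?W = "W' \<inter> V"
  have WO: "openin (mtop B) ?W" by (intro openin_Int e(2) local_basis_open[OF g])
  have comp: "smooth_fun_on B ?W (\<lambda>q. yc g (\<sigma> q) \<gamma>)" for \<gamma>
  proof -
    have "smooth_fun_on B ?W (\<lambda>q. \<Sum>\<alpha><k. yc e (\<sigma> q) \<alpha> * yc g (e \<alpha> q) \<gamma>)"
    proof (intro smooth_fun_on_sum[OF base_manifold WO] smooth_fun_on_mult[OF base_manifold WO])
      fix \<alpha> assume "\<alpha> \<in> {..<k}"
      then have \<alpha>: "\<alpha> < k" by simp
      show "smooth_fun_on B ?W (\<lambda>q. yc e (\<sigma> q) \<alpha>)"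
        by (rule smooth_fun_on_subset[of _ W']) (use e(5) \<alpha> in auto)
      have "smooth_fun_on B (U \<inter> V) (\<lambda>q. yc g (e \<alpha> q) \<gamma>)"
        by (rule section_component_smooth[OF g local_basis_open[OF e(1)] section_smooth[OF local_basis_section[OF e(1) \<alpha>]]
              local_basis_fibre[OF e(1) _ \<alpha>]])
      then show "smooth_fun_on B ?W (\<lambda>q. yc g (e \<alpha> q) \<gamma>)"
        by (rule smooth_fun_on_subset) (use e(4) in blast)
    qed
    then show ?thesis
    proof (rule smooth_fun_on_cong[OF base_manifold WO])
      fix q assume q: "q \<in> ?W"
      then have qU: "q \<in> U" "q \<in> V" "q \<in> W" using e(4) by auto
      have qB: "q \<in> points B" by (rule local_basis_points[OF g qU(2)])
      note bg = local_basis_frame[OF g qU(2)] and be = local_basis_frame[OF e(1) qU(1)]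
      show "(\<Sum>\<alpha><k. yc e (\<sigma> q) \<alpha> * yc g (e \<alpha> q) \<gamma>) = yc g (\<sigma> q) \<gamma>"
        by (rule basis_coord_change[OF qB bg be f[OF qU(3)]])
    qed
  qed
  have ind: "smooth_fun_on B ?W (\<lambda>q. induced_coords E z g (\<sigma> q) j)" for j
  proof -
    consider "j < n" | "j \<ge> n" "j < n + k" | "j \<ge> n + k" by linarith
    then show ?thesis
    proof cases
      case 1
      have "smooth_fun_on B ?W (\<lambda>q. z q j)"
        by (rule smooth_fun_on_subset[OF smooth_fun_on_coord[OF base_manifold z]]) blast
      then show ?thesis
        by (rule smooth_fun_on_cong[OF base_manifold WO])
          (use 1 e(4) fibre_vproj[OF f] in \<open>auto simp: induced_coords_def\<close>)
    next
      case 2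
      then show ?thesis using comp by (simp add: induced_coords_def Let_def)
    next
      case 3
      then show ?thesis using smooth_fun_on_const by (simp add: induced_coords_def Let_def)
    qed
  qed
  have "\<sigma> ` ?W \<subseteq> over E V"
  proof
    fix v assume "v \<in> \<sigma> ` ?W"
    then obtain q where q: "q \<in> ?W" "v = \<sigma> q" by blast
    then have "\<sigma> q \<in> fibre E q" using e(4) by (intro f) blast
    then show "v \<in> over E V" using q by (simp add: fibre_over)
  qed
  moreover have "W' \<inter> V \<subseteq> W" using e(4) by blast
  ultimately show "\<exists>W' V y. openin (mtop B) W' \<and> p \<in> W' \<and> W' \<subseteq> W \<and> local_coords T V y \<and> \<sigma> ` W' \<subseteq> V \<and>
      (\<forall>j<mdim T. smooth_fun_on B W' (\<lambda>q. y (\<sigma> q) j))"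
    by (intro exI conjI) (rule WO, rule IntI[OF e(3) V(1)], assumption, rule i, assumption, intro allI impI ind)
qed

lemma smooth_sectionI':
  assumes W: "openin (mtop B) W" and f: "\<And>q. q \<in> W \<Longrightarrow> \<sigma> q \<in> fibre E q"
    and s: "\<And>V g \<gamma>. local_basis E V g \<Longrightarrow> \<gamma> < k \<Longrightarrow> smooth_fun_on B (W \<inter> V) (\<lambda>q. yc g (\<sigma> q) \<gamma>)"
  shows "smooth_map_on B W T \<sigma>"
proof (rule smooth_sectionI[OF W f])
  fix p assume p: "p \<in> W"
  have "p \<in> points B" by (rule openin_points_subset[OF W p])
  then obtain V z g where V: "p \<in> V" "trivialization V z g" by (rule trivialization_at)
  then have g: "local_basis E V g" by (simp add: trivialization_def)
  show "\<exists>U e W'. local_basis E U e \<and> openin (mtop B) W' \<and> p \<in> W' \<and> W' \<subseteq> W \<inter> U \<and>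
      (\<forall>\<alpha><k. smooth_fun_on B W' (\<lambda>q. yc e (\<sigma> q) \<alpha>))"
    by (intro exI conjI) (rule g, rule openin_Int[OF W local_basis_open[OF g]], rule IntI[OF p V(1)],
      rule subset_refl, intro allI impI s[OF g])
qed

lemma smooth_section_lincomb:
  assumes W: "openin (mtop B) W" and e: "\<And>\<alpha>. \<alpha> < r \<Longrightarrow> smooth_map_on B W T (e \<alpha>)"
    and ef: "\<And>\<alpha> q. \<alpha> < r \<Longrightarrow> q \<in> W \<Longrightarrow> e \<alpha> q \<in> fibre E q"
    and c: "\<And>\<alpha>. \<alpha> < r \<Longrightarrow> smooth_fun_on B W (c \<alpha>)"
  shows "smooth_map_on B W T (\<lambda>q. lincomb E q r (\<lambda>\<alpha>. c \<alpha> q) (\<lambda>\<alpha>. e \<alpha> q))"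
proof (rule smooth_sectionI'[OF W])
  show "lincomb E q r (\<lambda>\<alpha>. c \<alpha> q) (\<lambda>\<alpha>. e \<alpha> q) \<in> fibre E q" if "q \<in> W" for q
    by (rule lincomb_fibre[OF openin_points_subset[OF W that]]) (rule ef[OF _ that])
  fix V g \<gamma> assume g: "local_basis E V g" and \<gamma>: "\<gamma> < k"
  have WV: "openin (mtop B) (W \<inter> V)" by (rule openin_Int[OF W local_basis_open[OF g]])
  have "smooth_fun_on B (W \<inter> V) (\<lambda>q. \<Sum>\<alpha><r. c \<alpha> q * yc g (e \<alpha> q) \<gamma>)"
  proof (intro smooth_fun_on_sum[OF base_manifold WV] smooth_fun_on_mult[OF base_manifold WV])
    fix \<alpha> assume "\<alpha> \<in> {..<r}"
    then have \<alpha>: "\<alpha> < r" by simp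
    show "smooth_fun_on B (W \<inter> V) (c \<alpha>)" by (rule smooth_fun_on_subset[OF c[OF \<alpha>]]) blast
    show "smooth_fun_on B (W \<inter> V) (\<lambda>q. yc g (e \<alpha> q) \<gamma>)"
      by (rule section_component_smooth[OF g W e[OF \<alpha>] ef[OF \<alpha>]])
  qed
  then show "smooth_fun_on B (W \<inter> V) (\<lambda>q. yc g (lincomb E q r (\<lambda>\<alpha>. c \<alpha> q) (\<lambda>\<alpha>. e \<alpha> q)) \<gamma>)"
  proof (rule smooth_fun_on_cong[OF base_manifold WV])
    fix q assume q: "q \<in> W \<inter> V"
    have fr: "frame g q" by (rule local_basis_frame[OF g]) (use q in blast)
    have qB: "q \<in> points B" by (rule openin_points_subset[OF WV q])
    have "e \<alpha> q \<in> fibre E q" if "\<alpha> < r" for \<alpha> by (rule ef[OF that]) (use q in blast)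
    then show "(\<Sum>\<alpha><r. c \<alpha> q * yc g (e \<alpha> q) \<gamma>) = yc g (lincomb E q r (\<lambda>\<alpha>. c \<alpha> q) (\<lambda>\<alpha>. e \<alpha> q)) \<gamma>"
      using basis_coord_lincomb[OF qB fr, of r "\<lambda>\<alpha>. e \<alpha> q" "\<lambda>\<alpha>. c \<alpha> q" \<gamma>] by simp
  qed
qed

section \<open>Global sections and extension of local ones\<close>

lemma gsectionI:
  assumes "smooth_map_on B (points B) T \<sigma>" "\<And>q. q \<in> points B \<Longrightarrow> \<sigma> q \<in> fibre E q"
  shows "(\<lambda>q\<in>points B. \<sigma> q) \<in> gsections E"
  unfolding sections_def
proof (intro CollectI conjI ballI)
  show "restrict \<sigma> (points B) \<in> extensional (points B)" by simp
  show "restrict \<sigma> (points B) m \<in> fibre E m" if "m \<in> points B" for m using assms(2)[OF that] that by simp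
  show "smooth_map_on B (points B) T (restrict \<sigma> (points B))"
  proof (rule smooth_sectionI'[OF openin_topspace])
    show "restrict \<sigma> (points B) q \<in> fibre E q" if "q \<in> points B" for q using assms(2)[OF that] that by simp
    fix V g \<gamma> assume g: "local_basis E V g"
    show "smooth_fun_on B (points B \<inter> V) (\<lambda>q. yc g (restrict \<sigma> (points B) q) \<gamma>)"
      by (rule smooth_fun_on_cong[OF base_manifold openin_Int[OF openin_topspace local_basis_open[OF g]]
            section_component_smooth[OF g openin_topspace assms]]) simp_all
  qed
qed

lemma gsection_smooth: "\<sigma> \<in> gsections E \<Longrightarrow> smooth_map_on B (points B) T \<sigma>"
  by (rule section_smooth)

lemma gsection_fibre: "\<sigma> \<in> gsections E \<Longrightarrow> m \<in> points B \<Longrightarrow> \<sigma> m \<in> fibre E m"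
  by (rule section_fibre)

lemma gsection_component_smooth:
  assumes "\<sigma> \<in> gsections E" "local_basis E U e"
  shows "smooth_fun_on B U (\<lambda>q. yc e (\<sigma> q) \<alpha>)"
  by (rule smooth_fun_on_subset[OF section_component_smooth[OF assms(2) openin_topspace gsection_smooth[OF assms(1)] gsection_fibre[OF assms(1)]]])
    (use local_basis_points[OF assms(2)] in auto)

definition glincomb :: "nat \<Rightarrow> (nat \<Rightarrow> 'm \<Rightarrow> real) \<Rightarrow> (nat \<Rightarrow> 'm \<Rightarrow> 'e) \<Rightarrow> 'm \<Rightarrow> 'e" where
  "glincomb r c e = (\<lambda>q\<in>points B. lincomb E q r (\<lambda>\<alpha>. c \<alpha> q) (\<lambda>\<alpha>. e \<alpha> q))"

lemma glincomb_gsection: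
  assumes "\<And>\<alpha>. \<alpha> < r \<Longrightarrow> e \<alpha> \<in> gsections E" "\<And>\<alpha>. \<alpha> < r \<Longrightarrow> smooth_fun_on B (points B) (c \<alpha>)"
  shows "glincomb r c e \<in> gsections E"
  unfolding glincomb_def
proof (rule gsectionI)
  show "smooth_map_on B (points B) T (\<lambda>q. lincomb E q r (\<lambda>\<alpha>. c \<alpha> q) (\<lambda>\<alpha>. e \<alpha> q))"
    by (rule smooth_section_lincomb[OF openin_topspace gsection_smooth[OF assms(1)] gsection_fibre[OF assms(1)] assms(2)])
  show "lincomb E q r (\<lambda>\<alpha>. c \<alpha> q) (\<lambda>\<alpha>. e \<alpha> q) \<in> fibre E q" if "q \<in> points B" for q
    by (rule lincomb_fibre[OF that]) (rule gsection_fibre[OF assms(1) that])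
qed

lemma sec_scale_gsection:
  assumes "\<sigma> \<in> gsections E" "smooth_fun_on B (points B) f"
  shows "sec_scale E f \<sigma> \<in> gsections E"
proof -
  have "glincomb 1 (\<lambda>_. f) (\<lambda>_. \<sigma>) = sec_scale E f \<sigma>"
    by (auto simp: glincomb_def sec_scale_def fun_eq_iff vadd_vzero_left vscale_fibre gsection_fibre[OF assms(1)])
  then show ?thesis using glincomb_gsection[of 1 "\<lambda>_. \<sigma>" "\<lambda>_. f"] assms by simp
qed

text \<open>Multiplication by a bump function followed by extension with the zero section. Agreement
  with \<sigma> is guaranteed on the neighbourhood W where the bump function is 1.\<close>

lemma gsection_extend:
  assumes U: "openin (mtop B) U" and m: "m \<in> U" and s: "smooth_map_on B U T \<sigma>"
    and f: "\<And>q. q \<in> U \<Longrightarrow> \<sigma> q \<in> fibre E q"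
  obtains \<sigma>' W where "\<sigma>' \<in> gsections E" "openin (mtop B) W" "m \<in> W" "W \<subseteq> U" "\<And>q. q \<in> W \<Longrightarrow> \<sigma>' q = \<sigma> q"
proof -
  obtain b K W where b: "smooth_fun_on B (points B) b" "closedin (mtop B) K" "K \<subseteq> U"
    "\<And>q. q \<notin> K \<Longrightarrow> b q = 0" "openin (mtop B) W" "m \<in> W" "W \<subseteq> K" "\<And>q. q \<in> W \<Longrightarrow> b q = 1"
    by (rule smooth_bump[OF base_manifold U m]) blast
  define s' where "s' q = (if q \<in> U then vscale E (b q) (\<sigma> q) else vzero E q)" for q
  have f': "s' q \<in> fibre E q" if "q \<in> points B" for q
    using vscale_fibre[OF that f] vzero_fibre[OF that] by (simp add: s'_def)
  have y: "yc g (s' q) \<gamma> = (if q \<in> U then b q * yc g (\<sigma> q) \<gamma> else 0)" if "q \<in> points B" "frame g q" for q g \<gamma>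
    using basis_coord_scale[OF that f] basis_coord_zero[OF that] by (simp add: s'_def)
  have "smooth_map_on B (points B) T s'"
  proof (rule smooth_sectionI'[OF openin_topspace f'])
    fix V g \<gamma> assume g: "local_basis E V g" and \<gamma>: "\<gamma> < k"
    have VO: "openin (mtop B) (points B \<inter> V)" by (intro openin_Int openin_topspace local_basis_open[OF g])
    show "smooth_fun_on B (points B \<inter> V) (\<lambda>q. yc g (s' q) \<gamma>)"
    proof (rule smooth_fun_on_local[OF base_manifold VO])
      fix p assume p: "p \<in> points B \<inter> V"
      show "\<exists>W'. openin (mtop B) W' \<and> p \<in> W' \<and> smooth_fun_on B (points B \<inter> V \<inter> W') (\<lambda>q. yc g (s' q) \<gamma>)"
      proof (cases "p \<in> U")
        case True
        have UV: "openin (mtop B) (points B \<inter> V \<inter> U)" by (rule openin_Int[OF VO U])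
        have "smooth_fun_on B (points B \<inter> V \<inter> U) (\<lambda>q. b q * yc g (\<sigma> q) \<gamma>)"
        proof (rule smooth_fun_on_mult[OF base_manifold UV])
          show "smooth_fun_on B (points B \<inter> V \<inter> U) b" by (rule smooth_fun_on_subset[OF b(1)]) blast
          show "smooth_fun_on B (points B \<inter> V \<inter> U) (\<lambda>q. yc g (\<sigma> q) \<gamma>)"
            by (rule smooth_fun_on_subset[OF section_component_smooth[OF g U s f]]) auto
        qed
        then have "smooth_fun_on B (points B \<inter> V \<inter> U) (\<lambda>q. yc g (s' q) \<gamma>)"
          by (rule smooth_fun_on_cong[OF base_manifold UV]) (simp add: y local_basis_frame[OF g])
        then show ?thesis using True U by (intro exI[of _ U] conjI)
      next
        case False
        have KO: "openin (mtop B) (points B - K)" using b(2) by blast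
        have "smooth_fun_on B (points B \<inter> V \<inter> (points B - K)) (\<lambda>q. yc g (s' q) \<gamma>)"
          by (rule smooth_fun_on_cong[OF base_manifold openin_Int[OF VO KO] smooth_fun_on_const[of _ _ 0]])
            (simp add: y local_basis_frame[OF g] b(4))
        moreover have "p \<in> points B - K" using p False b(3) by blast
        ultimately show ?thesis using KO by (intro exI[of _ "points B - K"] conjI)
      qed
    qed
  qed
  then have "(\<lambda>q\<in>points B. s' q) \<in> gsections E" by (rule gsectionI[OF _ f'])
  moreover have "(\<lambda>q\<in>points B. s' q) q = \<sigma> q" if q: "q \<in> W" for q
  proof -
    have qB: "q \<in> points B" by (rule openin_points_subset[OF b(5) q])
    have qU: "q \<in> U" using q b(3,7) by blast
    show ?thesis using qB qU b(8)[OF q] vscale_1[OF qB f[OF qU]] by (simp add: s'_def)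
  qed
  moreover have "W \<subseteq> U" using b(3,7) by blast
  ultimately show thesis using b(5,6) that by blast
qed

text \<open>Constant components in a trivialization give a local section, which is then extended.
  Hence the choice of sections in \<open>ext_diff\<close> always has a candidate.\<close>

lemma gsection_through:
  assumes v: "v \<in> fibre E m" obtains \<sigma> where "\<sigma> \<in> gsections E" "\<sigma> m = v"
proof -
  have m: "m \<in> points B" by (rule fibre_base[OF v])
  then obtain U x e where U: "m \<in> U" "trivialization U x e" by (rule trivialization_at)
  then have e: "local_basis E U e" by (simp add: trivialization_def)
  let ?s = "\<lambda>q. lincomb E q k (\<lambda>\<alpha>. yc e v \<alpha>) (\<lambda>\<alpha>. e \<alpha> q)"
  have s: "smooth_map_on B U T ?s"
    by (rule smooth_section_lincomb[OF local_basis_open[OF e] section_smooth[OF local_basis_section[OF e]]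
          local_basis_fibre[OF e] smooth_fun_on_const])
  have f: "?s q \<in> fibre E q" if "q \<in> U" for q
    by (rule frame_lincomb_fibre[OF local_basis_points[OF e that] local_basis_frame[OF e that]])
  obtain \<sigma>' W where "\<sigma>' \<in> gsections E" "m \<in> W" "\<And>q. q \<in> W \<Longrightarrow> \<sigma>' q = ?s q"
    by (rule gsection_extend[OF local_basis_open[OF e] U(1) s f], assumption) (rule that)
  then show thesis using that frame_coord(2)[OF local_basis_frame[OF e U(1)] v] by simp
qed

text \<open>Each \<open>e \<alpha>\<close> is extended separately, and W is the intersection of the
  finitely many neighbourhoods of agreement. Outside W the extensions may be linearly
  dependent.\<close>

lemma local_basis_extend:
  assumes e: "local_basis E U e" and m: "m \<in> U"
  obtains e' W where "\<And>\<alpha>. \<alpha> < k \<Longrightarrow> e' \<alpha> \<in> gsections E" "openin (mtop B) W" "m \<in> W" "W \<subseteq> U"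
    "\<And>\<alpha> q. \<alpha> < k \<Longrightarrow> q \<in> W \<Longrightarrow> e' \<alpha> q = e \<alpha> q"
proof -
  have "\<forall>\<alpha>. \<exists>p. \<alpha> < k \<longrightarrow> fst p \<in> gsections E \<and> openin (mtop B) (snd p) \<and> m \<in> snd p \<and> snd p \<subseteq> U \<and>
      (\<forall>q\<in>snd p. fst p q = e \<alpha> q)"
  proof
    fix \<alpha>
    show "\<exists>p. \<alpha> < k \<longrightarrow> fst p \<in> gsections E \<and> openin (mtop B) (snd p) \<and> m \<in> snd p \<and> snd p \<subseteq> U \<and>
      (\<forall>q\<in>snd p. fst p q = e \<alpha> q)"
    proof (cases "\<alpha> < k")
      case True
      obtain \<sigma>' W where "\<sigma>' \<in> gsections E" "openin (mtop B) W" "m \<in> W" "W \<subseteq> U" "\<And>q. q \<in> W \<Longrightarrow> \<sigma>' q = e \<alpha> q"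
        by (rule gsection_extend[OF local_basis_open[OF e] m section_smooth[OF local_basis_section[OF e True]]
              local_basis_fibre[OF e _ True]], assumption) (rule that)
      then show ?thesis by (intro exI[of _ "(\<sigma>', W)"]) simp
    qed simp
  qed
  from choice[OF this] obtain p where p: "\<forall>\<alpha>. \<alpha> < k \<longrightarrow> fst (p \<alpha>) \<in> gsections E \<and> openin (mtop B) (snd (p \<alpha>)) \<and>
      m \<in> snd (p \<alpha>) \<and> snd (p \<alpha>) \<subseteq> U \<and> (\<forall>q\<in>snd (p \<alpha>). fst (p \<alpha>) q = e \<alpha> q)" ..
  define W where "W = U \<inter> (\<Inter>\<alpha>\<in>{..<k}. snd (p \<alpha>))"
  have WO: "openin (mtop B) W"
  proof (cases "k = 0")
    case True then show ?thesis using local_basis_open[OF e] by (simp add: W_def)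
  next
    case False
    then have "{..<k} \<noteq> {}" by auto
    then show ?thesis unfolding W_def
      by (intro openin_Int[OF local_basis_open[OF e]] openin_INT2) (simp_all add: p)
  qed
  show thesis
  proof (rule that[of "\<lambda>\<alpha>. fst (p \<alpha>)" W])
    show "m \<in> W" using m p by (simp add: W_def)
    show "fst (p \<alpha>) q = e \<alpha> q" if "\<alpha> < k" "q \<in> W" for \<alpha> q using that p by (simp add: W_def)
  qed (use p WO in \<open>auto simp: W_def\<close>)
qed

section \<open>Induced coordinates\<close>

abbreviation base_part :: "(nat \<Rightarrow> real) \<Rightarrow> nat \<Rightarrow> real" where
  "base_part z \<equiv> tuple n (\<lambda>j z. z j) z"

lemma base_part_preimage_open:
  assumes A: "openin (Euclidean_space n) A"
  shows "openin (Euclidean_space (n + k)) {z \<in> ES (n + k). base_part z \<in> A}"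
proof (rule openin_ES_boxI)
  fix z assume z: "z \<in> {z \<in> ES (n + k). base_part z \<in> A}"
  then have zA: "base_part z \<in> A" by blast
  obtain d where d: "d > 0" "\<And>w. w \<in> ES n \<Longrightarrow> (\<And>i. i < n \<Longrightarrow> \<bar>w i - base_part z i\<bar> < d) \<Longrightarrow> w \<in> A"
    by (rule openin_ES_boxD[OF A zA]) blast
  have "base_part w \<in> A" if w: "\<forall>i<n + k. \<bar>w i - z i\<bar> < d" for w
  proof (rule d(2)[OF tuple_ES])
    show "\<bar>base_part w i - base_part z i\<bar> < d" if "i < n" for i using w that by (simp add: tuple_def)
  qed
  then show "\<exists>d>0. \<forall>w\<in>ES (n + k). (\<forall>i<n + k. \<bar>w i - z i\<bar> < d) \<longrightarrow> w \<in> {z \<in> ES (n + k). base_part z \<in> A}"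
    using d(1) by (intro exI[of _ d]) simp
qed blast

context
  fixes U x e assumes x: "local_coords B U x" and e: "local_basis E U e"
begin

abbreviation "ind \<equiv> induced_coords E x e"

definition induced_dom :: "(nat \<Rightarrow> real) set" where
  "induced_dom = {z \<in> ES (n + k). base_part z \<in> x ` U}"

text \<open>The inverse of the induced coordinates. It is linear in the fibre coordinates, so it is smooth for
  every local basis without any matrix inversion.\<close>

definition induced_par :: "(nat \<Rightarrow> real) \<Rightarrow> 'e" where
  "induced_par z = (let q = inv_into U x (base_part z) in lincomb E q k (\<lambda>\<alpha>. z (n + \<alpha>)) (\<lambda>\<alpha>. e \<alpha> q))"

lemma induced_dom_open: "openin (Euclidean_space (n + k)) induced_dom"
  unfolding induced_dom_def by (rule base_part_preimage_open[OF local_coords_image_open[OF x]])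

lemma ind_base: "i < n \<Longrightarrow> ind v i = x (vproj E v) i"
  and ind_fibre: "\<alpha> < k \<Longrightarrow> ind v (n + \<alpha>) = yc e v \<alpha>"
  and ind_ES: "ind v \<in> ES (n + k)"
  by (auto simp: induced_coords_def)

lemma base_part_ind: "v \<in> over E U \<Longrightarrow> base_part (ind v) = x (vproj E v)"
  by (rule tuple_eq[OF local_coords_ES[OF x]]) (auto simp: over_def ind_base)

lemma ind_dom: "v \<in> over E U \<Longrightarrow> ind v \<in> induced_dom"
  using ind_ES[of v] base_part_ind[of v] by (auto simp: induced_dom_def over_def)

lemma par_ind: assumes v: "v \<in> over E U" shows "induced_par (ind v) = v"
proof -
  have m: "vproj E v \<in> U" "v \<in> fibre E (vproj E v)" using v by (auto simp: over_def fibre_def)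
  have "induced_par (ind v) = lincomb E (vproj E v) k (\<lambda>\<alpha>. ind v (n + \<alpha>)) (\<lambda>\<alpha>. e \<alpha> (vproj E v))"
    unfolding induced_par_def base_part_ind[OF v] local_coords_inv[OF x m(1)] by (simp add: Let_def)
  also have "\<dots> = lincomb E (vproj E v) k (yc e v) (\<lambda>\<alpha>. e \<alpha> (vproj E v))"
    by (rule lincomb_cong) (auto simp: ind_fibre)
  finally show ?thesis using frame_coord(2)[OF local_basis_frame[OF e m(1)] m(2)] by simp
qed

lemma induced_base:
  assumes "z \<in> induced_dom"
  shows "inv_into U x (base_part z) \<in> U" "x (inv_into U x (base_part z)) = base_part z"
  using local_coords_inv_image[OF x subset_refl, of "base_part z"] assms by (auto simp: induced_dom_def)

lemma par_fibre: assumes z: "z \<in> induced_dom" shows "induced_par z \<in> fibre E (inv_into U x (base_part z))"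
  unfolding induced_par_def Let_def
  by (rule frame_lincomb_fibre[OF local_basis_points[OF e induced_base(1)[OF z]] local_basis_frame[OF e induced_base(1)[OF z]]])

lemma par_over: assumes z: "z \<in> induced_dom" shows "induced_par z \<in> over E U"
  using fibre_over[OF par_fibre[OF z]] induced_base(1)[OF z] by simp

lemma par_coord:
  assumes z: "z \<in> induced_dom" and \<alpha>: "\<alpha> < k" shows "yc e (induced_par z) \<alpha> = z (n + \<alpha>)"
  unfolding induced_par_def Let_def
  by (rule basis_coord_lincomb_basis[OF local_basis_points[OF e induced_base(1)[OF z]] local_basis_frame[OF e induced_base(1)[OF z]] \<alpha>])

lemma ind_par: assumes z: "z \<in> induced_dom" shows "ind (induced_par z) = z"
proof
  fix i
  consider "i < n" | \<alpha> where "i = n + \<alpha>" "\<alpha> < k" | "i \<ge> n + k"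
    by (metis le_Suc_ex less_or_eq_imp_le linorder_not_le nat_add_left_cancel_less)
  then show "ind (induced_par z) i = z i"
  proof cases
    case 1
    then show ?thesis
      using fibre_vproj[OF par_fibre[OF z]] induced_base(2)[OF z] by (simp add: ind_base) (simp add: tuple_def)
  next
    case 2
    then show ?thesis using par_coord[OF z] by (simp add: ind_fibre)
  next
    case 3
    then show ?thesis using z ind_ES by (simp add: induced_dom_def)
  qed
qed

lemma inv_ind: assumes z: "z \<in> induced_dom" shows "inv_into (over E U) ind z = induced_par z"
proof -
  have "inj_on ind (over E U)" by (rule inj_on_inverseI[of _ induced_par]) (rule par_ind)
  from inv_into_f_f[OF this par_over[OF z]] show ?thesis unfolding ind_par[OF z] .
qed

lemma Cinf_on_base_pullback:
  assumes V: "openin (mtop B) V" and g: "smooth_fun_on B V g"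
  shows "Cinf_on (n + k) {z \<in> ES (n + k). base_part z \<in> x ` (U \<inter> V)} (\<lambda>z. g (inv_into U x (base_part z)))"
  by (rule Cinf_on_compose[OF base_part_preimage_open[OF local_coords_open_image[OF x V]] local_coords_open_image[OF x V] _
        smooth_fun_on_chart[OF base_manifold V g x] Cinf_on_coord]) blast

text \<open>Smoothness of L can be read in the chart induced by a trivialization, while the
  coordinates induced by x and e are not known to be a chart. The passage from the latter to the
  former is smooth: its base part is a change of charts of the base, and its fibre part is a matrix
  of components of the \<open>e \<alpha>\<close> applied to the fibre coordinates.\<close>

lemma Cinf_on_par:
  assumes L: "smooth_fun_on T (points T) L"
  shows "Cinf_on (n + k) induced_dom (\<lambda>z. L (induced_par z))"
proof (rule Cinf_on_local[OF induced_dom_open])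
  fix z0 assume z0: "z0 \<in> induced_dom"
  let ?q = "\<lambda>z. inv_into U x (base_part z)"
  have "?q z0 \<in> points B" by (rule local_basis_points[OF e induced_base(1)[OF z0]])
  then obtain V zc f where V: "?q z0 \<in> V" "trivialization V zc f" by (rule trivialization_at)
  then have zc: "local_coords B V zc" and f: "local_basis E V f" and i: "local_coords T (over E V) (induced_coords E zc f)"
    by (auto simp: trivialization_def)
  note VO = local_basis_open[OF f]
  define S where "S = {z \<in> ES (n + k). base_part z \<in> x ` (U \<inter> V)}"
  have SO: "openin (Euclidean_space (n + k)) S"
    unfolding S_def by (rule base_part_preimage_open[OF local_coords_open_image[OF x VO]])
  have Sq: "z \<in> induced_dom" "?q z \<in> V" if "z \<in> S" for z
    using that local_coords_inv_image[OF x, of "U \<inter> V" "base_part z"] by (auto simp: S_def induced_dom_def)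
  have parV: "induced_par z \<in> over E V" if "z \<in> S" for z
    using fibre_over[OF par_fibre[OF Sq(1)[OF that]]] Sq(2)[OF that] by simp
  have t: "tuple (n + k) (\<lambda>j z. induced_coords E zc f (induced_par z) j) z = induced_coords E zc f (induced_par z)" for z
    by (rule tuple_eq) (auto simp: induced_coords_def)
  have C: "Cinf_on (n + k) S (\<lambda>z. L (inv_into (over E V) (induced_coords E zc f)
      (tuple (n + k) (\<lambda>j z. induced_coords E zc f (induced_par z) j) z)))"
  proof (rule Cinf_on_compose[OF SO local_coords_image_open[OF i, unfolded mdim_total]])
    show "tuple (n + k) (\<lambda>j z. induced_coords E zc f (induced_par z) j) z \<in> induced_coords E zc f ` over E V"
      if "z \<in> S" for z unfolding t using parV[OF that] by blast
    have "Cinf_on (mdim T) (induced_coords E zc f ` (over E V \<inter> points T)) (\<lambda>z. L (inv_into (over E V) (induced_coords E zc f) z))"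
      by (rule smooth_fun_on_chart[OF total_manifold openin_topspace L i])
    moreover have "over E V \<inter> points T = over E V" by (auto simp: over_def)
    ultimately show "Cinf_on (n + k) (induced_coords E zc f ` over E V) (\<lambda>z. L (inv_into (over E V) (induced_coords E zc f) z))"
      by (simp add: mdim_total)
    show "Cinf_on (n + k) S (\<lambda>z. induced_coords E zc f (induced_par z) j)" if "j < n + k" for j
    proof (cases "j < n")
      case True
      have "Cinf_on (n + k) S (\<lambda>z. zc (?q z) j)"
        unfolding S_def by (rule Cinf_on_base_pullback[OF VO smooth_fun_on_coord[OF base_manifold zc]])
      then show ?thesis
        by (rule Cinf_on_cong_imp[OF SO]) (use True fibre_vproj[OF par_fibre[OF Sq(1)]] in \<open>simp add: induced_coords_def\<close>)
    next
      case False
      define \<gamma> where "\<gamma> = j - n"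
      have \<gamma>: "\<gamma> < k" "j = n + \<gamma>" using False \<open>j < n + k\<close> by (auto simp: \<gamma>_def)
      have UV: "openin (mtop B) (U \<inter> V)" by (rule openin_Int[OF local_basis_open[OF e] VO])
      have S': "S = {z \<in> ES (n + k). base_part z \<in> x ` (U \<inter> (U \<inter> V))}"
        unfolding S_def by (simp add: Int_absorb1 flip: Int_assoc)
      \<comment> \<open>The fibre coordinate \<gamma> in the frame f is linear in the fibre
        coordinates of z, with coefficients that depend on the base point only.\<close>
      have "Cinf_on (n + k) S (\<lambda>z. \<Sum>\<alpha><k. z (n + \<alpha>) * yc f (e \<alpha> (?q z)) \<gamma>)"
      proof (intro Cinf_on_sum[OF SO] Cinf_on_mult[OF SO] Cinf_on_coord)
        fix \<alpha> assume "\<alpha> \<in> {..<k}"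
        then have \<alpha>: "\<alpha> < k" by simp
        show "Cinf_on (n + k) S (\<lambda>z. yc f (e \<alpha> (?q z)) \<gamma>)"
          unfolding S' by (rule Cinf_on_base_pullback[OF UV section_component_smooth[OF f local_basis_open[OF e]
              section_smooth[OF local_basis_section[OF e \<alpha>]] local_basis_fibre[OF e _ \<alpha>]]])
      qed
      then show ?thesis
      proof (rule Cinf_on_cong_imp[OF SO])
        fix z assume z: "z \<in> S"
        have qU: "?q z \<in> U" by (rule induced_base(1)[OF Sq(1)[OF z]])
        have "yc f (induced_par z) \<gamma> = (\<Sum>\<alpha><k. z (n + \<alpha>) * yc f (e \<alpha> (?q z)) \<gamma>)"
          unfolding induced_par_def Let_def
          by (rule basis_coord_lincomb[OF local_basis_points[OF e qU] local_basis_frame[OF f Sq(2)[OF z]] local_basis_fibre[OF e qU]])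
        then show "(\<Sum>\<alpha><k. z (n + \<alpha>) * yc f (e \<alpha> (?q z)) \<gamma>) = induced_coords E zc f (induced_par z) j"
          using \<gamma> by (simp add: induced_coords_def Let_def)
      qed
    qed
  qed
  have "Cinf_on (n + k) S (\<lambda>z. L (induced_par z))"
    by (rule Cinf_on_cong_imp[OF SO C]) (simp add: t local_coords_inv[OF i parV])
  then have "Cinf_on (n + k) (induced_dom \<inter> S) (\<lambda>z. L (induced_par z))" by (rule Cinf_on_mono) blast
  moreover have "z0 \<in> S"
    using z0 V(1) induced_base[OF z0] unfolding S_def induced_dom_def by (auto intro!: image_eqI[of _ _ "?q z0"])
  ultimately show "\<exists>S. openin (Euclidean_space (n + k)) S \<and> z0 \<in> S \<and> Cinf_on (n + k) (induced_dom \<inter> S) (\<lambda>z. L (induced_par z))"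
    using SO by (intro exI[of _ S] conjI)
qed

text \<open>The inverse selected by \<open>inv_into\<close> agrees with the explicit parametrization
  on an open set, so both have the same partial derivatives.\<close>

lemma partial_par:
  assumes v: "v \<in> over E U" and j: "j < n + k"
  shows "partial_deriv j (\<lambda>z. L (inv_into (over E U) ind z)) (ind v) = partial_deriv j (\<lambda>z. L (induced_par z)) (ind v)"
  by (rule partial_deriv_cong[OF induced_dom_open _ ind_dom[OF v] j]) (simp add: inv_ind)

end

end

section \<open>Tangent vectors and curves\<close>

lemma smooth_nearI: "openin (mtop M) W \<Longrightarrow> m \<in> W \<Longrightarrow> smooth_fun_on M W f \<Longrightarrow> smooth_near M m f"
  unfolding smooth_near_def by blast

text \<open>By convention a tangent vector is 0 on functions that are not smooth near m. Agreement
  near m therefore has to yield smoothness of g as well as equality of the partial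
  derivatives.\<close>

lemma tangent_cong:
  assumes M: "smooth_manifold M" and D: "D \<in> tangent_space M m" and W: "openin (mtop M) W" "m \<in> W"
    and f: "smooth_fun_on M W f" and eq: "\<And>q. q \<in> W \<Longrightarrow> f q = g q"
  shows "D f = D g"
proof -
  obtain U x v where x: "local_coords M U x" "m \<in> U"
    and D': "D = (\<lambda>f. if smooth_near M m f then \<Sum>i<mdim M. v i * coord_deriv U x i f m else 0)"
    using D unfolding tangent_space_def mem_Collect_eq by (elim exE conjE) (rule that)
  have "smooth_near M m f" by (rule smooth_nearI[OF W f])
  moreover have "smooth_near M m g" by (rule smooth_nearI[OF W smooth_fun_on_cong[OF M W(1) f eq]])
  moreover have "coord_deriv U x i f m = coord_deriv U x i g m" if "i < mdim M" for i
    unfolding coord_deriv_def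
  proof (rule partial_deriv_cong[OF local_coords_open_image[OF x(1) W(1)] _ _ that])
    show "x m \<in> x ` (U \<inter> W)" using x(2) W(2) by blast
    show "f (inv_into U x z) = g (inv_into U x z)" if "z \<in> x ` (U \<inter> W)" for z
      using local_coords_inv_image[OF x(1) _ that] eq by blast
  qed
  ultimately show ?thesis unfolding D' by simp
qed

text \<open>The source of the calculation rules for tangent vectors: constants, sums and products
  correspond to F constant, F(z) = z 0 + z 1 and F(z) = z 0 z 1. The chain rule is applied in a
  chart of M, and two finite sums are interchanged.\<close>

lemma tangent_chain:
  assumes M: "smooth_manifold M" and D: "D \<in> tangent_space M m" and W: "openin (mtop M) W" "m \<in> W"
    and g: "\<And>j. j < N \<Longrightarrow> smooth_fun_on M W (g j)" and T: "openin (Euclidean_space N) T"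
    and WT: "\<And>q. q \<in> W \<Longrightarrow> tuple N g q \<in> T" and F: "Cinf_on N T F"
  shows "D (\<lambda>q. F (tuple N g q)) = (\<Sum>j<N. partial_deriv j F (tuple N g m) * D (g j))"
proof -
  obtain U x v where x: "local_coords M U x" "m \<in> U"
    and D': "D = (\<lambda>f. if smooth_near M m f then \<Sum>i<mdim M. v i * coord_deriv U x i f m else 0)"
    using D unfolding tangent_space_def mem_Collect_eq by (elim exE conjE) (rule that)
  have s1: "smooth_near M m (g j)" if "j < N" for j by (rule smooth_nearI[OF W g[OF that]])
  have s2: "smooth_near M m (\<lambda>q. F (tuple N g q))"
    by (rule smooth_nearI[OF W smooth_fun_on_compose[OF M W(1) g T WT F]])
  let ?h = "\<lambda>j z. g j (inv_into U x z)"
  have t: "tuple N g (inv_into U x z) = tuple N ?h z" for z by (simp add: tuple_def)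
  have xm: "inv_into U x (x m) = m" by (rule local_coords_inv[OF x])
  have tm: "tuple N ?h (x m) = tuple N g m" using t[of "x m"] unfolding xm by (rule sym)
  have c: "coord_deriv U x i (\<lambda>q. F (tuple N g q)) m = (\<Sum>j<N. partial_deriv j F (tuple N g m) * coord_deriv U x i (g j) m)"
    if i: "i < mdim M" for i
  proof -
    have "((\<lambda>s. F (tuple N ?h ((x m)(i := s)))) has_real_derivative
        (\<Sum>j<N. partial_deriv j F (tuple N ?h (x m)) * partial_deriv i (?h j) (x m))) (at (x m i))"
    proof (rule Ck_on_compose_partial[OF local_coords_open_image[OF x(1) W(1)] T _ _ _ _ i])
      show "Ck_on N (Suc 0) T F" using F unfolding Cinf_on_def by (rule spec)
      show "Ck_on (mdim M) (Suc 0) (x ` (U \<inter> W)) (?h j)" if "j < N" for j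
        using smooth_fun_on_chart[OF M W(1) g[OF that] x(1)] unfolding Cinf_on_def by (rule spec)
      show "x m \<in> x ` (U \<inter> W)" using x(2) W(2) by blast
      show "tuple N ?h (x m) \<in> T" using WT[OF W(2)] unfolding tm .
    qed
    from partial_derivI[OF this] show ?thesis unfolding coord_deriv_def t tm .
  qed
  have "D (\<lambda>q. F (tuple N g q)) = (\<Sum>i<mdim M. v i * (\<Sum>j<N. partial_deriv j F (tuple N g m) * coord_deriv U x i (g j) m))"
    unfolding D' using s2 c by simp
  also have "\<dots> = (\<Sum>j<N. \<Sum>i<mdim M. v i * (partial_deriv j F (tuple N g m) * coord_deriv U x i (g j) m))"
    unfolding sum_distrib_left by (rule sum.swap)
  also have "\<dots> = (\<Sum>j<N. partial_deriv j F (tuple N g m) * D (g j))"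
    by (intro sum.cong refl) (simp add: D' s1 sum_distrib_left mult_ac)
  finally show ?thesis .
qed

lemma tangent_const:
  assumes M: "smooth_manifold M" and D: "D \<in> tangent_space M m" and m: "m \<in> points M"
  shows "D (\<lambda>q. c) = 0"
  \<comment> \<open>N = 0: F has no arguments and the sum is empty.\<close>
  using tangent_chain[OF M D openin_topspace m _ ES_open tuple_ES Cinf_on_const, of 0 undefined c] by simp

lemma tangent_add:
  assumes M: "smooth_manifold M" and D: "D \<in> tangent_space M m" and W: "openin (mtop M) W" "m \<in> W"
    and f: "smooth_fun_on M W f" and g: "smooth_fun_on M W g"
  shows "D (\<lambda>q. f q + g q) = D f + D g"
proof -
  define F where "F = (\<lambda>z::nat \<Rightarrow> real. z 0 + z 1)"
  define h where "h j = (if j = 0 then f else g)" for j :: nat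
  have F: "Cinf_on 2 (ES 2) F" unfolding F_def by (intro Cinf_on_add[OF ES_open] Cinf_on_coord)
  have p: "partial_deriv 0 F w = 1" "partial_deriv (Suc 0) F w = 1" for w
    by (rule partial_derivI, auto simp: F_def intro!: derivative_eq_intros)+
  have "D (\<lambda>q. F (tuple 2 h q)) = (\<Sum>j<2. partial_deriv j F (tuple 2 h m) * D (h j))"
    by (rule tangent_chain[OF M D W _ ES_open tuple_ES F]) (use f g in \<open>simp add: h_def\<close>)
  then have "D (\<lambda>q. F (tuple 2 h q)) = D f + D g" by (simp add: numeral_2_eq_2 p h_def)
  moreover have "(\<lambda>q. F (tuple 2 h q)) = (\<lambda>q. f q + g q)" by (simp add: F_def tuple_def h_def)
  ultimately show ?thesis by simp
qed

lemma tangent_mult: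
  assumes M: "smooth_manifold M" and D: "D \<in> tangent_space M m" and W: "openin (mtop M) W" "m \<in> W"
    and f: "smooth_fun_on M W f" and g: "smooth_fun_on M W g"
  shows "D (\<lambda>q. f q * g q) = D f * g m + f m * D g"
proof -
  define F where "F = (\<lambda>z::nat \<Rightarrow> real. z 0 * z 1)"
  define h where "h j = (if j = 0 then f else g)" for j :: nat
  have F: "Cinf_on 2 (ES 2) F" unfolding F_def by (intro Cinf_on_mult[OF ES_open] Cinf_on_coord)
  have p: "partial_deriv 0 F w = w 1" "partial_deriv (Suc 0) F w = w 0" for w
    by (rule partial_derivI, auto simp: F_def intro!: derivative_eq_intros)+
  have "D (\<lambda>q. F (tuple 2 h q)) = (\<Sum>j<2. partial_deriv j F (tuple 2 h m) * D (h j))"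
    by (rule tangent_chain[OF M D W _ ES_open tuple_ES F]) (use f g in \<open>simp add: h_def\<close>)
  then have "D (\<lambda>q. F (tuple 2 h q)) = D f * g m + f m * D g" by (simp add: numeral_2_eq_2 p h_def tuple_def mult.commute)
  moreover have "(\<lambda>q. F (tuple 2 h q)) = (\<lambda>q. f q * g q)" by (simp add: F_def tuple_def h_def)
  ultimately show ?thesis by simp
qed

lemma tangent_sum:
  assumes M: "smooth_manifold M" and D: "D \<in> tangent_space M m" and W: "openin (mtop M) W" "m \<in> W"
    and f: "\<And>j::nat. j < r \<Longrightarrow> smooth_fun_on M W (f j)"
  shows "D (\<lambda>q. \<Sum>j<r. f j q) = (\<Sum>j<r. D (f j))"
  using f
proof (induction r)
  case 0
  have "m \<in> points M" using openin_subset[OF W(1)] W(2) by blast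
  then show ?case using tangent_const[OF M D, of 0] by simp
next
  case (Suc r)
  have "D (\<lambda>q. (\<Sum>j<r. f j q) + f r q) = D (\<lambda>q. \<Sum>j<r. f j q) + D (f r)"
    by (rule tangent_add[OF M D W]) (auto intro!: smooth_fun_on_sum[OF M W(1)] Suc.prems)
  then show ?case using Suc by simp
qed

section \<open>Derivatives along curves\<close>

lemma curve_eventually:
  fixes J :: "real set"
  assumes a: "continuous_map (top_of_set J) X a" and A: "openin X A" and t: "t \<in> J" "a t \<in> A"
  shows "\<forall>\<^sub>F s in at t within J. s \<in> J \<and> a s \<in> A"
proof -
  have "openin (top_of_set J) {s \<in> J. a s \<in> A}"
    using openin_continuous_map_preimage[OF a A] by simp
  then obtain G where G: "open G" "{s \<in> J. a s \<in> A} = J \<inter> G" unfolding openin_open by blast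
  have "t \<in> {s \<in> J. a s \<in> A}" using t by simp
  then have "t \<in> G" unfolding G(2) by simp
  moreover have "a s \<in> A" if "s \<in> J" "s \<in> G" for s
  proof -
    have "s \<in> {s \<in> J. a s \<in> A}" unfolding G(2) using that by simp
    then show ?thesis by simp
  qed
  ultimately show ?thesis unfolding eventually_at_topological using G(1) by (intro exI[of _ G]) simp
qed

text \<open>No point of the interval is isolated because t0 < t1; this covers the one-sided
  derivatives at the end points.\<close>

lemma interval_DERIV_unique:
  fixes f :: "real \<Rightarrow> real"
  assumes "t0 < t1" "t \<in> {t0..t1}" "(f has_real_derivative d) (at t within {t0..t1})" "(f has_real_derivative d') (at t within {t0..t1})"
  shows "d = d'"
proof -
  have "vector_derivative f (at t within {t0..t1}) = d" "vector_derivative f (at t within {t0..t1}) = d'"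
    using assms by (auto intro!: vector_derivative_within_closed_interval simp: has_real_derivative_iff_has_vector_derivative)
  then show ?thesis by simp
qed

text \<open>\<open>C1_curve\<close> speaks of the coordinates of atlas charts, so the chain rule
  gives a derivative in each chart separately. By uniqueness these pieces are restrictions of one
  function h, the vector derivative, and continuity of h is a local matter.\<close>

lemma C1_curve_component:
  assumes N: "smooth_manifold N" and a: "C1_curve N {t0..t1} a" and lt: "t0 < t1"
    and W: "openin (mtop N) W" and f: "smooth_fun_on N W f"
  shows "\<exists>h. (\<forall>t\<in>{t\<in>{t0..t1}. a t \<in> W}. ((\<lambda>s. f (a s)) has_real_derivative h t) (at t within {t0..t1})) \<and>
    continuous_on {t\<in>{t0..t1}. a t \<in> W} h"
proof -
  let ?J = "{t0..t1}" let ?n = "mdim N"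
  define h where "h t = vector_derivative (\<lambda>s. f (a s)) (at t within ?J)" for t
  have ac: "continuous_map (top_of_set ?J) (mtop N) a" using a by (simp add: C1_curve_def)
  have pre: "openin (top_of_set ?J) {t \<in> ?J. a t \<in> A}" if "openin (mtop N) A" for A
    using openin_continuous_map_preimage[OF ac that] by simp
  have key: "\<exists>h'. (\<forall>t\<in>{t\<in>?J. a t \<in> V \<inter> W}. ((\<lambda>s. f (a s)) has_real_derivative h' t) (at t within ?J)) \<and>
      continuous_on {t\<in>?J. a t \<in> V \<inter> W} h'" if V: "(V, y) \<in> matlas N" for V y
  proof -
    have y: "local_coords N V y" by (rule atlas_local_coords[OF N V])
    have "\<forall>i. \<exists>g. i < ?n \<longrightarrow> (\<forall>t\<in>{t\<in>?J. a t \<in> V}. ((\<lambda>s. y (a s) i) has_real_derivative g t) (at t within ?J)) \<and>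
        continuous_on {t\<in>?J. a t \<in> V} g"
      using a V unfolding C1_curve_def by blast
    from choice[OF this] obtain g where g': "\<forall>i. i < ?n \<longrightarrow>
        (\<forall>t\<in>{t\<in>?J. a t \<in> V}. ((\<lambda>s. y (a s) i) has_real_derivative g i t) (at t within ?J)) \<and>
        continuous_on {t\<in>?J. a t \<in> V} (g i)" ..
    have g: "(\<forall>t\<in>{t\<in>?J. a t \<in> V}. ((\<lambda>s. y (a s) i) has_real_derivative g i t) (at t within ?J)) \<and>
        continuous_on {t\<in>?J. a t \<in> V} (g i)" if "i < ?n" for i
      using g' that by (elim allE impE)
    let ?F = "\<lambda>z. f (inv_into V y z)"
    have SO: "openin (Euclidean_space ?n) (y ` (V \<inter> W))" by (rule local_coords_open_image[OF y W])
    have F: "Cinf_on ?n (y ` (V \<inter> W)) ?F" by (rule smooth_fun_on_chart[OF N W f y])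
    let ?h = "\<lambda>t. \<Sum>i<?n. partial_deriv i ?F (y (a t)) * g i t"
    have "((\<lambda>s. f (a s)) has_real_derivative ?h t) (at t within ?J)" if t: "t \<in> ?J" "a t \<in> V \<inter> W" for t
    proof -
      have near: "\<forall>\<^sub>F s in at t within ?J. a s \<in> V"
        using curve_eventually[OF ac local_coords_open[OF y] t(1)] t(2) by (simp add: eventually_conj_iff)
      have d: "((\<lambda>s. ?F (y (a s))) has_real_derivative ?h t) (at t within ?J)"
      proof (rule Ck_on_curve_DERIV[OF SO, of ?F "\<lambda>s. y (a s)"])
        show "Ck_on ?n (Suc 0) (y ` (V \<inter> W)) ?F" using F unfolding Cinf_on_def by (rule spec)
        show "y (a t) \<in> y ` (V \<inter> W)" using t by blast
        show "\<forall>\<^sub>F s in at t within ?J. y (a s) \<in> ES ?n"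
          using near by (rule eventually_mono) (rule local_coords_ES[OF y])
        show "((\<lambda>s. y (a s) i) has_real_derivative g i t) (at t within ?J)" if "i < ?n" for i
          using g[OF that] t by blast
      qed
      have ev: "\<forall>\<^sub>F s in at t within ?J. ?F (y (a s)) = f (a s)"
        using near by (rule eventually_mono) (simp add: local_coords_inv[OF y])
      show ?thesis
        by (rule has_field_derivative_cong_eventually[THEN iffD1, OF ev _ d]) (use t local_coords_inv[OF y] in auto)
    qed
    moreover have "continuous_on {t\<in>?J. a t \<in> V \<inter> W} ?h"
    proof (intro continuous_on_sum continuous_on_mult)
      fix i assume "i \<in> {..<?n}"
      then have i: "i < ?n" by simp
      show "continuous_on {t\<in>?J. a t \<in> V \<inter> W} (g i)"
        by (rule continuous_on_subset[of "{t\<in>?J. a t \<in> V}"]) (use g[OF i] in auto)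
      have ya: "continuous_on {t\<in>?J. a t \<in> V \<inter> W} (\<lambda>t. y (a t))"
      proof (rule continuous_on_coordinatewise_then_product)
        fix j
        show "continuous_on {t\<in>?J. a t \<in> V \<inter> W} (\<lambda>t. y (a t) j)"
        proof (cases "j < ?n")
          case True
          have "continuous (at t within {t\<in>?J. a t \<in> V \<inter> W}) (\<lambda>t. y (a t) j)" if "t \<in> {t\<in>?J. a t \<in> V \<inter> W}" for t
            by (rule continuous_within_subset[OF DERIV_continuous[of _ "g j t" t ?J]]) (use g[OF True] that in auto)
          then show ?thesis unfolding continuous_on_eq_continuous_within by blast
        next
          case False
          then have "y (a t) j = 0" if "t \<in> {t\<in>?J. a t \<in> V \<inter> W}" for t
            using local_coords_ES[OF y, of "a t"] that by simp
          then show ?thesis by (subst continuous_on_cong[OF refl]) auto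
        qed
      qed
      have "continuous_on (y ` (V \<inter> W)) (partial_deriv i ?F)"
        by (rule Cinf_on_continuous[OF Cinf_on_partial[OF F i]])
      from continuous_on_compose2[OF this ya]
      show "continuous_on {t\<in>?J. a t \<in> V \<inter> W} (\<lambda>t. partial_deriv i ?F (y (a t)))" by blast
    qed
    ultimately show ?thesis by (intro exI[of _ ?h] conjI ballI) auto
  qed
  have at: "\<exists>V h'. t \<in> {t\<in>?J. a t \<in> V \<inter> W} \<and> openin (mtop N) V \<and>
      (\<forall>t\<in>{t\<in>?J. a t \<in> V \<inter> W}. ((\<lambda>s. f (a s)) has_real_derivative h' t) (at t within ?J)) \<and>
      continuous_on {t\<in>?J. a t \<in> V \<inter> W} h'" if t: "t \<in> {t\<in>?J. a t \<in> W}" for t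
  proof -
    have "a t \<in> points N" using t openin_subset[OF W] by blast
    then obtain V y where V: "(V, y) \<in> matlas N" "a t \<in> V" "local_coords N V y" by (rule atlas_at[OF N])
    from key[OF V(1)] show ?thesis
      by (elim exE conjE, intro exI conjI) (use t V(2) local_coords_open[OF V(3)] in auto)
  qed
  have hD: "h t = d" if "((\<lambda>s. f (a s)) has_real_derivative d) (at t within ?J)" "t \<in> ?J" for d t
    unfolding h_def using that lt
    by (intro vector_derivative_within_closed_interval) (auto simp: has_real_derivative_iff_has_vector_derivative)
  have "((\<lambda>s. f (a s)) has_real_derivative h t) (at t within ?J)" if t: "t \<in> {t\<in>?J. a t \<in> W}" for t
  proof -
    obtain V h' where *: "t \<in> {t\<in>?J. a t \<in> V \<inter> W}" 
      "\<forall>t\<in>{t\<in>?J. a t \<in> V \<inter> W}. ((\<lambda>s. f (a s)) has_real_derivative h' t) (at t within ?J)"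
      using at[OF t] by (elim exE conjE) (rule that)
    have d: "((\<lambda>s. f (a s)) has_real_derivative h' t) (at t within ?J)" using * by (rule bspec[rotated])
    show ?thesis using d hD[OF d] t by simp
  qed
  moreover have "continuous_on {t\<in>?J. a t \<in> W} h"
    unfolding continuous_on_eq_continuous_within
  proof
    fix t assume t: "t \<in> {t\<in>?J. a t \<in> W}"
    obtain V h' where *: "t \<in> {t\<in>?J. a t \<in> V \<inter> W}" "openin (mtop N) V"
      "\<forall>t\<in>{t\<in>?J. a t \<in> V \<inter> W}. ((\<lambda>s. f (a s)) has_real_derivative h' t) (at t within ?J)"
      "continuous_on {t\<in>?J. a t \<in> V \<inter> W} h'"
      using at[OF t] by (elim exE conjE) (rule that)
    have "openin (top_of_set ?J) {t\<in>?J. a t \<in> V}" by (rule pre[OF *(2)])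
    then obtain G where G: "open G" "{s \<in> ?J. a s \<in> V} = ?J \<inter> G" unfolding openin_open by blast
    have "h s = h' s" if "s \<in> {t\<in>?J. a t \<in> V \<inter> W}" for s
      by (rule hD) (use bspec[OF *(3) that] that in simp_all)
    then have "continuous_on {t\<in>?J. a t \<in> V \<inter> W} h" by (intro continuous_on_eq[OF *(4)]) (rule sym)
    then have "continuous (at t within {t\<in>?J. a t \<in> V \<inter> W}) h"
      using *(1) unfolding continuous_on_eq_continuous_within by (rule bspec)
    \<comment> \<open>The two sets coincide near t, namely on the open set G that cuts out the
      preimage of V in the interval.\<close>
    moreover have "at t within {t\<in>?J. a t \<in> V \<inter> W} = at t within {t\<in>?J. a t \<in> W}"
    proof (rule at_within_nhd[of _ G])
      have "t \<in> {s \<in> ?J. a s \<in> V}" using *(1) by simp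
      then show "t \<in> G" unfolding G(2) by simp
      have "s \<in> ?J \<and> a s \<in> V \<longleftrightarrow> s \<in> ?J \<and> s \<in> G" for s
      proof -
        have "s \<in> {s \<in> ?J. a s \<in> V} \<longleftrightarrow> s \<in> ?J \<inter> G" unfolding G(2) ..
        then show ?thesis by simp
      qed
      then show "{t \<in> ?J. a t \<in> V \<inter> W} \<inter> G - {t} = {t \<in> ?J. a t \<in> W} \<inter> G - {t}" by blast
    qed (rule G(1))
    ultimately show "continuous (at t within {t\<in>?J. a t \<in> W}) h" by simp
  qed
  ultimately show ?thesis by (intro exI[of _ h] conjI ballI)
qed

section \<open>Lie algebroids in local coordinates\<close>

lemma tangent_bundle_points: "points (vtotal (tangent_bundle M)) \<subseteq> tangent_points M"
  by (auto simp: tangent_bundle_def topology_generated_by_topspace)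

locale lie_alg =
  fixes E :: "('m, 'e) algebroid"
  assumes la: "lie_algebroid E"
begin

sublocale vbundle E
  using la by unfold_locales (simp add: lie_algebroid_def)

lemma anchor_map: "vbundle_map E (tangent_bundle B) (\<lambda>m. m) (anchor E)"
  using la by (simp add: lie_algebroid_def)

text \<open>Through this, the calculation rules for tangent vectors become available for
  \<open>anchor_deriv E v\<close>.\<close>

lemma anchor_tangent:
  assumes v: "v \<in> fibre E m"
  shows "anchor_deriv E v \<in> tangent_space B m" "fst (anchor E v) = m"
proof -
  have vT: "v \<in> points T" by (rule fibre_total[OF v])
  have "smooth_map_on T (points T) (vtotal (tangent_bundle B)) (anchor E)"
    using anchor_map by (simp add: vbundle_map_def)
  then have "anchor E v \<in> points (vtotal (tangent_bundle B))"
    by (rule smooth_map_on_point[OF _ vT subset_refl])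
  then have p: "anchor E v \<in> tangent_points B" using tangent_bundle_points by blast
  have "vproj (tangent_bundle B) (anchor E v) = vproj E v"
    using anchor_map vT unfolding vbundle_map_def by blast
  then show f: "fst (anchor E v) = m" using fibre_vproj[OF v] by (simp add: tangent_bundle_def)
  have "snd (anchor E v) \<in> tangent_space B (fst (anchor E v))"
    using p by (simp add: tangent_points_def split_beta)
  moreover have "anchor_deriv E v = snd (anchor E v)" by (rule ext) (simp add: anchor_deriv_def)
  ultimately show "anchor_deriv E v \<in> tangent_space B m" using f by simp
qed

lemma anchor_deriv_add:
  assumes "u \<in> fibre E m" "v \<in> fibre E m"
  shows "anchor_deriv E (vadd E u v) f = anchor_deriv E u f + anchor_deriv E v f"
proof -
  have "anchor E (vadd E u v) = vadd (tangent_bundle B) (anchor E u) (anchor E v)"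
    using anchor_map assms fibre_base[OF assms(1)] unfolding vbundle_map_def by blast
  then show ?thesis by (simp add: anchor_deriv_def tangent_bundle_def split_beta)
qed

lemma anchor_deriv_scale:
  assumes "u \<in> fibre E m"
  shows "anchor_deriv E (vscale E c u) f = c * anchor_deriv E u f"
proof -
  have "anchor E (vscale E c u) = vscale (tangent_bundle B) c (anchor E u)"
    using anchor_map assms fibre_base[OF assms(1)] unfolding vbundle_map_def by blast
  then show ?thesis by (simp add: anchor_deriv_def tangent_bundle_def split_beta)
qed

lemma anchor_deriv_lincomb:
  assumes m: "m \<in> points B"
  shows "(\<And>\<alpha>. \<alpha> < r \<Longrightarrow> f \<alpha> \<in> fibre E m) \<Longrightarrow>
    anchor_deriv E (lincomb E m r c f) g = (\<Sum>\<alpha><r. c \<alpha> * anchor_deriv E (f \<alpha>) g)"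
proof (induction r)
  case 0
  \<comment> \<open>The zero vector is 0 times itself, so homogeneity gives the value 0.\<close>
  have "anchor_deriv E (vscale E 0 (vzero E m)) g = 0"
    unfolding anchor_deriv_scale[OF vzero_fibre[OF m]] by simp
  then show ?case by (simp add: vscale_vzero[OF m])
next
  case (Suc r)
  have "anchor_deriv E (lincomb E m (Suc r) c f) g =
      anchor_deriv E (lincomb E m r c f) g + anchor_deriv E (vscale E (c r) (f r)) g"
    unfolding lincomb.simps
    by (rule anchor_deriv_add[OF lincomb_fibre[OF m] vscale_fibre[OF m]]) (use Suc.prems in auto)
  also have "anchor_deriv E (vscale E (c r) (f r)) g = c r * anchor_deriv E (f r) g"
    by (rule anchor_deriv_scale[OF Suc.prems]) simp
  finally show ?case using Suc by simp
qed

lemma anchor_deriv_frame: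
  assumes e: "frame e m" and v: "v \<in> fibre E m"
  shows "anchor_deriv E v g = (\<Sum>\<alpha><k. yc e v \<alpha> * anchor_deriv E (e \<alpha> m) g)"
  using anchor_deriv_lincomb[OF fibre_base[OF v], of k "\<lambda>\<alpha>. e \<alpha> m" "yc e v" g] frame_fibre[OF e]
  unfolding frame_coord(2)[OF e v] by simp

section \<open>The bracket in components\<close>

lemma lie_bracket: "lie_bracket_on_sections E"
  using la by (simp add: lie_algebroid_def)

lemma bracket_gsection: "\<sigma> \<in> gsections E \<Longrightarrow> \<eta> \<in> gsections E \<Longrightarrow> bracket E \<sigma> \<eta> \<in> gsections E"
  using lie_bracket unfolding lie_bracket_on_sections_def by blast

lemma sec_add_gsection:
  assumes "\<sigma> \<in> gsections E" "\<eta> \<in> gsections E" shows "sec_add E \<sigma> \<eta> \<in> gsections E"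
proof -
  define h where "h j = (if j = 0 then \<sigma> else \<eta>)" for j :: nat
  have "glincomb 2 (\<lambda>_ _. 1) h = sec_add E \<sigma> \<eta>"
    by (auto simp: glincomb_def sec_add_def fun_eq_iff numeral_2_eq_2 h_def vadd_vzero_left vscale_1
        gsection_fibre[OF assms(1)] gsection_fibre[OF assms(2)])
  moreover have "glincomb 2 (\<lambda>_ _. 1) h \<in> gsections E"
    by (rule glincomb_gsection[OF _ smooth_fun_on_const]) (simp add: h_def assms)
  ultimately show ?thesis by simp
qed

lemma glincomb_Suc:
  "glincomb (Suc r) c e = sec_add E (glincomb r c e) (sec_scale E (c r) (e r))"
  by (auto simp: glincomb_def sec_add_def sec_scale_def fun_eq_iff)

lemma glincomb_0: "\<sigma> \<in> gsections E \<Longrightarrow> glincomb 0 c e = sec_scale E (\<lambda>_. 0) \<sigma>"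
  by (auto simp: glincomb_def sec_scale_def fun_eq_iff vscale_0 gsection_fibre)

context
  fixes m e assumes m: "m \<in> points B" and e: "frame e m"
begin

text \<open>With m and e fixed, identities between sections become identities between
  numbers.\<close>

definition bracket_comp :: "nat \<Rightarrow> ('m \<Rightarrow> 'e) \<Rightarrow> ('m \<Rightarrow> 'e) \<Rightarrow> real" where
  "bracket_comp \<gamma> \<sigma> \<eta> = yc e (bracket E \<sigma> \<eta> m) \<gamma>"

lemma bracket_comp_fibre: "\<sigma> \<in> gsections E \<Longrightarrow> \<eta> \<in> gsections E \<Longrightarrow> bracket E \<sigma> \<eta> m \<in> fibre E m"
  by (rule gsection_fibre[OF bracket_gsection m])

lemma bracket_comp_add_left:
  assumes "\<sigma> \<in> gsections E" "\<eta> \<in> gsections E" "\<zeta> \<in> gsections E"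
  shows "bracket_comp \<gamma> (sec_add E \<sigma> \<eta>) \<zeta> = bracket_comp \<gamma> \<sigma> \<zeta> + bracket_comp \<gamma> \<eta> \<zeta>"
proof -
  have "bracket E (sec_add E \<sigma> \<eta>) \<zeta> = sec_add E (bracket E \<sigma> \<zeta>) (bracket E \<eta> \<zeta>)"
    using lie_bracket assms unfolding lie_bracket_on_sections_def by blast
  then show ?thesis
    using basis_coord_add[OF m e bracket_comp_fibre[OF assms(1,3)] bracket_comp_fibre[OF assms(2,3)]] m by (simp add: bracket_comp_def sec_add_def)
qed

lemma bracket_comp_add_right:
  assumes "\<sigma> \<in> gsections E" "\<eta> \<in> gsections E" "\<zeta> \<in> gsections E"
  shows "bracket_comp \<gamma> \<zeta> (sec_add E \<sigma> \<eta>) = bracket_comp \<gamma> \<zeta> \<sigma> + bracket_comp \<gamma> \<zeta> \<eta>"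
proof -
  have "bracket E \<zeta> (sec_add E \<sigma> \<eta>) = sec_add E (bracket E \<zeta> \<sigma>) (bracket E \<zeta> \<eta>)"
    using lie_bracket assms unfolding lie_bracket_on_sections_def by blast
  then show ?thesis
    using basis_coord_add[OF m e bracket_comp_fibre[OF assms(3,1)] bracket_comp_fibre[OF assms(3,2)]] m by (simp add: bracket_comp_def sec_add_def)
qed

lemma bracket_comp_self: assumes "\<sigma> \<in> gsections E" shows "bracket_comp \<gamma> \<sigma> \<sigma> = 0"
proof -
  have "bracket E \<sigma> \<sigma> = sec_zero E"
    using lie_bracket assms unfolding lie_bracket_on_sections_def by blast
  then show ?thesis using m basis_coord_zero[OF m e] by (simp add: bracket_comp_def sec_zero_def)
qed

text \<open>Polarization of [\<sigma>, \<sigma>] = 0.\<close>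

lemma bracket_comp_anti:
  assumes "\<sigma> \<in> gsections E" "\<eta> \<in> gsections E" shows "bracket_comp \<gamma> \<sigma> \<eta> = - bracket_comp \<gamma> \<eta> \<sigma>"
proof -
  have "bracket_comp \<gamma> (sec_add E \<sigma> \<eta>) (sec_add E \<sigma> \<eta>) = 0" by (rule bracket_comp_self[OF sec_add_gsection[OF assms]])
  then show ?thesis
    unfolding bracket_comp_add_left[OF assms sec_add_gsection[OF assms]] bracket_comp_add_right[OF assms assms(1)]
      bracket_comp_add_right[OF assms assms(2)] bracket_comp_self[OF assms(1)] bracket_comp_self[OF assms(2)] by simp
qed

lemma bracket_comp_scale_right:
  assumes s: "\<sigma> \<in> gsections E" and h: "\<eta> \<in> gsections E" and f: "smooth_fun_on B (points B) f"
  shows "bracket_comp \<gamma> \<sigma> (sec_scale E f \<eta>) = anchor_deriv E (\<sigma> m) f * yc e (\<eta> m) \<gamma> + f m * bracket_comp \<gamma> \<sigma> \<eta>"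
proof -
  have "bracket E \<sigma> (sec_scale E f \<eta>) =
      sec_add E (sec_scale E (\<lambda>m. anchor_deriv E (\<sigma> m) f) \<eta>) (sec_scale E f (bracket E \<sigma> \<eta>))"
    using la s h f unfolding lie_algebroid_def by blast
  then have "bracket_comp \<gamma> \<sigma> (sec_scale E f \<eta>) =
      yc e (vadd E (vscale E (anchor_deriv E (\<sigma> m) f) (\<eta> m)) (vscale E (f m) (bracket E \<sigma> \<eta> m))) \<gamma>"
    using m by (simp add: bracket_comp_def sec_add_def sec_scale_def)
  also have "\<dots> = anchor_deriv E (\<sigma> m) f * yc e (\<eta> m) \<gamma> + f m * bracket_comp \<gamma> \<sigma> \<eta>"
    using gsection_fibre[OF h m] bracket_comp_fibre[OF s h]
    by (simp add: basis_coord_add[OF m e] basis_coord_scale[OF m e] vscale_fibre[OF m] bracket_comp_def)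
  finally show ?thesis .
qed

text \<open>Multiplication by a bump function makes the two sections equal, and by the Leibniz rule it does not
  change the bracket at \<open>m\<close> beyond a term depending only on the value of the section there.\<close>

lemma bracket_comp_local_right:
  assumes s: "\<sigma> \<in> gsections E" and h: "\<eta> \<in> gsections E" "\<eta>' \<in> gsections E"
    and W: "openin (mtop B) W" "m \<in> W" "\<And>q. q \<in> W \<Longrightarrow> \<eta> q = \<eta>' q"
  shows "bracket_comp \<gamma> \<sigma> \<eta> = bracket_comp \<gamma> \<sigma> \<eta>'"
proof -
  obtain b K W' where b: "smooth_fun_on B (points B) b" "K \<subseteq> W" "\<And>q. q \<notin> K \<Longrightarrow> b q = 0"
    "m \<in> W'" "\<And>q. q \<in> W' \<Longrightarrow> b q = 1"
    by (rule smooth_bump[OF base_manifold W(1,2)]) (rule that)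
  have "vscale E (b q) (\<eta> q) = vscale E (b q) (\<eta>' q)" if q: "q \<in> points B" for q
  proof (cases "q \<in> W")
    case True then show ?thesis using W(3) by simp
  next
    case False
    then have "b q = 0" using b(2,3) by blast
    then show ?thesis using vscale_0[OF q] gsection_fibre[OF h(1) q] gsection_fibre[OF h(2) q] by simp
  qed
  then have eq: "sec_scale E b \<eta> = sec_scale E b \<eta>'" by (auto simp: sec_scale_def fun_eq_iff)
  have "b m = 1" by (rule b(5)[OF b(4)])
  then show ?thesis
    using bracket_comp_scale_right[OF s h(1) b(1), of \<gamma>] bracket_comp_scale_right[OF s h(2) b(1), of \<gamma>] W(3)[OF W(2)] eq by simp
qed

text \<open>Antisymmetry turns locality in the right argument into locality in the left one.\<close>

lemma bracket_comp_local:
  assumes s: "\<sigma> \<in> gsections E" "\<sigma>' \<in> gsections E" and h: "\<eta> \<in> gsections E" "\<eta>' \<in> gsections E"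
    and W: "openin (mtop B) W" "m \<in> W" "\<And>q. q \<in> W \<Longrightarrow> \<eta> q = \<eta>' q" "\<And>q. q \<in> W \<Longrightarrow> \<sigma> q = \<sigma>' q"
  shows "bracket_comp \<gamma> \<sigma> \<eta> = bracket_comp \<gamma> \<sigma>' \<eta>'"
  using bracket_comp_local_right[OF s(1) h W(1-3), of \<gamma>] bracket_comp_local_right[OF h(2) s W(1,2,4), of \<gamma>]
    bracket_comp_anti[OF s(1) h(2), of \<gamma>] bracket_comp_anti[OF s(2) h(2), of \<gamma>] by simp

lemma bracket_comp_glincomb_right:
  assumes s: "\<sigma> \<in> gsections E"
  shows "(\<And>\<beta>. \<beta> < r \<Longrightarrow> g \<beta> \<in> gsections E) \<Longrightarrow> (\<And>\<beta>. \<beta> < r \<Longrightarrow> smooth_fun_on B (points B) (c \<beta>)) \<Longrightarrow>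
    bracket_comp \<gamma> \<sigma> (glincomb r c g) = (\<Sum>\<beta><r. anchor_deriv E (\<sigma> m) (c \<beta>) * yc e (g \<beta> m) \<gamma> + c \<beta> m * bracket_comp \<gamma> \<sigma> (g \<beta>))"
proof (induction r)
  case 0
  \<comment> \<open>The empty combination is the zero section, written as 0 times \<sigma> so that
    homogeneity of the bracket applies.\<close>
  have "bracket E \<sigma> (sec_scale E (\<lambda>_. 0) \<sigma>) = sec_scale E (\<lambda>_. 0) (bracket E \<sigma> \<sigma>)"
    using lie_bracket s unfolding lie_bracket_on_sections_def by blast
  then have "bracket_comp \<gamma> \<sigma> (sec_scale E (\<lambda>_. 0) \<sigma>) = 0"
    using m basis_coord_scale[OF m e bracket_comp_fibre[OF s s], of 0] by (simp add: bracket_comp_def sec_scale_def)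
  then show ?case by (simp add: glincomb_0[OF s])
next
  case (Suc r)
  have g: "glincomb r c g \<in> gsections E" by (rule glincomb_gsection) (use Suc.prems in auto)
  have gr: "g r \<in> gsections E" "smooth_fun_on B (points B) (c r)" using Suc.prems by auto
  show ?case
    unfolding glincomb_Suc bracket_comp_add_right[OF g sec_scale_gsection[OF gr] s] bracket_comp_scale_right[OF s gr]
    using Suc by simp
qed

end

lemma anchor_cong:
  assumes v: "v \<in> fibre E m" and W: "openin (mtop B) W" "m \<in> W"
    and f: "smooth_fun_on B W f" "\<And>q. q \<in> W \<Longrightarrow> f q = g q"
  shows "anchor_deriv E v f = anchor_deriv E v g"
  by (rule tangent_cong[OF base_manifold anchor_tangent(1)[OF v] W f])

text \<open>Both sections are expanded in the basis, and the Leibniz rule is used in each argument.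
  Bracket and Leibniz rule concern global sections, so e is replaced by global sections e' and the
  components by global functions \<open>ext\<close>; the resulting combinations agree with \<sigma>
  and \<eta> near m, which is enough because the bracket is local.\<close>

lemma bracket_coord:
  assumes e: "local_basis E U e" and m: "m \<in> U" and s: "\<sigma> \<in> gsections E" and h: "\<eta> \<in> gsections E" and \<gamma>: "\<gamma> < k"
  shows "yc e (bracket E \<sigma> \<eta> m) \<gamma> =
    (\<Sum>\<alpha><k. \<Sum>\<beta><k. structure_fun E e \<gamma> \<alpha> \<beta> m * yc e (\<sigma> m) \<alpha> * yc e (\<eta> m) \<beta>)
    + anchor_deriv E (\<sigma> m) (\<lambda>q. yc e (\<eta> q) \<gamma>) - anchor_deriv E (\<eta> m) (\<lambda>q. yc e (\<sigma> q) \<gamma>)"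
proof -
  have mB: "m \<in> points B" by (rule local_basis_points[OF e m])
  have fr: "frame e m" by (rule local_basis_frame[OF e m])
  note UO = local_basis_open[OF e]
  obtain e' W1 where e': "\<And>\<alpha>. \<alpha> < k \<Longrightarrow> e' \<alpha> \<in> gsections E" and W1: "openin (mtop B) W1" "m \<in> W1" "W1 \<subseteq> U"
    "\<And>\<alpha> q. \<alpha> < k \<Longrightarrow> q \<in> W1 \<Longrightarrow> e' \<alpha> q = e \<alpha> q"
    by (rule local_basis_extend[OF e m]) (rule that)
  obtain b K W2 where b: "smooth_fun_on B (points B) b" "closedin (mtop B) K" "K \<subseteq> U" "\<And>q. q \<notin> K \<Longrightarrow> b q = 0"
    "openin (mtop B) W2" "m \<in> W2" "W2 \<subseteq> K" "\<And>q. q \<in> W2 \<Longrightarrow> b q = 1"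
    by (rule smooth_bump[OF base_manifold UO m]) (rule that)
  define W where "W = W1 \<inter> W2"
  have W: "openin (mtop B) W" "m \<in> W" using W1 b(5,6) by (auto simp: W_def)
  \<comment> \<open>Components exist over U only; the factor b makes them globally smooth and leaves
    them unchanged near m.\<close>
  define ext where "ext \<tau> \<alpha> q = (if q \<in> U then b q * yc e (\<tau> q) \<alpha> else 0)" for \<tau> :: "'m \<Rightarrow> 'e" and \<alpha> q
  have ext_smooth: "smooth_fun_on B (points B) (ext \<tau> \<alpha>)" if "\<tau> \<in> gsections E" for \<tau> \<alpha>
    unfolding ext_def by (rule smooth_fun_on_cutoff[OF base_manifold UO gsection_component_smooth[OF that e] b(1-4)])
  have ext_eq: "ext \<tau> \<alpha> q = yc e (\<tau> q) \<alpha>" if "q \<in> W" for \<tau> \<alpha> q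
    using that b(8)[of q] W1(3) by (auto simp: ext_def W_def)
  have ext_deriv: "anchor_deriv E v (ext \<tau> \<alpha>) = anchor_deriv E v (\<lambda>q. yc e (\<tau> q) \<alpha>)"
    if "\<tau> \<in> gsections E" "v \<in> fibre E m" for \<tau> \<alpha> v
    by (rule anchor_cong[OF that(2) W smooth_fun_on_subset[OF ext_smooth[OF that(1)] openin_subset[OF W(1)]] ext_eq])
  have expand: "glincomb k (ext \<tau>) e' q = \<tau> q" if \<tau>: "\<tau> \<in> gsections E" and q: "q \<in> W" for \<tau> q
  proof -
    have qU: "q \<in> U" "q \<in> W1" using q W1(3) by (auto simp: W_def)
    have qB: "q \<in> points B" by (rule local_basis_points[OF e qU(1)])
    have "glincomb k (ext \<tau>) e' q = lincomb E q k (yc e (\<tau> q)) (\<lambda>\<alpha>. e \<alpha> q)"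
      unfolding glincomb_def using qB by (simp, intro lincomb_cong) (auto simp: ext_eq[OF q] W1(4)[OF _ qU(2)])
    also have "\<dots> = \<tau> q" by (rule frame_coord(2)[OF local_basis_frame[OF e qU(1)] gsection_fibre[OF \<tau> qB]])
    finally show ?thesis .
  qed
  \<comment> \<open>The value selected by \<open>SOME\<close> in \<open>local_bracket\<close> stems
    from some pair of extensions. These agree near m with \<open>e' \<alpha>\<close> and
    \<open>e' \<beta>\<close>, so locality identifies the components of the brackets.\<close>
  have C: "structure_fun E e \<gamma> \<alpha> \<beta> m = bracket_comp m e \<gamma> (e' \<alpha>) (e' \<beta>)" if \<alpha>\<beta>: "\<alpha> < k" "\<beta> < k" for \<alpha> \<beta>
  proof -
    let ?P = "\<lambda>v. \<exists>\<sigma>'\<in>gsections E. \<exists>\<eta>'\<in>gsections E. agree_near B m \<sigma>' (e \<alpha>) \<and> agree_near B m \<eta>' (e \<beta>) \<and> v = bracket E \<sigma>' \<eta>' m"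
    have near: "agree_near B m (e' \<alpha>) (e \<alpha>)" if "\<alpha> < k" for \<alpha>
      unfolding agree_near_def using W1 that by (intro exI[of _ W1]) simp
    have "?P (bracket E (e' \<alpha>) (e' \<beta>) m)"
      by (intro bexI conjI) (rule near[OF \<alpha>\<beta>(1)], rule near[OF \<alpha>\<beta>(2)], rule refl, rule e'[OF \<alpha>\<beta>(2)], rule e'[OF \<alpha>\<beta>(1)])
    then have "?P (local_bracket E (e \<alpha>) (e \<beta>) m)"
      unfolding local_bracket_def by (rule someI[of ?P])
    then obtain \<sigma>' \<eta>' where *: "\<sigma>' \<in> gsections E" "\<eta>' \<in> gsections E" "agree_near B m \<sigma>' (e \<alpha>)" "agree_near B m \<eta>' (e \<beta>)"
      "local_bracket E (e \<alpha>) (e \<beta>) m = bracket E \<sigma>' \<eta>' m" by (elim bexE conjE) (rule that)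
    obtain V1 where V1: "openin (mtop B) V1" "m \<in> V1" "\<forall>q\<in>V1. \<sigma>' q = e \<alpha> q" using *(3) unfolding agree_near_def by (elim exE conjE) (rule that)
    obtain V2 where V2: "openin (mtop B) V2" "m \<in> V2" "\<forall>q\<in>V2. \<eta>' q = e \<beta> q" using *(4) unfolding agree_near_def by (elim exE conjE) (rule that)
    have "bracket_comp m e \<gamma> \<sigma>' \<eta>' = bracket_comp m e \<gamma> (e' \<alpha>) (e' \<beta>)"
    proof (rule bracket_comp_local[OF mB fr *(1) e'[OF \<alpha>\<beta>(1)] *(2) e'[OF \<alpha>\<beta>(2)]])
      show "openin (mtop B) (V1 \<inter> V2 \<inter> W1)" by (intro openin_Int V1(1) V2(1) W1(1))
      show "m \<in> V1 \<inter> V2 \<inter> W1" using V1(2) V2(2) W1(2) by blast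
      show "\<eta>' q = e' \<beta> q" "\<sigma>' q = e' \<alpha> q" if "q \<in> V1 \<inter> V2 \<inter> W1" for q
        using that V1(3) V2(3) W1(4)[OF \<alpha>\<beta>(1), of q] W1(4)[OF \<alpha>\<beta>(2), of q] by auto
    qed
    then show ?thesis unfolding structure_fun_def *(5) bracket_comp_def[OF mB fr] .
  qed
  have e'm: "e' \<alpha> m = e \<alpha> m" if "\<alpha> < k" for \<alpha> by (rule W1(4)[OF that W1(2)])
  have delta: "yc e (e' \<alpha> m) \<gamma> = (if \<gamma> = \<alpha> then 1 else 0)" if "\<alpha> < k" for \<alpha>
    unfolding e'm[OF that] by (rule basis_coord_basis[OF mB fr that \<gamma>])
  have sm: "\<sigma> m \<in> fibre E m" and hm: "\<eta> m \<in> fibre E m" by (rule gsection_fibre[OF s mB], rule gsection_fibre[OF h mB])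
  have em: "e \<alpha> m \<in> fibre E m" if "\<alpha> < k" for \<alpha> by (rule frame_fibre[OF fr that])
  let ?D = "\<lambda>v \<tau> \<gamma>. anchor_deriv E v (\<lambda>q. yc e (\<tau> q) \<gamma>)"
  \<comment> \<open>Leibniz rule in the right argument. Since e' is the basis e at m, only the
    derivative of component \<gamma> survives.\<close>
  have step: "bracket_comp m e \<gamma> \<tau> \<zeta> = ?D (\<tau> m) \<zeta> \<gamma> + (\<Sum>\<beta><k. yc e (\<zeta> m) \<beta> * bracket_comp m e \<gamma> \<tau> (e' \<beta>))"
    if \<tau>: "\<tau> \<in> gsections E" and \<zeta>: "\<zeta> \<in> gsections E" for \<tau> \<zeta>
  proof -
    have \<tau>m: "\<tau> m \<in> fibre E m" by (rule gsection_fibre[OF \<tau> mB])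
    have "bracket_comp m e \<gamma> \<tau> \<zeta> = bracket_comp m e \<gamma> \<tau> (glincomb k (ext \<zeta>) e')"
      by (rule bracket_comp_local_right[OF mB fr \<tau> \<zeta> glincomb_gsection[of k e' "ext \<zeta>", OF e' ext_smooth[OF \<zeta>]] W]) (simp_all add: expand[OF \<zeta>])
    also have "\<dots> = (\<Sum>\<beta><k. anchor_deriv E (\<tau> m) (ext \<zeta> \<beta>) * yc e (e' \<beta> m) \<gamma> + ext \<zeta> \<beta> m * bracket_comp m e \<gamma> \<tau> (e' \<beta>))"
      by (rule bracket_comp_glincomb_right[OF mB fr \<tau> e' ext_smooth[OF \<zeta>]])
    also have "\<dots> = (\<Sum>\<beta><k. ?D (\<tau> m) \<zeta> \<beta> * (if \<gamma> = \<beta> then 1 else 0)) + (\<Sum>\<beta><k. yc e (\<zeta> m) \<beta> * bracket_comp m e \<gamma> \<tau> (e' \<beta>))"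
      unfolding sum.distrib by (simp add: ext_deriv[OF \<zeta> \<tau>m] delta ext_eq[OF W(2)])
    also have "(\<Sum>\<beta><k. ?D (\<tau> m) \<zeta> \<beta> * (if \<gamma> = \<beta> then 1 else 0)) = ?D (\<tau> m) \<zeta> \<gamma>"
      using \<gamma> by (simp add: if_distrib[of "\<lambda>x. _ * x"] cong: if_cong)
    finally show ?thesis .
  qed
  \<comment> \<open>The expansion of the left argument, reached by exchanging the arguments: the two
    sign changes cancel in the structure functions, and one remains at the derivative.\<close>
  have inner: "bracket_comp m e \<gamma> \<sigma> (e' \<beta>) = (\<Sum>\<alpha><k. yc e (\<sigma> m) \<alpha> * structure_fun E e \<gamma> \<alpha> \<beta> m) - ?D (e \<beta> m) \<sigma> \<gamma>"
    if \<beta>: "\<beta> < k" for \<beta>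
  proof -
    have "bracket_comp m e \<gamma> \<sigma> (e' \<beta>) = - bracket_comp m e \<gamma> (e' \<beta>) \<sigma>" by (rule bracket_comp_anti[OF mB fr s e'[OF \<beta>]])
    also have "\<dots> = - (?D (e \<beta> m) \<sigma> \<gamma> + (\<Sum>\<alpha><k. yc e (\<sigma> m) \<alpha> * bracket_comp m e \<gamma> (e' \<beta>) (e' \<alpha>)))"
      unfolding step[OF e'[OF \<beta>] s] e'm[OF \<beta>] ..
    also have "(\<Sum>\<alpha><k. yc e (\<sigma> m) \<alpha> * bracket_comp m e \<gamma> (e' \<beta>) (e' \<alpha>)) = (\<Sum>\<alpha><k. yc e (\<sigma> m) \<alpha> * - structure_fun E e \<gamma> \<alpha> \<beta> m)"
    proof (rule sum.cong[OF refl])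
      fix \<alpha> assume "\<alpha> \<in> {..<k}"
      then have \<alpha>: "\<alpha> < k" by simp
      show "yc e (\<sigma> m) \<alpha> * bracket_comp m e \<gamma> (e' \<beta>) (e' \<alpha>) = yc e (\<sigma> m) \<alpha> * - structure_fun E e \<gamma> \<alpha> \<beta> m"
        unfolding C[OF \<alpha> \<beta>] bracket_comp_anti[OF mB fr e'[OF \<beta>] e'[OF \<alpha>]] by simp
    qed
    finally show ?thesis by (simp add: sum_negf)
  qed
  have "yc e (bracket E \<sigma> \<eta> m) \<gamma> = ?D (\<sigma> m) \<eta> \<gamma> + (\<Sum>\<beta><k. yc e (\<eta> m) \<beta> * bracket_comp m e \<gamma> \<sigma> (e' \<beta>))"
    using step[OF s h] unfolding bracket_comp_def[OF mB fr] .
  also have "(\<Sum>\<beta><k. yc e (\<eta> m) \<beta> * bracket_comp m e \<gamma> \<sigma> (e' \<beta>)) =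
      (\<Sum>\<beta><k. yc e (\<eta> m) \<beta> * ((\<Sum>\<alpha><k. yc e (\<sigma> m) \<alpha> * structure_fun E e \<gamma> \<alpha> \<beta> m) - ?D (e \<beta> m) \<sigma> \<gamma>))"
    by (rule sum.cong[OF refl]) (simp add: inner)
  also have "\<dots> = (\<Sum>\<beta><k. \<Sum>\<alpha><k. structure_fun E e \<gamma> \<alpha> \<beta> m * yc e (\<sigma> m) \<alpha> * yc e (\<eta> m) \<beta>)
      - (\<Sum>\<beta><k. yc e (\<eta> m) \<beta> * ?D (e \<beta> m) \<sigma> \<gamma>)"
    by (simp add: right_diff_distrib sum_subtractf sum_distrib_left mult_ac)
  also have "(\<Sum>\<beta><k. yc e (\<eta> m) \<beta> * ?D (e \<beta> m) \<sigma> \<gamma>) = ?D (\<eta> m) \<sigma> \<gamma>"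
    by (rule anchor_deriv_frame[OF fr hm, symmetric])
  also have "(\<Sum>\<beta><k. \<Sum>\<alpha><k. structure_fun E e \<gamma> \<alpha> \<beta> m * yc e (\<sigma> m) \<alpha> * yc e (\<eta> m) \<beta>) =
      (\<Sum>\<alpha><k. \<Sum>\<beta><k. structure_fun E e \<gamma> \<alpha> \<beta> m * yc e (\<sigma> m) \<alpha> * yc e (\<eta> m) \<beta>)" by (rule sum.swap)
  finally show ?thesis by simp
qed

section \<open>The Koszul formula in degrees 0 and 1\<close>

lemma koszul_0: "koszul E \<theta> [\<sigma>] m = anchor_deriv E (\<sigma> m) (\<lambda>q. \<theta> q [])"
  by (simp add: koszul_def omit_def)

lemma koszul_1:
  "koszul E \<theta> [\<sigma>, \<eta>] m = anchor_deriv E (\<sigma> m) (\<lambda>q. \<theta> q [\<eta> q]) - anchor_deriv E (\<eta> m) (\<lambda>q. \<theta> q [\<sigma> q])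
    - \<theta> m [bracket E \<sigma> \<eta> m]"
  by (simp add: koszul_def omit_def numeral_2_eq_2 lessThan_Suc)

text \<open>The product rule yields derivatives of the components of \<sigma> and \<eta>, and the
  bracket term yields the same derivatives with the opposite sign. What remains depends on
  \<open>\<sigma> m\<close> and \<open>\<eta> m\<close> only, so the choice of sections in
  \<open>ext_diff\<close> does not matter.\<close>

lemma koszul_1_coord:
  assumes e: "local_basis E U e" and m: "m \<in> U" and s: "\<sigma> \<in> gsections E" and h: "\<eta> \<in> gsections E"
    and W: "openin (mtop B) W" "m \<in> W" "W \<subseteq> U"
    and A: "\<And>\<alpha>. \<alpha> < k \<Longrightarrow> smooth_fun_on B W (A \<alpha>)"
    and \<theta>: "\<And>q v. q \<in> W \<Longrightarrow> v \<in> fibre E q \<Longrightarrow> \<theta> q [v] = (\<Sum>\<alpha><k. A \<alpha> q * yc e v \<alpha>)"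
  shows "koszul E \<theta> [\<sigma>, \<eta>] m =
    (\<Sum>\<beta><k. anchor_deriv E (\<sigma> m) (A \<beta>) * yc e (\<eta> m) \<beta>) - (\<Sum>\<alpha><k. anchor_deriv E (\<eta> m) (A \<alpha>) * yc e (\<sigma> m) \<alpha>)
    - (\<Sum>\<gamma><k. A \<gamma> m * (\<Sum>\<alpha><k. \<Sum>\<beta><k. structure_fun E e \<gamma> \<alpha> \<beta> m * yc e (\<sigma> m) \<alpha> * yc e (\<eta> m) \<beta>))"
proof -
  have mB: "m \<in> points B" by (rule local_basis_points[OF e m])
  have der: "anchor_deriv E v (\<lambda>q. \<theta> q [\<tau> q]) =
      (\<Sum>\<alpha><k. anchor_deriv E v (A \<alpha>) * yc e (\<tau> m) \<alpha> + A \<alpha> m * anchor_deriv E v (\<lambda>q. yc e (\<tau> q) \<alpha>))"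
    if \<tau>: "\<tau> \<in> gsections E" and v: "v \<in> fibre E m" for \<tau> v
  proof -
    note D = anchor_tangent(1)[OF v]
    have c: "smooth_fun_on B W (\<lambda>q. yc e (\<tau> q) \<alpha>)" for \<alpha>
      by (rule smooth_fun_on_subset[OF gsection_component_smooth[OF \<tau> e] W(3)])
    have Ac: "smooth_fun_on B W (\<lambda>q. A \<alpha> q * yc e (\<tau> q) \<alpha>)" if "\<alpha> < k" for \<alpha>
      by (rule smooth_fun_on_mult[OF base_manifold W(1) A[OF that] c])
    have "anchor_deriv E v (\<lambda>q. \<theta> q [\<tau> q]) = anchor_deriv E v (\<lambda>q. \<Sum>\<alpha><k. A \<alpha> q * yc e (\<tau> q) \<alpha>)"
    proof (rule anchor_cong[OF v W(1,2), symmetric])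
      show "smooth_fun_on B W (\<lambda>q. \<Sum>\<alpha><k. A \<alpha> q * yc e (\<tau> q) \<alpha>)"
        by (rule smooth_fun_on_sum[OF base_manifold W(1) Ac]) simp
      show "(\<Sum>\<alpha><k. A \<alpha> q * yc e (\<tau> q) \<alpha>) = \<theta> q [\<tau> q]" if "q \<in> W" for q
        by (rule \<theta>[OF that gsection_fibre[OF \<tau> openin_points_subset[OF W(1) that]], symmetric])
    qed
    also have "\<dots> = (\<Sum>\<alpha><k. anchor_deriv E v (\<lambda>q. A \<alpha> q * yc e (\<tau> q) \<alpha>))"
      by (rule tangent_sum[OF base_manifold D W(1,2) Ac])
    also have "\<dots> = (\<Sum>\<alpha><k. anchor_deriv E v (A \<alpha>) * yc e (\<tau> m) \<alpha> + A \<alpha> m * anchor_deriv E v (\<lambda>q. yc e (\<tau> q) \<alpha>))"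
      by (rule sum.cong[OF refl], rule tangent_mult[OF base_manifold D W(1,2) A c]) simp
    finally show ?thesis .
  qed
  have sm: "\<sigma> m \<in> fibre E m" and hm: "\<eta> m \<in> fibre E m" by (rule gsection_fibre[OF s mB], rule gsection_fibre[OF h mB])
  have "\<theta> m [bracket E \<sigma> \<eta> m] = (\<Sum>\<gamma><k. A \<gamma> m * ((\<Sum>\<alpha><k. \<Sum>\<beta><k. structure_fun E e \<gamma> \<alpha> \<beta> m * yc e (\<sigma> m) \<alpha> * yc e (\<eta> m) \<beta>)
    + anchor_deriv E (\<sigma> m) (\<lambda>q. yc e (\<eta> q) \<gamma>) - anchor_deriv E (\<eta> m) (\<lambda>q. yc e (\<sigma> q) \<gamma>)))"
    unfolding \<theta>[OF W(2) gsection_fibre[OF bracket_gsection[OF s h] mB]]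
    by (rule sum.cong[OF refl]) (simp add: bracket_coord[OF e m s h])
  then show ?thesis
    unfolding koszul_1 der[OF h sm] der[OF s hm]
    by (simp add: sum.distrib sum_subtractf distrib_left right_diff_distrib)
qed

end

section \<open>Derivatives of the Lagrangian along maps into the bundle\<close>

lemma sum_lessThan_add: "(\<Sum>j<n + k. f j) = (\<Sum>j<n. f j) + (\<Sum>\<alpha><k. f (n + \<alpha>))" for f :: "nat \<Rightarrow> real"
  by (induction k) (simp_all add: add.assoc)

context vbundle
begin

lemma dL_partial:
  assumes x: "local_coords B U x" and e: "local_basis E U e" and v: "v \<in> over E U" and j: "j < n + k"
  shows "coord_deriv (over E U) (induced_coords E x e) j L v = partial_deriv j (\<lambda>z. L (induced_par U x e z)) (induced_coords E x e v)"
  unfolding coord_deriv_def by (rule partial_par[OF x e v j])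

text \<open>The chain rule for L composed with a map w into the bundle. The source manifold M is
  general because the rule is needed for maps into E and into E' that are both defined on the base
  of E.\<close>

lemma tangent_total:
  assumes x: "local_coords B U x" and e: "local_basis E U e" and L: "smooth_fun_on T (points T) L"
    and M: "smooth_manifold M" and D: "D \<in> tangent_space M m" and W: "openin (mtop M) W" "m \<in> W"
    and w: "\<And>q. q \<in> W \<Longrightarrow> w q \<in> over E U"
    and s1: "\<And>i. i < n \<Longrightarrow> smooth_fun_on M W (\<lambda>q. x (vproj E (w q)) i)"
    and s2: "\<And>\<alpha>. \<alpha> < k \<Longrightarrow> smooth_fun_on M W (\<lambda>q. yc e (w q) \<alpha>)"
  shows "D (\<lambda>q. L (w q)) =
    (\<Sum>i<n. coord_deriv (over E U) (induced_coords E x e) i L (w m) * D (\<lambda>q. x (vproj E (w q)) i)) +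
    (\<Sum>\<alpha><k. coord_deriv (over E U) (induced_coords E x e) (n + \<alpha>) L (w m) * D (\<lambda>q. yc e (w q) \<alpha>))"
proof -
  let ?ind = "induced_coords E x e"
  let ?F = "\<lambda>z. L (induced_par U x e z)"
  let ?g = "\<lambda>j q. ?ind (w q) j"
  have F: "Cinf_on (n + k) (induced_dom U x) ?F" by (rule Cinf_on_par[OF x e L])
  have t: "tuple (n + k) ?g q = ?ind (w q)" for q
    by (rule tuple_eq) (auto simp: induced_coords_def)
  have g: "smooth_fun_on M W (?g j)" if "j < n + k" for j
  proof (cases "j < n")
    case True
    then show ?thesis using s1[OF True] by (simp add: induced_coords_def)
  next
    case False
    then have "j - n < k" "\<not> j < n" using that by auto
    then show ?thesis using s2[of "j - n"] that by (simp add: induced_coords_def Let_def)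
  qed
  have TW: "tuple (n + k) ?g q \<in> induced_dom U x" if "q \<in> W" for q
    unfolding t by (rule ind_dom[OF x e w[OF that]])
  have "D (\<lambda>q. L (w q)) = D (\<lambda>q. ?F (tuple (n + k) ?g q))"
  proof (rule tangent_cong[OF M D W, symmetric])
    show "smooth_fun_on M W (\<lambda>q. ?F (tuple (n + k) ?g q))"
      by (rule smooth_fun_on_compose[OF M W(1) g induced_dom_open[OF x e] TW F])
    show "?F (tuple (n + k) ?g q) = L (w q)" if "q \<in> W" for q
      unfolding t par_ind[OF x e w[OF that]] ..
  qed
  also have "\<dots> = (\<Sum>j<n + k. partial_deriv j ?F (tuple (n + k) ?g m) * D (?g j))"
    by (rule tangent_chain[OF M D W g induced_dom_open[OF x e] TW F])
  also have "\<dots> = (\<Sum>j<n + k. coord_deriv (over E U) ?ind j L (w m) * D (?g j))"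
    unfolding t by (rule sum.cong[OF refl]) (simp add: dL_partial[OF x e w[OF W(2)]])
  also have "\<dots> = (\<Sum>i<n. coord_deriv (over E U) ?ind i L (w m) * D (?g i)) +
      (\<Sum>\<alpha><k. coord_deriv (over E U) ?ind (n + \<alpha>) L (w m) * D (?g (n + \<alpha>)))"
    by (rule sum_lessThan_add)
  finally show ?thesis by (simp add: induced_coords_def)
qed

end

section \<open>Values of the differential and derivatives along admissible curves\<close>

context lie_alg
begin

lemma ext_diff_0:
  assumes v: "v \<in> fibre E m"
  shows "ext_diff E \<theta> m [v] = anchor_deriv E v (\<lambda>q. \<theta> q [])"
proof -
  have "\<exists>\<sigma>. \<sigma> \<in> gsections E \<and> \<sigma> m = v" by (rule gsection_through[OF v]) blast
  then have "(SOME \<sigma>. \<sigma> \<in> gsections E \<and> \<sigma> m = v) \<in> gsections E \<and> (SOME \<sigma>. \<sigma> \<in> gsections E \<and> \<sigma> m = v) m = v"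
    by (rule someI_ex)
  then show ?thesis by (simp add: ext_diff_def koszul_0)
qed

text \<open>Of the sections selected by \<open>SOME\<close> only the values at m are known. They are
  returned as witnesses, to be eliminated by \<open>koszul_1_coord\<close>.\<close>

lemma ext_diff_1:
  assumes u: "u \<in> fibre E m" and v: "v \<in> fibre E m"
  obtains \<sigma> \<eta> where "\<sigma> \<in> gsections E" "\<sigma> m = u" "\<eta> \<in> gsections E" "\<eta> m = v"
    "ext_diff E \<theta> m [u, v] = koszul E \<theta> [\<sigma>, \<eta>] m"
proof -
  have *: "(SOME \<sigma>. \<sigma> \<in> gsections E \<and> \<sigma> m = w) \<in> gsections E \<and> (SOME \<sigma>. \<sigma> \<in> gsections E \<and> \<sigma> m = w) m = w"
    if w: "w \<in> fibre E m" for w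
  proof -
    have "\<exists>\<sigma>. \<sigma> \<in> gsections E \<and> \<sigma> m = w" by (rule gsection_through[OF w]) blast
    then show ?thesis by (rule someI_ex)
  qed
  show thesis
    by (rule that[OF conjunct1[OF *[OF u]] conjunct2[OF *[OF u]] conjunct1[OF *[OF v]] conjunct2[OF *[OF v]]])
      (simp add: ext_diff_def)
qed

lemma admissible_total: 
  assumes a: "admissible_curve E J a" and t: "t \<in> J" shows "a t \<in> points T"
proof -
  have "continuous_map (top_of_set J) (mtop T) a" using a by (simp add: admissible_curve_def C1_curve_def)
  then show ?thesis using t by (auto simp: continuous_map_def Pi_iff)
qed

text \<open>\<open>velocity\<close> is written with \<open>vector_derivative\<close>, which is
  meaningful only where a derivative exists. Existence comes from the C1 property of a, applied to
  the smooth function f o \<open>vproj E\<close> on the total space.\<close>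

lemma admissible_DERIV:
  assumes a: "admissible_curve E {t0..t1} a" and lt: "t0 < t1" and t: "t \<in> {t0..t1}"
    and W: "openin (mtop B) W" "vproj E (a t) \<in> W" and f: "smooth_fun_on B W f"
  shows "((\<lambda>s. f (vproj E (a s))) has_real_derivative anchor_deriv E (a t) f) (at t within {t0..t1})"
proof -
  have C: "C1_curve T {t0..t1} a" using a by (simp add: admissible_curve_def)
  obtain h where h: "\<forall>t\<in>{t\<in>{t0..t1}. a t \<in> over E W}.
      ((\<lambda>s. f (vproj E (a s))) has_real_derivative h t) (at t within {t0..t1})"
    using C1_curve_component[OF total_manifold C lt over_open[OF W(1)] smooth_fun_on_base_pullback[OF W(1) f]]
    by (elim exE conjE) (rule that)
  have "a t \<in> over E W" using admissible_total[OF a t] W(2) by (simp add: over_def)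
  then have d: "((\<lambda>s. f (vproj E (a s))) has_real_derivative h t) (at t within {t0..t1})" using h t by simp
  have "smooth_near B (vproj E (a t)) f" by (rule smooth_nearI[OF W f])
  moreover have "anchor E (a t) = velocity B {t0..t1} (\<lambda>s. vproj E (a s)) t"
    using a t unfolding admissible_curve_def by blast
  ultimately have "anchor_deriv E (a t) f = vector_derivative (\<lambda>s. f (vproj E (a s))) (at t within {t0..t1})"
    by (simp add: anchor_deriv_def velocity_def)
  also have "\<dots> = h t"
    using d lt t by (intro vector_derivative_within_closed_interval) (auto simp: has_real_derivative_iff_has_vector_derivative)
  finally show ?thesis using d by simp
qed

end

section \<open>Morphisms\<close>

locale lie_alg_morphism = S: lie_alg E + R: lie_alg E'
  for E :: "('m, 'e) algebroid" and E' :: "('n, 'f) algebroid" +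
  fixes \<phi> :: "'m \<Rightarrow> 'n" and \<Phi> :: "'e \<Rightarrow> 'f"
  assumes mor: "algebroid_morphism E E' \<phi> \<Phi>"
begin

lemma bundle_map: "vbundle_map E E' \<phi> \<Phi>"
  using mor by (simp add: algebroid_morphism_def)

lemma base_map_smooth: "smooth_map_on S.B (points S.B) R.B \<phi>"
  and total_map_smooth: "smooth_map_on S.T (points S.T) R.T \<Phi>"
  using bundle_map by (auto simp: vbundle_map_def)

lemma vproj_map: "v \<in> points S.T \<Longrightarrow> vproj E' (\<Phi> v) = \<phi> (vproj E v)"
  using bundle_map unfolding vbundle_map_def by blast

lemma total_map_points: "v \<in> points S.T \<Longrightarrow> \<Phi> v \<in> points R.T"
  by (rule smooth_map_on_point[OF total_map_smooth _ subset_refl])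

lemma base_map_points: "m \<in> points S.B \<Longrightarrow> \<phi> m \<in> points R.B"
  by (rule smooth_map_on_point[OF base_map_smooth _ subset_refl])

lemma map_fibre: assumes v: "v \<in> fibre E m" shows "\<Phi> v \<in> fibre E' (\<phi> m)"
  using total_map_points[OF S.fibre_total[OF v]] vproj_map[OF S.fibre_total[OF v]] S.fibre_vproj[OF v]
  by (simp add: fibre_def)

lemma map_add: "u \<in> fibre E m \<Longrightarrow> v \<in> fibre E m \<Longrightarrow> \<Phi> (vadd E u v) = vadd E' (\<Phi> u) (\<Phi> v)"
  using bundle_map S.fibre_base[of u m] unfolding vbundle_map_def by blast

lemma map_scale: "u \<in> fibre E m \<Longrightarrow> \<Phi> (vscale E c u) = vscale E' c (\<Phi> u)"
  using bundle_map S.fibre_base[of u m] unfolding vbundle_map_def by blast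

text \<open>\<open>vbundle_map\<close> states additivity and homogeneity; the zero vector is treated
  as 0 times itself.\<close>

lemma map_zero: assumes m: "m \<in> points S.B" shows "\<Phi> (vzero E m) = vzero E' (\<phi> m)"
proof -
  have z: "vzero E m \<in> fibre E m" by (rule S.vzero_fibre[OF m])
  have "\<Phi> (vzero E m) = \<Phi> (vscale E 0 (vzero E m))" unfolding S.vscale_vzero[OF m] ..
  also have "\<dots> = vscale E' 0 (\<Phi> (vzero E m))" by (rule map_scale[OF z])
  also have "\<dots> = vzero E' (\<phi> m)" by (rule R.vscale_0[OF base_map_points[OF m] map_fibre[OF z]])
  finally show ?thesis .
qed

lemma map_lincomb:
  assumes m: "m \<in> points S.B"
  shows "(\<And>\<alpha>. \<alpha> < r \<Longrightarrow> f \<alpha> \<in> fibre E m) \<Longrightarrow> \<Phi> (lincomb E m r c f) = lincomb E' (\<phi> m) r c (\<lambda>\<alpha>. \<Phi> (f \<alpha>))"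
proof (induction r)
  case 0 show ?case by (simp add: map_zero[OF m])
next
  case (Suc r)
  have "\<Phi> (lincomb E m (Suc r) c f) = vadd E' (\<Phi> (lincomb E m r c f)) (\<Phi> (vscale E (c r) (f r)))"
    unfolding lincomb.simps
    by (rule map_add[OF S.lincomb_fibre[OF m] S.vscale_fibre[OF m]]) (use Suc.prems in auto)
  also have "\<Phi> (vscale E (c r) (f r)) = vscale E' (c r) (\<Phi> (f r))" by (rule map_scale[OF Suc.prems]) simp
  finally show ?case using Suc by simp
qed

lemma map_coord:
  assumes e: "S.frame e m" and e': "R.frame e' (\<phi> m)" and v: "v \<in> fibre E m"
  shows "basis_coord E' e' (\<Phi> v) \<gamma> = (\<Sum>\<alpha><S.k. basis_coord E e v \<alpha> * basis_coord E' e' (\<Phi> (e \<alpha> m)) \<gamma>)"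
proof -
  have m: "m \<in> points S.B" by (rule S.fibre_base[OF v])
  have "\<Phi> v = lincomb E' (\<phi> m) S.k (basis_coord E e v) (\<lambda>\<alpha>. \<Phi> (e \<alpha> m))"
    using map_lincomb[OF m, of S.k "\<lambda>\<alpha>. e \<alpha> m" "basis_coord E e v"] S.frame_fibre[OF e]
    unfolding S.frame_coord(2)[OF e v] by blast
  then show ?thesis
    using R.basis_coord_lincomb[OF base_map_points[OF m] e', of S.k "\<lambda>\<alpha>. \<Phi> (e \<alpha> m)" "basis_coord E e v" \<gamma>]
      map_fibre[OF S.frame_fibre[OF e]] by simp
qed

lemma base_preimage_open: "openin (mtop R.B) V \<Longrightarrow> openin (mtop S.B) {q \<in> points S.B. \<phi> q \<in> V}"
  by (rule smooth_map_on_open_preimage[OF openin_topspace base_map_smooth])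

lemma base_pullback_smooth:
  "openin (mtop R.B) V \<Longrightarrow> smooth_fun_on R.B V f \<Longrightarrow> smooth_fun_on S.B {q \<in> points S.B. \<phi> q \<in> V} (\<lambda>q. f (\<phi> q))"
  by (rule smooth_fun_on_pullback[OF S.base_manifold R.base_manifold openin_topspace base_map_smooth])

lemma total_pullback_smooth:
  "openin (mtop R.T) V \<Longrightarrow> smooth_fun_on R.T V f \<Longrightarrow> smooth_fun_on S.T {q \<in> points S.T. \<Phi> q \<in> V} (\<lambda>q. f (\<Phi> q))"
  by (rule smooth_fun_on_pullback[OF S.total_manifold R.total_manifold openin_topspace total_map_smooth])

lemma matrix_smooth:
  assumes e: "local_basis E U e" and e': "local_basis E' U' e'" and \<alpha>: "\<alpha> < S.k"
  shows "smooth_fun_on S.B {q \<in> U. \<phi> q \<in> U'} (\<lambda>q. basis_coord E' e' (\<Phi> (e \<alpha> q)) \<gamma>)"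
proof -
  have O': "openin (mtop R.T) (over E' U')" by (rule R.over_open[OF R.local_basis_open[OF e']])
  have "smooth_fun_on S.B {q \<in> U. e \<alpha> q \<in> {v \<in> points S.T. \<Phi> v \<in> over E' U'}} (\<lambda>q. basis_coord E' e' (\<Phi> (e \<alpha> q)) \<gamma>)"
    by (rule smooth_fun_on_pullback[OF S.base_manifold S.total_manifold S.local_basis_open[OF e]
          S.section_smooth[OF S.local_basis_section[OF e \<alpha>]]
          smooth_map_on_open_preimage[OF openin_topspace total_map_smooth O']
          total_pullback_smooth[OF O' R.component_smooth[OF e']]])
  then show ?thesis
  proof (rule smooth_fun_on_subset, intro subsetI)
    fix q assume "q \<in> {q \<in> U. \<phi> q \<in> U'}"
    then have q: "q \<in> U" "\<phi> q \<in> U'" by auto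
    have ef: "e \<alpha> q \<in> fibre E q" by (rule S.local_basis_fibre[OF e q(1) \<alpha>])
    show "q \<in> {q \<in> U. e \<alpha> q \<in> {v \<in> points S.T. \<Phi> v \<in> over E' U'}}"
      using q R.fibre_over[OF map_fibre[OF ef]] S.fibre_total[OF ef] by simp
  qed
qed

text \<open>Commutation with the differential in degree 0. Forms are global, so f is first replaced
  by a global function g equal to it near \<open>\<phi> m\<close>; tangent vectors do not see the
  difference.\<close>

lemma anchor_morphism:
  assumes v: "v \<in> fibre E m" and W: "openin (mtop R.B) W" "\<phi> m \<in> W" and f: "smooth_fun_on R.B W f"
  shows "anchor_deriv E' (\<Phi> v) f = anchor_deriv E v (\<lambda>q. f (\<phi> q))"
proof -
  have m: "m \<in> points S.B" by (rule S.fibre_base[OF v])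
  obtain g W' where g: "smooth_fun_on R.B (points R.B) g" "openin (mtop R.B) W'" "\<phi> m \<in> W'" "W' \<subseteq> W"
    "\<And>q. q \<in> W' \<Longrightarrow> g q = f q"
    by (rule smooth_fun_extend[OF R.base_manifold W f]) (rule that)
  \<comment> \<open>A function viewed as a 0-form: the list of arguments is ignored.\<close>
  define \<theta> where "\<theta> q vs = g q" for q and vs :: "'f list"
  have "is_form E' 0 \<theta>"
    unfolding is_form_def \<theta>_def
    using smooth_fun_on_subset[OF g(1) openin_subset[OF R.local_basis_open]] by simp
  then have "pullback_form \<phi> \<Phi> (ext_diff E' \<theta>) m [v] = ext_diff E (pullback_form \<phi> \<Phi> \<theta>) m [v]"
    using mor m v unfolding algebroid_morphism_def by (elim conjE allE impE ballE) auto
  then have "anchor_deriv E' (\<Phi> v) g = anchor_deriv E v (\<lambda>q. g (\<phi> q))"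
    by (simp add: pullback_form_def R.ext_diff_0[OF map_fibre[OF v]] S.ext_diff_0[OF v] \<theta>_def)
  moreover have "anchor_deriv E' (\<Phi> v) g = anchor_deriv E' (\<Phi> v) f"
    by (rule R.anchor_cong[OF map_fibre[OF v] g(2,3) smooth_fun_on_subset[OF g(1) openin_subset[OF g(2)]] g(5)])
  moreover have "anchor_deriv E v (\<lambda>q. g (\<phi> q)) = anchor_deriv E v (\<lambda>q. f (\<phi> q))"
  proof (rule S.anchor_cong[OF v base_preimage_open[OF g(2)]])
    show "smooth_fun_on S.B {q \<in> points S.B. \<phi> q \<in> W'} (\<lambda>q. g (\<phi> q))"
      by (rule base_pullback_smooth[OF g(2) smooth_fun_on_subset[OF g(1) openin_subset[OF g(2)]]])
  qed (use m g(3,5) in auto)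
  ultimately show ?thesis by simp
qed

text \<open>The value of \<open>d(\<Phi>\<^sup>* \<theta>) = \<Phi>\<^sup>* (d\<theta>)\<close> on the pair \<open>(u, v)\<close>, where \<open>\<theta>\<close> is the dual basis form \<open>e'\<^sup>\<gamma>\<close> cut off by
  a bump function.\<close>

lemma bracket_morphism:
  assumes e: "local_basis E U e" and m: "m \<in> U" and e': "local_basis E' U' e'" and m': "\<phi> m \<in> U'"
    and u: "u \<in> fibre E m" and v: "v \<in> fibre E m" and \<gamma>: "\<gamma> < R.k"
  defines "A \<equiv> \<lambda>\<alpha> q. basis_coord E' e' (\<Phi> (e \<alpha> q)) \<gamma>"
  shows "- (\<Sum>\<alpha><R.k. \<Sum>\<beta><R.k. structure_fun E' e' \<gamma> \<alpha> \<beta> (\<phi> m) * basis_coord E' e' (\<Phi> u) \<alpha> * basis_coord E' e' (\<Phi> v) \<beta>) =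
    (\<Sum>\<beta><S.k. anchor_deriv E u (A \<beta>) * basis_coord E e v \<beta>) - (\<Sum>\<alpha><S.k. anchor_deriv E v (A \<alpha>) * basis_coord E e u \<alpha>)
    - (\<Sum>\<delta><S.k. A \<delta> m * (\<Sum>\<alpha><S.k. \<Sum>\<beta><S.k. structure_fun E e \<delta> \<alpha> \<beta> m * basis_coord E e u \<alpha> * basis_coord E e v \<beta>))"
proof -
  have mB: "m \<in> points S.B" by (rule S.fibre_base[OF u])
  note U'O = R.local_basis_open[OF e']
  obtain b K W' where b: "smooth_fun_on R.B (points R.B) b" "closedin (mtop R.B) K" "K \<subseteq> U'" "\<And>q. q \<notin> K \<Longrightarrow> b q = 0"
    "openin (mtop R.B) W'" "\<phi> m \<in> W'" "W' \<subseteq> K" "\<And>q. q \<in> W' \<Longrightarrow> b q = 1"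
    by (rule smooth_bump[OF R.base_manifold U'O m']) (rule that)
  \<comment> \<open>\<open>hd\<close> reads off the single argument of a 1-form. On W', where b is
    1, this is the covector with index \<gamma> of the basis dual to e'.\<close>
  define \<theta> where "\<theta> q vs = (if q \<in> U' then b q * basis_coord E' e' (hd vs) \<gamma> else 0)" for q vs
  have \<theta>1: "\<theta> q [w] = basis_coord E' e' w \<gamma>" if "q \<in> W'" for q w
    using that b(3,7) b(8)[OF that] by (auto simp: \<theta>_def)
  have form: "is_form E' 1 \<theta>"
    unfolding is_form_def
  proof (intro conjI ballI allI impI)
    fix q vs i w assume q: "q \<in> points R.B" and vs: "length vs = 1 \<and> set vs \<subseteq> fibre E' q" and i: "i < (1::nat)" and w: "w \<in> fibre E' q"
    then obtain z where z: "vs = [z]" "z \<in> fibre E' q" by (auto simp: length_Suc_conv)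
    show "\<theta> q (vs[i := vadd E' (vs ! i) w]) = \<theta> q vs + \<theta> q (vs[i := w])"
      using i z(2) w R.basis_coord_add[OF q R.local_basis_frame[OF e']]
      by (simp add: z(1) \<theta>_def distrib_left)
  next
    fix q vs i c assume q: "q \<in> points R.B" and vs: "length vs = 1 \<and> set vs \<subseteq> fibre E' q" and i: "i < (1::nat)"
    then obtain z where z: "vs = [z]" "z \<in> fibre E' q" by (auto simp: length_Suc_conv)
    show "\<theta> q (vs[i := vscale E' c (vs ! i)]) = c * \<theta> q vs"
      using i z(2) R.basis_coord_scale[OF q R.local_basis_frame[OF e']] by (simp add: z(1) \<theta>_def)
  next
    fix V f \<alpha>s assume f: "local_basis E' V f" and as: "length \<alpha>s = 1 \<and> set \<alpha>s \<subseteq> {..<R.k}"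
    then obtain \<alpha> where \<alpha>: "\<alpha>s = [\<alpha>]" "\<alpha> < R.k" by (auto simp: length_Suc_conv)
    have "smooth_fun_on R.B V (\<lambda>q. if q \<in> U' then b q * basis_coord E' e' (f \<alpha> q) \<gamma> else 0)"
      by (rule smooth_fun_on_cutoff_on[OF R.base_manifold R.local_basis_open[OF f] U'O _ b(1-4)],
        rule R.section_component_smooth[OF e' R.local_basis_open[OF f] R.section_smooth[OF R.local_basis_section[OF f \<alpha>(2)]]
            R.local_basis_fibre[OF f _ \<alpha>(2)]])
    then show "smooth_fun_on R.B V (\<lambda>q. \<theta> q (map (\<lambda>\<alpha>. f \<alpha> q) \<alpha>s))"
      by (simp add: \<alpha>(1) \<theta>_def cong: if_cong)
  qed auto
  then have "pullback_form \<phi> \<Phi> (ext_diff E' \<theta>) m [u, v] = ext_diff E (pullback_form \<phi> \<Phi> \<theta>) m [u, v]"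
    using mor mB u v unfolding algebroid_morphism_def by (elim conjE allE impE ballE) auto
  then have eq: "ext_diff E' \<theta> (\<phi> m) [\<Phi> u, \<Phi> v] = ext_diff E (pullback_form \<phi> \<Phi> \<theta>) m [u, v]"
    by (simp add: pullback_form_def)
  have "W' \<subseteq> U'" using b(3,7) by blast
  obtain \<sigma>' \<eta>' where s': "\<sigma>' \<in> gsections E'" "\<sigma>' (\<phi> m) = \<Phi> u" "\<eta>' \<in> gsections E'" "\<eta>' (\<phi> m) = \<Phi> v"
    "ext_diff E' \<theta> (\<phi> m) [\<Phi> u, \<Phi> v] = koszul E' \<theta> [\<sigma>', \<eta>'] (\<phi> m)"
    by (rule R.ext_diff_1[OF map_fibre[OF u] map_fibre[OF v]]) (rule that)
  have const: "anchor_deriv E' (\<Phi> w) (\<lambda>q. c) = 0" if "w \<in> fibre E m" for w c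
    by (rule tangent_const[OF R.base_manifold R.anchor_tangent(1)[OF map_fibre[OF that]] base_map_points[OF mB]])
  \<comment> \<open>Near \<open>\<phi> m\<close> the components of \<theta> are Kronecker deltas, so
    their anchor derivatives vanish and the bracket term alone remains.\<close>
  have "koszul E' \<theta> [\<sigma>', \<eta>'] (\<phi> m) = - (\<Sum>\<delta><R.k. (if \<delta> = \<gamma> then 1 else 0) *
      (\<Sum>\<alpha><R.k. \<Sum>\<beta><R.k. structure_fun E' e' \<delta> \<alpha> \<beta> (\<phi> m) * basis_coord E' e' (\<Phi> u) \<alpha> * basis_coord E' e' (\<Phi> v) \<beta>))"
    using R.koszul_1_coord[OF e' m' s'(1,3) b(5,6) \<open>W' \<subseteq> U'\<close> smooth_fun_on_const, of \<theta> "\<lambda>\<alpha>. if \<alpha> = \<gamma> then 1 else 0"] \<gamma>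
    by (simp add: \<theta>1 s'(2,4) const[OF u] const[OF v] if_distrib[of "\<lambda>x. x * _"] cong: if_cong)
  then have lhs: "ext_diff E' \<theta> (\<phi> m) [\<Phi> u, \<Phi> v] =
      - (\<Sum>\<alpha><R.k. \<Sum>\<beta><R.k. structure_fun E' e' \<gamma> \<alpha> \<beta> (\<phi> m) * basis_coord E' e' (\<Phi> u) \<alpha> * basis_coord E' e' (\<Phi> v) \<beta>)"
    using \<gamma> unfolding s'(5) by (simp add: if_distrib[of "\<lambda>x. x * _"] cong: if_cong)
  obtain \<sigma> \<eta> where s: "\<sigma> \<in> gsections E" "\<sigma> m = u" "\<eta> \<in> gsections E" "\<eta> m = v"
    "ext_diff E (pullback_form \<phi> \<Phi> \<theta>) m [u, v] = koszul E (pullback_form \<phi> \<Phi> \<theta>) [\<sigma>, \<eta>] m"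
    by (rule S.ext_diff_1[OF u v]) (rule that)
  define W where "W = U \<inter> {q \<in> points S.B. \<phi> q \<in> W'}"
  have W: "openin (mtop S.B) W" "m \<in> W" "W \<subseteq> U"
    unfolding W_def using S.local_basis_open[OF e] base_preimage_open[OF b(5)] m mB b(6) by auto
  \<comment> \<open>The pullback has the components \<open>A \<alpha>\<close>, which vary with the
    base point; this is where derivatives of the matrix of \<Phi> enter the structure
    equation.\<close>
  have "ext_diff E (pullback_form \<phi> \<Phi> \<theta>) m [u, v] =
    (\<Sum>\<beta><S.k. anchor_deriv E (\<sigma> m) (A \<beta>) * basis_coord E e (\<eta> m) \<beta>) - (\<Sum>\<alpha><S.k. anchor_deriv E (\<eta> m) (A \<alpha>) * basis_coord E e (\<sigma> m) \<alpha>)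
    - (\<Sum>\<delta><S.k. A \<delta> m * (\<Sum>\<alpha><S.k. \<Sum>\<beta><S.k. structure_fun E e \<delta> \<alpha> \<beta> m * basis_coord E e (\<sigma> m) \<alpha> * basis_coord E e (\<eta> m) \<beta>))"
    unfolding s(5)
  proof (rule S.koszul_1_coord[OF e m s(1,3) W])
    show "smooth_fun_on S.B W (A \<alpha>)" if "\<alpha> < S.k" for \<alpha>
      unfolding A_def by (rule smooth_fun_on_subset[OF matrix_smooth[OF e e' that]]) (use \<open>W' \<subseteq> U'\<close> in \<open>auto simp: W_def\<close>)
    fix q w assume q: "q \<in> W" and w: "w \<in> fibre E q"
    have q': "q \<in> U" "\<phi> q \<in> W'" "\<phi> q \<in> U'" using q \<open>W' \<subseteq> U'\<close> by (auto simp: W_def)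
    show "pullback_form \<phi> \<Phi> \<theta> q [w] = (\<Sum>\<alpha><S.k. A \<alpha> q * basis_coord E e w \<alpha>)"
      using map_coord[OF S.local_basis_frame[OF e q'(1)] R.local_basis_frame[OF e' q'(3)] w, of \<gamma>]
      by (simp add: pullback_form_def \<theta>1[OF q'(2)] A_def mult.commute)
  qed
  then show ?thesis using eq unfolding lhs s(2,4) by simp
qed

end

section \<open>Contraction of Lagrange's equations and smoothness of the momenta\<close>

lemma tangent_not_smooth: "D \<in> tangent_space M m \<Longrightarrow> \<not> smooth_near M m f \<Longrightarrow> D f = 0"
  unfolding tangent_space_def by auto

text \<open>Here \<open>u\<close> is a vector with \<open>\<Phi> u = e'\<^sub>\<alpha>\<^sub>'\<close>, \<open>A\<close> is the matrix of \<open>\<Phi>\<close>, and \<open>rA\<close>, \<open>uA\<close> are its derivatives along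
  \<open>\<rho>(a(t))\<close> and \<open>\<rho>(u)\<close>. The derivatives of \<open>A\<close> produced by the product rule in \<open>D\<close> and \<open>X\<close> are exactly those in
  the structure equation \<open>M\<close>.\<close>

lemma lagrange_contraction:
  fixes k k' n \<alpha>' :: nat and p p' u y y' D D' Lx :: "nat \<Rightarrow> real"
    and A rA uA \<rho> :: "nat \<Rightarrow> nat \<Rightarrow> real" and C C' :: "nat \<Rightarrow> nat \<Rightarrow> nat \<Rightarrow> real"
  assumes EL: "\<And>\<alpha>. \<alpha> < k \<Longrightarrow> D \<alpha> + (\<Sum>\<gamma><k. \<Sum>\<beta><k. p \<gamma> * C \<gamma> \<alpha> \<beta> * y \<beta>) = (\<Sum>i<n. \<rho> i \<alpha> * Lx i)"
    and D: "\<And>\<alpha>. \<alpha> < k \<Longrightarrow> D \<alpha> = (\<Sum>\<gamma><k'. rA \<alpha> \<gamma> * p' \<gamma> + A \<alpha> \<gamma> * D' \<gamma>)"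
    and p: "\<And>\<delta>. \<delta> < k \<Longrightarrow> p \<delta> = (\<Sum>\<gamma><k'. A \<delta> \<gamma> * p' \<gamma>)"
    and u: "\<And>\<gamma>. \<gamma> < k' \<Longrightarrow> (\<Sum>\<alpha><k. u \<alpha> * A \<alpha> \<gamma>) = (if \<gamma> = \<alpha>' then 1 else 0)" and \<alpha>': "\<alpha>' < k'"
    and X: "(\<Sum>i<n. Lx i * (\<Sum>\<alpha><k. u \<alpha> * \<rho> i \<alpha>)) = R + (\<Sum>\<gamma><k'. p' \<gamma> * (\<Sum>\<beta><k. y \<beta> * uA \<beta> \<gamma>))"
    and M: "\<And>\<gamma>. \<gamma> < k' \<Longrightarrow> - (\<Sum>\<beta><k'. C' \<gamma> \<alpha>' \<beta> * y' \<beta>) = (\<Sum>\<beta><k. uA \<beta> \<gamma> * y \<beta>) - (\<Sum>\<alpha><k. rA \<alpha> \<gamma> * u \<alpha>)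
      - (\<Sum>\<delta><k. A \<delta> \<gamma> * (\<Sum>\<alpha><k. \<Sum>\<beta><k. C \<delta> \<alpha> \<beta> * u \<alpha> * y \<beta>))"
  shows "D' \<alpha>' + (\<Sum>\<gamma><k'. \<Sum>\<beta><k'. p' \<gamma> * C' \<gamma> \<alpha>' \<beta> * y' \<beta>) = (R::real)"
proof -
  define Q where "Q \<delta> = (\<Sum>\<alpha><k. \<Sum>\<beta><k. C \<delta> \<alpha> \<beta> * u \<alpha> * y \<beta>)" for \<delta>
  \<comment> \<open>By the choice of u the terms with D' collapse to the single index \<alpha>',
    while the derivatives rA of the matrix stay.\<close>
  have T1: "(\<Sum>\<alpha><k. u \<alpha> * D \<alpha>) = (\<Sum>\<gamma><k'. p' \<gamma> * (\<Sum>\<alpha><k. rA \<alpha> \<gamma> * u \<alpha>)) + D' \<alpha>'"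
  proof -
    have "(\<Sum>\<alpha><k. u \<alpha> * D \<alpha>) = (\<Sum>\<alpha><k. \<Sum>\<gamma><k'. p' \<gamma> * (rA \<alpha> \<gamma> * u \<alpha>) + D' \<gamma> * (u \<alpha> * A \<alpha> \<gamma>))"
      by (rule sum.cong[OF refl]) (simp add: D sum_distrib_left distrib_left mult_ac)
    also have "\<dots> = (\<Sum>\<gamma><k'. \<Sum>\<alpha><k. p' \<gamma> * (rA \<alpha> \<gamma> * u \<alpha>) + D' \<gamma> * (u \<alpha> * A \<alpha> \<gamma>))" by (rule sum.swap)
    also have "\<dots> = (\<Sum>\<gamma><k'. p' \<gamma> * (\<Sum>\<alpha><k. rA \<alpha> \<gamma> * u \<alpha>)) + (\<Sum>\<gamma><k'. D' \<gamma> * (\<Sum>\<alpha><k. u \<alpha> * A \<alpha> \<gamma>))"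
      by (simp only: sum.distrib sum_distrib_left)
    also have "(\<Sum>\<gamma><k'. D' \<gamma> * (\<Sum>\<alpha><k. u \<alpha> * A \<alpha> \<gamma>)) = (\<Sum>\<gamma><k'. D' \<gamma> * (if \<gamma> = \<alpha>' then 1 else 0))"
      by (rule sum.cong[OF refl]) (simp add: u)
    also have "\<dots> = D' \<alpha>'" using \<alpha>' by (simp add: if_distrib[of "\<lambda>x. _ * x"] cong: if_cong)
    finally show ?thesis .
  qed
  \<comment> \<open>Inserting p = A p' brings the structure functions of E into the form in which
    they occur in M.\<close>
  have T2: "(\<Sum>\<alpha><k. u \<alpha> * (\<Sum>\<delta><k. \<Sum>\<beta><k. p \<delta> * C \<delta> \<alpha> \<beta> * y \<beta>)) = (\<Sum>\<gamma><k'. p' \<gamma> * (\<Sum>\<delta><k. A \<delta> \<gamma> * Q \<delta>))"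
  proof -
    have "(\<Sum>\<alpha><k. u \<alpha> * (\<Sum>\<delta><k. \<Sum>\<beta><k. p \<delta> * C \<delta> \<alpha> \<beta> * y \<beta>)) =
        (\<Sum>\<alpha><k. \<Sum>\<delta><k. \<Sum>\<beta><k. p \<delta> * (C \<delta> \<alpha> \<beta> * u \<alpha> * y \<beta>))"
      by (simp add: sum_distrib_left mult_ac)
    also have "\<dots> = (\<Sum>\<delta><k. \<Sum>\<alpha><k. \<Sum>\<beta><k. p \<delta> * (C \<delta> \<alpha> \<beta> * u \<alpha> * y \<beta>))" by (rule sum.swap)
    also have "\<dots> = (\<Sum>\<delta><k. p \<delta> * Q \<delta>)" by (simp add: Q_def sum_distrib_left)
    also have "\<dots> = (\<Sum>\<delta><k. \<Sum>\<gamma><k'. p' \<gamma> * (A \<delta> \<gamma> * Q \<delta>))"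
      by (rule sum.cong[OF refl]) (simp add: p sum_distrib_left mult_ac)
    also have "\<dots> = (\<Sum>\<gamma><k'. \<Sum>\<delta><k. p' \<gamma> * (A \<delta> \<gamma> * Q \<delta>))" by (rule sum.swap)
    finally show ?thesis by (simp add: sum_distrib_left)
  qed
  have T3: "(\<Sum>\<alpha><k. u \<alpha> * (\<Sum>i<n. \<rho> i \<alpha> * Lx i)) = (\<Sum>i<n. Lx i * (\<Sum>\<alpha><k. u \<alpha> * \<rho> i \<alpha>))"
  proof -
    have "(\<Sum>\<alpha><k. u \<alpha> * (\<Sum>i<n. \<rho> i \<alpha> * Lx i)) = (\<Sum>\<alpha><k. \<Sum>i<n. Lx i * (u \<alpha> * \<rho> i \<alpha>))"
      by (simp add: sum_distrib_left mult_ac)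
    also have "\<dots> = (\<Sum>i<n. \<Sum>\<alpha><k. Lx i * (u \<alpha> * \<rho> i \<alpha>))" by (rule sum.swap)
    finally show ?thesis by (simp add: sum_distrib_left)
  qed
  have "(\<Sum>\<alpha><k. u \<alpha> * (D \<alpha> + (\<Sum>\<gamma><k. \<Sum>\<beta><k. p \<gamma> * C \<gamma> \<alpha> \<beta> * y \<beta>))) = (\<Sum>\<alpha><k. u \<alpha> * (\<Sum>i<n. \<rho> i \<alpha> * Lx i))"
    by (rule sum.cong[OF refl]) (simp add: EL)
  then have S: "(\<Sum>\<gamma><k'. p' \<gamma> * (\<Sum>\<alpha><k. rA \<alpha> \<gamma> * u \<alpha>)) + D' \<alpha>' + (\<Sum>\<gamma><k'. p' \<gamma> * (\<Sum>\<delta><k. A \<delta> \<gamma> * Q \<delta>))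
      = R + (\<Sum>\<gamma><k'. p' \<gamma> * (\<Sum>\<beta><k. y \<beta> * uA \<beta> \<gamma>))"
    unfolding distrib_left sum.distrib T1 T2 T3 X .
  have "(\<Sum>\<gamma><k'. \<Sum>\<beta><k'. p' \<gamma> * C' \<gamma> \<alpha>' \<beta> * y' \<beta>) = (\<Sum>\<gamma><k'. p' \<gamma> * (\<Sum>\<beta><k'. C' \<gamma> \<alpha>' \<beta> * y' \<beta>))"
    by (simp add: sum_distrib_left mult_ac)
  \<comment> \<open>The structure equation M trades C' for C and the derivatives of A; these are the
    terms already present in S.\<close>
  also have "\<dots> = (\<Sum>\<gamma><k'. p' \<gamma> * ((\<Sum>\<alpha><k. rA \<alpha> \<gamma> * u \<alpha>) + (\<Sum>\<delta><k. A \<delta> \<gamma> * Q \<delta>) - (\<Sum>\<beta><k. y \<beta> * uA \<beta> \<gamma>)))"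
  proof (rule sum.cong[OF refl])
    fix \<gamma> assume "\<gamma> \<in> {..<k'}"
    then have "\<gamma> < k'" by simp
    have "(\<Sum>\<beta><k. y \<beta> * uA \<beta> \<gamma>) = (\<Sum>\<beta><k. uA \<beta> \<gamma> * y \<beta>)" by (simp add: mult.commute)
    then have "(\<Sum>\<beta><k'. C' \<gamma> \<alpha>' \<beta> * y' \<beta>) = (\<Sum>\<alpha><k. rA \<alpha> \<gamma> * u \<alpha>) + (\<Sum>\<delta><k. A \<delta> \<gamma> * Q \<delta>) - (\<Sum>\<beta><k. y \<beta> * uA \<beta> \<gamma>)"
      using M[OF \<open>\<gamma> < k'\<close>] unfolding Q_def by linarith
    then show "p' \<gamma> * (\<Sum>\<beta><k'. C' \<gamma> \<alpha>' \<beta> * y' \<beta>) = p' \<gamma> * ((\<Sum>\<alpha><k. rA \<alpha> \<gamma> * u \<alpha>) + (\<Sum>\<delta><k. A \<delta> \<gamma> * Q \<delta>) - (\<Sum>\<beta><k. y \<beta> * uA \<beta> \<gamma>))"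
      by simp
  qed
  also have "\<dots> = (\<Sum>\<gamma><k'. p' \<gamma> * (\<Sum>\<alpha><k. rA \<alpha> \<gamma> * u \<alpha>)) + (\<Sum>\<gamma><k'. p' \<gamma> * (\<Sum>\<delta><k. A \<delta> \<gamma> * Q \<delta>))
      - (\<Sum>\<gamma><k'. p' \<gamma> * (\<Sum>\<beta><k. y \<beta> * uA \<beta> \<gamma>))"
    by (simp only: right_diff_distrib distrib_left sum.distrib sum_subtractf)
  finally show ?thesis using S by linarith
qed

text \<open>A partial derivative of the smooth coordinate expression of L, composed with the induced
  coordinates. The latter are smooth for any local basis by \<open>component_smooth\<close>.
  Regarded as smooth functions on the total space, the momenta can be differentiated along C1
  curves.\<close>

lemma (in lie_alg) dL_dy_smooth:
  assumes x: "local_coords B U x" and e: "local_basis E U e" and L: "smooth_fun_on T (points T) L" and \<alpha>: "\<alpha> < k"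
  shows "smooth_fun_on T (over E U) (dL_dy E U x e L \<alpha>)"
proof -
  let ?ind = "induced_coords E x e"
  let ?F = "\<lambda>z. L (induced_par U x e z)"
  have O1: "openin (mtop T) (over E U)" by (rule over_open[OF local_basis_open[OF e]])
  have t: "tuple (n + k) (\<lambda>j v. ?ind v j) v = ?ind v" for v by (rule tuple_eq) (auto simp: induced_coords_def)
  have "smooth_fun_on T (over E U) (\<lambda>v. partial_deriv (n + \<alpha>) ?F (tuple (n + k) (\<lambda>j v. ?ind v j) v))"
  proof (rule smooth_fun_on_compose[OF total_manifold O1 _ induced_dom_open[OF x e]])
    show "smooth_fun_on T (over E U) (\<lambda>v. ?ind v j)" if "j < n + k" for j
    proof (cases "j < n")
      case True
      then show ?thesis
        using smooth_fun_on_base_pullback[OF local_basis_open[OF e] smooth_fun_on_coord[OF base_manifold x]]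
        by (simp add: induced_coords_def)
    next
      case False
      then show ?thesis using that component_smooth[OF e, of "j - n"] by (simp add: induced_coords_def Let_def)
    qed
    show "tuple (n + k) (\<lambda>j v. ?ind v j) v \<in> induced_dom U x" if "v \<in> over E U" for v
      unfolding t by (rule ind_dom[OF x e that])
    show "Cinf_on (n + k) (induced_dom U x) (partial_deriv (n + \<alpha>) ?F)"
      by (rule Cinf_on_partial[OF Cinf_on_par[OF x e L]]) (use \<alpha> in simp)
  qed
  then show ?thesis
    by (rule smooth_fun_on_cong[OF total_manifold O1]) (simp add: t dL_dy_def dL_partial[OF x e _ add_strict_left_mono[OF \<alpha>]])
qed

section \<open>Curves and Lagrangians under a morphism\<close>

context lie_alg_morphism
begin

text \<open>Chart coordinates of E' composed with \<Phi> are smooth functions on E, so they have C1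
  derivatives along a by \<open>C1_curve_component\<close>, up to the order required. Tangent
  vectors being operators, the anchor condition is checked on each function f: if f is smooth near
  the base point it follows from \<open>anchor_morphism\<close>, and otherwise both sides are
  0.\<close>

lemma admissible_morphism:
  assumes a: "admissible_curve E {t0..t1} a" and lt: "t0 < t1"
  shows "admissible_curve E' {t0..t1} (\<Phi> \<circ> a)"
  unfolding admissible_curve_def
proof (intro conjI ballI)
  let ?J = "{t0..t1}"
  have C: "C1_curve S.T ?J a" using a by (simp add: admissible_curve_def)
  have aT: "a t \<in> points S.T" if "t \<in> ?J" for t by (rule S.admissible_total[OF a that])
  show "C1_curve R.T ?J (\<Phi> \<circ> a)"
    unfolding C1_curve_def
  proof (intro conjI)
    have "continuous_map (mtop S.T) (mtop R.T) \<Phi>"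
      using total_map_smooth by (simp add: smooth_map_on_def)
    then show "continuous_map (top_of_set ?J) (mtop R.T) (\<Phi> \<circ> a)"
      using C continuous_map_compose unfolding C1_curve_def by blast
    show "\<forall>(U, x)\<in>matlas R.T. \<forall>i<mdim R.T. \<exists>g. (\<forall>t\<in>{t \<in> ?J. (\<Phi> \<circ> a) t \<in> U}.
        ((\<lambda>s. x ((\<Phi> \<circ> a) s) i) has_real_derivative g t) (at t within ?J)) \<and> continuous_on {t \<in> ?J. (\<Phi> \<circ> a) t \<in> U} g"
    proof clarify
      fix U x i assume U: "(U, x) \<in> matlas R.T" and i: "i < mdim R.T"
      have x: "local_coords R.T U x" by (rule atlas_local_coords[OF R.total_manifold U])
      let ?W = "{v \<in> points S.T. \<Phi> v \<in> U}"
      have W: "openin (mtop S.T) ?W"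
        by (rule smooth_map_on_open_preimage[OF openin_topspace total_map_smooth local_coords_open[OF x]])
      have "{t \<in> ?J. (\<Phi> \<circ> a) t \<in> U} = {t \<in> ?J. a t \<in> ?W}" using aT by auto
      then show "\<exists>g. (\<forall>t\<in>{t \<in> ?J. (\<Phi> \<circ> a) t \<in> U}.
        ((\<lambda>s. x ((\<Phi> \<circ> a) s) i) has_real_derivative g t) (at t within ?J)) \<and> continuous_on {t \<in> ?J. (\<Phi> \<circ> a) t \<in> U} g"
        using C1_curve_component[OF S.total_manifold C lt W total_pullback_smooth[OF local_coords_open[OF x] smooth_fun_on_coord[OF R.total_manifold x, of i]]]
        unfolding o_def by (simp only:)
    qed
  qed
  fix t assume t: "t \<in> ?J"
  let ?m = "vproj E (a t)"
  have v: "a t \<in> fibre E ?m" by (rule S.fibre_self[OF aT[OF t]])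
  note v' = map_fibre[OF v]
  have pr: "vproj E' ((\<Phi> \<circ> a) s) = \<phi> (vproj E (a s))" if "s \<in> ?J" for s using vproj_map[OF aT[OF that]] by simp
  show "anchor E' ((\<Phi> \<circ> a) t) = velocity R.B ?J (\<lambda>s. vproj E' ((\<Phi> \<circ> a) s)) t"
  proof (rule prod_eqI)
    show "fst (anchor E' ((\<Phi> \<circ> a) t)) = fst (velocity R.B ?J (\<lambda>s. vproj E' ((\<Phi> \<circ> a) s)) t)"
      using R.anchor_tangent(2)[OF v'] pr[OF t] by (simp add: velocity_def)
    show "snd (anchor E' ((\<Phi> \<circ> a) t)) = snd (velocity R.B ?J (\<lambda>s. vproj E' ((\<Phi> \<circ> a) s)) t)"
    proof
      fix f
      have "anchor_deriv E' (\<Phi> (a t)) f =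
        (if smooth_near R.B (\<phi> ?m) f then vector_derivative (\<lambda>s. f (vproj E' ((\<Phi> \<circ> a) s))) (at t within ?J) else 0)"
      proof (cases "smooth_near R.B (\<phi> ?m) f")
        case True
        then obtain W where W: "openin (mtop R.B) W" "\<phi> ?m \<in> W" "smooth_fun_on R.B W f"
          unfolding smooth_near_def by (elim exE conjE) (rule that)
        have mW: "?m \<in> {q \<in> points S.B. \<phi> q \<in> W}" using W(2) S.fibre_base[OF v] by simp
        have "((\<lambda>s. f (\<phi> (vproj E (a s)))) has_real_derivative anchor_deriv E (a t) (\<lambda>q. f (\<phi> q))) (at t within ?J)"
          by (rule S.admissible_DERIV[OF a lt t base_preimage_open[OF W(1)] mW base_pullback_smooth[OF W(1,3)]])
        \<comment> \<open>The base curve of \<Phi> o a is known only for parameters in the interval;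
          the radius 1 is arbitrary.\<close>
        then have "((\<lambda>s. f (vproj E' ((\<Phi> \<circ> a) s))) has_real_derivative anchor_deriv E (a t) (\<lambda>q. f (\<phi> q))) (at t within ?J)"
          by (rule has_field_derivative_transform_within[where d = 1]) (use t pr in \<open>simp_all del: o_apply\<close>)
        then have "vector_derivative (\<lambda>s. f (vproj E' ((\<Phi> \<circ> a) s))) (at t within ?J) = anchor_deriv E (a t) (\<lambda>q. f (\<phi> q))"
          using lt t by (intro vector_derivative_within_closed_interval) (auto simp: has_real_derivative_iff_has_vector_derivative)
        then show ?thesis using True anchor_morphism[OF v W] by simp
      next
        case False
        then show ?thesis using tangent_not_smooth[OF R.anchor_tangent(1)[OF v']] by simp
      qed
      then show "snd (anchor E' ((\<Phi> \<circ> a) t)) f = snd (velocity R.B ?J (\<lambda>s. vproj E' ((\<Phi> \<circ> a) s)) t) f"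
        using pr[OF t] by (simp add: velocity_def anchor_deriv_def)
    qed
  qed
qed

context
  fixes U x e U' x' e' L L'
  assumes x: "local_coords S.B U x" and e: "local_basis E U e"
    and x': "local_coords R.B U' x'" and e': "local_basis E' U' e'"
    and L: "smooth_fun_on S.T (points S.T) L" and L': "smooth_fun_on R.T (points R.T) L'"
    and LL': "\<And>v. v \<in> points S.T \<Longrightarrow> L v = L' (\<Phi> v)"
begin

abbreviation "mat_el \<equiv> \<lambda>\<alpha> \<gamma> q. basis_coord E' e' (\<Phi> (e \<alpha> q)) \<gamma>"

text \<open>Only the fibre coordinate \<alpha> is varied, so the base point stays m and \<Phi> acts
  linearly. In the coordinates of E' the image curve c has constant x' and fibre components that are
  affine in the parameter, and the chain rule along c gives the momentum relation.\<close>

lemma dL_dy_morphism: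
  assumes v: "v \<in> fibre E m" and m: "m \<in> U" "\<phi> m \<in> U'" and \<alpha>: "\<alpha> < S.k"
  shows "dL_dy E U x e L \<alpha> v = (\<Sum>\<gamma><R.k. mat_el \<alpha> \<gamma> m * dL_dy E' U' x' e' L' \<gamma> (\<Phi> v))"
proof -
  have vU: "v \<in> over E U" using S.fibre_over[OF v] m by simp
  have vU': "\<Phi> v \<in> over E' U'" using R.fibre_over[OF map_fibre[OF v]] m by simp
  let ?ind' = "induced_coords E' x' e'"
  let ?F = "\<lambda>z. L (S.induced_par U x e z)"
  let ?F' = "\<lambda>z. L' (R.induced_par U' x' e' z)"
  define z where "z = induced_coords E x e v"
  define w where "w s = S.induced_par U x e (z(S.n + \<alpha> := s))" for s
  define c where "c s = ?ind' (\<Phi> (w s))" for s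
  \<comment> \<open>The index n + \<alpha> lies outside the base part. Hence \<open>w s\<close>
    stays in the fibre over m for every real s.\<close>
  have bp: "S.base_part (z(S.n + \<alpha> := s)) = x m" for s
  proof -
    have "S.base_part (z(S.n + \<alpha> := s)) = S.base_part z" by (auto simp: tuple_def fun_eq_iff)
    then show ?thesis using S.base_part_ind[OF x e vU] S.fibre_vproj[OF v] unfolding z_def by simp
  qed
  have zE: "z \<in> ES (S.n + S.k)" unfolding z_def by (rule S.ind_ES[OF x e])
  have dom: "z(S.n + \<alpha> := s) \<in> S.induced_dom U x" for s
    unfolding S.induced_dom_def[OF x e] mem_Collect_eq bp using zE \<alpha> m(1) by simp
  have wf: "w s \<in> fibre E m" for s
    using S.par_fibre[OF x e dom[of s]] unfolding bp local_coords_inv[OF x m(1)] w_def .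
  have wy: "basis_coord E e (w s) \<beta> = (z(S.n + \<alpha> := s)) (S.n + \<beta>)" if "\<beta> < S.k" for s \<beta>
    unfolding w_def by (rule S.par_coord[OF x e dom that])
  have wU': "\<Phi> (w s) \<in> over E' U'" for s using R.fibre_over[OF map_fibre[OF wf]] m by simp
  have w0: "w (z (S.n + \<alpha>)) = v" unfolding w_def fun_upd_triv unfolding z_def by (rule S.par_ind[OF x e vU])
  have c1: "c s i = x' (\<phi> m) i" if "i < R.n" for s i
    using that R.fibre_vproj[OF map_fibre[OF wf]] by (simp add: c_def induced_coords_def)
  have c2: "c s (R.n + \<gamma>) = (\<Sum>\<beta><S.k. (z(S.n + \<alpha> := s)) (S.n + \<beta>) * mat_el \<beta> \<gamma> m)" if "\<gamma> < R.k" for s \<gamma>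
  proof -
    have "c s (R.n + \<gamma>) = basis_coord E' e' (\<Phi> (w s)) \<gamma>" using that by (simp add: c_def induced_coords_def)
    also have "\<dots> = (\<Sum>\<beta><S.k. basis_coord E e (w s) \<beta> * mat_el \<beta> \<gamma> m)"
      by (rule map_coord[OF S.local_basis_frame[OF e m(1)] R.local_basis_frame[OF e' m(2)] wf])
    finally show ?thesis by (simp add: wy del: fun_upd_apply)
  qed
  \<comment> \<open>The velocity of c: x' is at rest, and the fibre component \<gamma> moves with
    the matrix entry of \<alpha> and \<gamma>.\<close>
  define d where "d j = (if j < R.n then 0 else mat_el \<alpha> (j - R.n) m)" for j
  have der: "((\<lambda>s. c s j) has_real_derivative d j) (at (z (S.n + \<alpha>)))" if j: "j < R.n + R.k" for j
  proof (cases "j < R.n")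
    case True
    then show ?thesis by (simp add: c1 d_def)
  next
    case False
    then obtain \<gamma> where \<gamma>: "j = R.n + \<gamma>" "\<gamma> < R.k" using j by (metis add_diff_inverse_nat nat_add_left_cancel_less)
    have "((\<lambda>s. \<Sum>\<beta><S.k. (z(S.n + \<alpha> := s)) (S.n + \<beta>) * mat_el \<beta> \<gamma> m) has_real_derivative
        (\<Sum>\<beta><S.k. (if \<beta> = \<alpha> then 1 else 0) * mat_el \<beta> \<gamma> m)) (at (z (S.n + \<alpha>)))"
    proof (rule DERIV_sum)
      fix \<beta>
      show "((\<lambda>s. (z(S.n + \<alpha> := s)) (S.n + \<beta>) * mat_el \<beta> \<gamma> m) has_real_derivative (if \<beta> = \<alpha> then 1 else 0) * mat_el \<beta> \<gamma> m) (at (z (S.n + \<alpha>)))"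
        by (cases "\<beta> = \<alpha>") (auto intro!: derivative_eq_intros)
    qed
    moreover have "(\<Sum>\<beta><S.k. (if \<beta> = \<alpha> then 1 else 0) * mat_el \<beta> \<gamma> m) = d j"
      using \<alpha> by (simp add: d_def \<gamma>(1) if_distrib[of "\<lambda>x. x * _"] cong: if_cong)
    moreover have "(\<lambda>s. c s j) = (\<lambda>s. \<Sum>\<beta><S.k. (z(S.n + \<alpha> := s)) (S.n + \<beta>) * mat_el \<beta> \<gamma> m)"
      unfolding \<gamma>(1) by (rule ext) (rule c2[OF \<gamma>(2)])
    ultimately show ?thesis by (simp only:)
  qed
  have "((\<lambda>s. ?F' (c s)) has_real_derivative (\<Sum>j<R.n + R.k. partial_deriv j ?F' (c (z (S.n + \<alpha>))) * d j)) (at (z (S.n + \<alpha>)))"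
  proof (rule Ck_on_curve_DERIV[OF R.induced_dom_open[OF x' e'], of ?F' c])
    show "Ck_on (R.n + R.k) (Suc 0) (R.induced_dom U' x') ?F'"
      using R.Cinf_on_par[OF x' e' L'] unfolding Cinf_on_def by (rule spec)
    show "c (z (S.n + \<alpha>)) \<in> R.induced_dom U' x'" unfolding c_def by (rule R.ind_dom[OF x' e' wU'])
    show "\<forall>\<^sub>F s in at (z (S.n + \<alpha>)). c s \<in> ES (R.n + R.k)"
      unfolding c_def by (intro always_eventually allI R.ind_ES[OF x' e'])
  qed (rule der)
  moreover have "?F' (c s) = ?F (z(S.n + \<alpha> := s))" for s
    unfolding c_def R.par_ind[OF x' e' wU'] using LL'[OF S.fibre_total[OF wf[of s]]] by (simp add: w_def)
  moreover have "c (z (S.n + \<alpha>)) = ?ind' (\<Phi> v)" by (simp add: c_def w0)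
  ultimately have "((\<lambda>s. ?F (z(S.n + \<alpha> := s))) has_real_derivative (\<Sum>j<R.n + R.k. partial_deriv j ?F' (?ind' (\<Phi> v)) * d j)) (at (z (S.n + \<alpha>)))"
    by (simp only:)
  from partial_derivI[OF this]
  have "dL_dy E U x e L \<alpha> v = (\<Sum>j<R.n + R.k. partial_deriv j ?F' (?ind' (\<Phi> v)) * d j)"
    unfolding dL_dy_def S.dL_partial[OF x e vU add_strict_left_mono[OF \<alpha>]] z_def .
  also have "\<dots> = (\<Sum>\<gamma><R.k. partial_deriv (R.n + \<gamma>) ?F' (?ind' (\<Phi> v)) * mat_el \<alpha> \<gamma> m)"
    unfolding sum_lessThan_add by (simp add: d_def)
  also have "\<dots> = (\<Sum>\<gamma><R.k. mat_el \<alpha> \<gamma> m * dL_dy E' U' x' e' L' \<gamma> (\<Phi> v))"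
    by (rule sum.cong[OF refl]) (simp add: dL_dy_def R.dL_partial[OF x' e' vU'] mult.commute)
  finally show ?thesis .
qed

text \<open>The function L o w = L' o \<Phi> o w is differentiated along \<rho>(u) in two ways,
  where w extends v with constant components in e. On the side of E only the base coordinates vary.
  On the side of E' the components of \<Phi> o w vary through the matrix of \<Phi>, which produces
  the last sum.\<close>

lemma dL_dx_morphism:
  assumes u: "u \<in> fibre E m" and v: "v \<in> fibre E m" and m: "m \<in> U" "\<phi> m \<in> U'"
  shows "(\<Sum>i<S.n. dL_dx E U x e L i v * anchor_deriv E u (\<lambda>q. x q i)) =
    (\<Sum>i<R.n. dL_dx E' U' x' e' L' i (\<Phi> v) * anchor_deriv E' (\<Phi> u) (\<lambda>q. x' q i)) +
    (\<Sum>\<gamma><R.k. dL_dy E' U' x' e' L' \<gamma> (\<Phi> v) * (\<Sum>\<beta><S.k. basis_coord E e v \<beta> * anchor_deriv E u (mat_el \<beta> \<gamma>)))"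
proof -
  let ?D = "anchor_deriv E u"
  note M = S.base_manifold
  have mB: "m \<in> points S.B" by (rule S.fibre_base[OF u])
  have D: "?D \<in> tangent_space S.B m" by (rule S.anchor_tangent(1)[OF u])
  define W where "W = U \<inter> {q \<in> points S.B. \<phi> q \<in> U'}"
  have W: "openin (mtop S.B) W" "m \<in> W"
    unfolding W_def using S.local_basis_open[OF e] base_preimage_open[OF R.local_basis_open[OF e']] m mB by auto
  have WU: "q \<in> U" "\<phi> q \<in> U'" "q \<in> points S.B" if "q \<in> W" for q using that by (auto simp: W_def)
  define w where "w q = lincomb E q S.k (basis_coord E e v) (\<lambda>\<alpha>. e \<alpha> q)" for q
  have wf: "w q \<in> fibre E q" if "q \<in> W" for q
    unfolding w_def by (rule S.frame_lincomb_fibre[OF WU(3)[OF that] S.local_basis_frame[OF e WU(1)[OF that]]])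
  have wm: "w m = v" unfolding w_def by (rule S.frame_coord(2)[OF S.local_basis_frame[OF e m(1)] v])
  have wU: "w q \<in> over E U" if "q \<in> W" for q using S.fibre_over[OF wf[OF that]] WU[OF that] by simp
  have wU': "\<Phi> (w q) \<in> over E' U'" if "q \<in> W" for q using R.fibre_over[OF map_fibre[OF wf[OF that]]] WU[OF that] by simp
  have wy: "basis_coord E e (w q) \<alpha> = basis_coord E e v \<alpha>" if "q \<in> W" "\<alpha> < S.k" for q \<alpha>
    unfolding w_def by (rule S.basis_coord_lincomb_basis[OF WU(3)[OF that(1)] S.local_basis_frame[OF e WU(1)[OF that(1)]] that(2)])
  have wy': "basis_coord E' e' (\<Phi> (w q)) \<gamma> = (\<Sum>\<beta><S.k. basis_coord E e v \<beta> * mat_el \<beta> \<gamma> q)" if "q \<in> W" for q \<gamma>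
    using map_coord[OF S.local_basis_frame[OF e WU(1)[OF that]] R.local_basis_frame[OF e' WU(2)[OF that]] wf[OF that], of \<gamma>]
    by (simp add: wy[OF that])
  have ws: "smooth_map_on S.B U S.T w"
    unfolding w_def by (rule S.smooth_section_lincomb[OF S.local_basis_open[OF e] S.section_smooth[OF S.local_basis_section[OF e]]
        S.local_basis_fibre[OF e] smooth_fun_on_const])
  have As: "smooth_fun_on S.B W (mat_el \<beta> \<gamma>)" if "\<beta> < S.k" for \<beta> \<gamma>
    by (rule smooth_fun_on_subset[OF matrix_smooth[OF e e' that]]) (auto simp: W_def)
  have pr: "vproj E (w q) = q" if "q \<in> W" for q by (rule S.fibre_vproj[OF wf[OF that]])
  have pr': "vproj E' (\<Phi> (w q)) = \<phi> q" if "q \<in> W" for q by (rule R.fibre_vproj[OF map_fibre[OF wf[OF that]]])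
  have xs: "smooth_fun_on S.B W (\<lambda>q. x q i)" for i
    by (rule smooth_fun_on_subset[OF smooth_fun_on_coord[OF M x]]) (auto simp: W_def)
  have xs': "smooth_fun_on S.B W (\<lambda>q. x' (\<phi> q) i)" for i
    by (rule smooth_fun_on_subset[OF base_pullback_smooth[OF R.local_basis_open[OF e'] smooth_fun_on_coord[OF R.base_manifold x']]])
      (auto simp: W_def)
  have ys': "smooth_fun_on S.B W (\<lambda>q. \<Sum>\<beta><S.k. basis_coord E e v \<beta> * mat_el \<beta> \<gamma> q)" for \<gamma>
    by (intro smooth_fun_on_sum[OF M W(1)] smooth_fun_on_mult[OF M W(1)] smooth_fun_on_const As) simp
  have a1: "?D (\<lambda>q. x (vproj E (w q)) i) = ?D (\<lambda>q. x q i)" for i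
    by (rule tangent_cong[OF M D W xs, symmetric]) (simp add: pr)
  \<comment> \<open>The purpose of constant components: the fibre derivatives of L drop out.\<close>
  have a2: "?D (\<lambda>q. basis_coord E e (w q) \<alpha>) = 0" if "\<alpha> < S.k" for \<alpha>
  proof -
    have "?D (\<lambda>q. basis_coord E e v \<alpha>) = ?D (\<lambda>q. basis_coord E e (w q) \<alpha>)"
      by (rule tangent_cong[OF M D W smooth_fun_on_const]) (simp add: wy that)
    then show ?thesis by (simp add: tangent_const[OF M D mB])
  qed
  \<comment> \<open>\<open>anchor_morphism\<close> turns the derivative of x' o \<phi> along u into
    the derivative of x' along the image of u.\<close>
  have b1: "?D (\<lambda>q. x' (vproj E' (\<Phi> (w q))) i) = anchor_deriv E' (\<Phi> u) (\<lambda>q. x' q i)" for i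
  proof -
    have "?D (\<lambda>q. x' (\<phi> q) i) = ?D (\<lambda>q. x' (vproj E' (\<Phi> (w q))) i)"
      by (rule tangent_cong[OF M D W xs']) (simp add: pr')
    then show ?thesis
      using anchor_morphism[OF u R.local_basis_open[OF e'] m(2) smooth_fun_on_coord[OF R.base_manifold x', of i]] by simp
  qed
  have b2: "?D (\<lambda>q. basis_coord E' e' (\<Phi> (w q)) \<gamma>) = (\<Sum>\<beta><S.k. basis_coord E e v \<beta> * ?D (mat_el \<beta> \<gamma>))" for \<gamma>
  proof -
    have "?D (\<lambda>q. basis_coord E' e' (\<Phi> (w q)) \<gamma>) = ?D (\<lambda>q. \<Sum>\<beta><S.k. basis_coord E e v \<beta> * mat_el \<beta> \<gamma> q)"
      by (rule tangent_cong[OF M D W ys', symmetric]) (simp add: wy')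
    also have "\<dots> = (\<Sum>\<beta><S.k. ?D (\<lambda>q. basis_coord E e v \<beta> * mat_el \<beta> \<gamma> q))"
      by (rule tangent_sum[OF M D W]) (intro smooth_fun_on_mult[OF M W(1)] smooth_fun_on_const As)
    also have "\<dots> = (\<Sum>\<beta><S.k. basis_coord E e v \<beta> * ?D (mat_el \<beta> \<gamma>))"
      by (rule sum.cong[OF refl])
        (simp add: tangent_mult[OF M D W smooth_fun_on_const As] tangent_const[OF M D mB])
    finally show ?thesis .
  qed
  have "?D (\<lambda>q. L (w q)) = (\<Sum>i<S.n. dL_dx E U x e L i v * ?D (\<lambda>q. x q i))"
  proof -
    have "?D (\<lambda>q. L (w q)) =
      (\<Sum>i<S.n. dL_dx E U x e L i (w m) * ?D (\<lambda>q. x (vproj E (w q)) i)) +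
      (\<Sum>\<alpha><S.k. dL_dy E U x e L \<alpha> (w m) * ?D (\<lambda>q. basis_coord E e (w q) \<alpha>))"
      unfolding dL_dx_def dL_dy_def
    proof (rule S.tangent_total[OF x e L M D W wU])
      show "smooth_fun_on S.B W (\<lambda>q. x (vproj E (w q)) i)" for i
        by (rule smooth_fun_on_cong[OF M W(1) xs]) (simp add: pr)
      show "smooth_fun_on S.B W (\<lambda>q. basis_coord E e (w q) \<alpha>)" if "\<alpha> < S.k" for \<alpha>
        by (rule smooth_fun_on_cong[OF M W(1) smooth_fun_on_const[of _ _ "basis_coord E e v \<alpha>"]]) (simp add: wy that)
    qed
    then show ?thesis by (simp add: a1 a2 wm)
  qed
  moreover have "?D (\<lambda>q. L' (\<Phi> (w q))) = (\<Sum>i<R.n. dL_dx E' U' x' e' L' i (\<Phi> v) * anchor_deriv E' (\<Phi> u) (\<lambda>q. x' q i)) +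
    (\<Sum>\<gamma><R.k. dL_dy E' U' x' e' L' \<gamma> (\<Phi> v) * (\<Sum>\<beta><S.k. basis_coord E e v \<beta> * ?D (mat_el \<beta> \<gamma>)))"
  proof -
    have "?D (\<lambda>q. L' (\<Phi> (w q))) =
      (\<Sum>i<R.n. dL_dx E' U' x' e' L' i (\<Phi> (w m)) * ?D (\<lambda>q. x' (vproj E' (\<Phi> (w q))) i)) +
      (\<Sum>\<alpha><R.k. dL_dy E' U' x' e' L' \<alpha> (\<Phi> (w m)) * ?D (\<lambda>q. basis_coord E' e' (\<Phi> (w q)) \<alpha>))"
      unfolding dL_dx_def dL_dy_def
    proof (rule R.tangent_total[OF x' e' L' M D W wU'])
      show "smooth_fun_on S.B W (\<lambda>q. x' (vproj E' (\<Phi> (w q))) i)" for i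
        by (rule smooth_fun_on_cong[OF M W(1) xs']) (simp add: pr')
      show "smooth_fun_on S.B W (\<lambda>q. basis_coord E' e' (\<Phi> (w q)) \<alpha>)" for \<alpha>
        by (rule smooth_fun_on_cong[OF M W(1) ys']) (simp add: wy')
    qed
    then show ?thesis by (simp add: b1 b2 wm)
  qed
  moreover have "?D (\<lambda>q. L (w q)) = ?D (\<lambda>q. L' (\<Phi> (w q)))"
  proof (rule tangent_cong[OF M D W])
    show "smooth_fun_on S.B W (\<lambda>q. L (w q))"
      by (rule smooth_fun_on_subset[OF smooth_fun_on_pullback[OF M S.total_manifold S.local_basis_open[OF e] ws openin_topspace L]])
        (use wf S.fibre_total WU in auto)
    show "L (w q) = L' (\<Phi> (w q))" if "q \<in> W" for q by (rule LL'[OF S.fibre_total[OF wf[OF that]]])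
  qed
  ultimately show ?thesis by simp
qed

end

text \<open>Chart and basis on E' are arbitrary, as the notion of a solution requires. On E the
  equations hold in all coordinates, so one trivialization around the base point of a(t) can be
  chosen.\<close>

lemma lagrange_morphism:
  assumes surj: "fibrewise_surjective E E' \<phi> \<Phi>"
    and L: "smooth_fun_on S.T (points S.T) L" and L': "smooth_fun_on R.T (points R.T) L'"
    and LL': "\<And>v. v \<in> points S.T \<Longrightarrow> L v = L' (\<Phi> v)"
    and lt: "t0 < t1" and sol: "lagrange_solution E L {t0..t1} a"
  shows "lagrange_solution E' L' {t0..t1} (\<Phi> \<circ> a)"
proof -
  let ?J = "{t0..t1}"
  have adm: "admissible_curve E ?J a" using sol by (simp add: lagrange_solution_def)
  have adm': "admissible_curve E' ?J (\<Phi> \<circ> a)" by (rule admissible_morphism[OF adm lt])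
  have aT: "a s \<in> points S.T" if "s \<in> ?J" for s by (rule S.admissible_total[OF adm that])
  have ac: "continuous_map (top_of_set ?J) (mtop S.T) a"
    using adm by (simp add: admissible_curve_def C1_curve_def)
  have af: "a s \<in> fibre E (vproj E (a s))" if "s \<in> ?J" for s by (rule S.fibre_self[OF aT[OF that]])
  have pr: "vproj E' ((\<Phi> \<circ> a) s) = \<phi> (vproj E (a s))" if "s \<in> ?J" for s using vproj_map[OF aT[OF that]] by simp
  show ?thesis
    unfolding lagrange_solution_def Let_def
  proof (intro conjI allI impI ballI adm')
    fix U' x' e' t
    assume c': "local_coords R.B U' x' \<and> local_basis E' U' e'" and t': "t \<in> {t \<in> ?J. vproj E' ((\<Phi> \<circ> a) t) \<in> U'}"
    then have x': "local_coords R.B U' x'" and e': "local_basis E' U' e'" and t: "t \<in> ?J" by auto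
    define v where "v = a t"
    define m where "m = vproj E v"
    have v: "v \<in> fibre E m" using af[OF t] by (simp add: v_def m_def)
    have m': "\<phi> m \<in> U'" "vproj E' ((\<Phi> \<circ> a) t) = \<phi> m" using t' pr[OF t] by (auto simp: v_def m_def)
    note fr' = R.local_basis_frame[OF e' m'(1)]
    {
      \<comment> \<open>The kinematic half: the derivative of x' o \<phi> along the anchor of a(t)
        is that of x' along the anchor of its image under \<Phi>, which is then expanded in the
        frame e'.\<close>
      fix i assume "i < R.n"
      let ?W = "{q \<in> points S.B. \<phi> q \<in> U'}"
      have "((\<lambda>s. x' (\<phi> (vproj E (a s))) i) has_real_derivative anchor_deriv E (a t) (\<lambda>q. x' (\<phi> q) i)) (at t within ?J)"
        by (rule S.admissible_DERIV[OF adm lt t base_preimage_open[OF R.local_basis_open[OF e']] _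
              base_pullback_smooth[OF R.local_basis_open[OF e'] smooth_fun_on_coord[OF R.base_manifold x']]])
          (use m'(1) S.fibre_base[OF v] in \<open>simp add: m_def v_def\<close>)
      then have "((\<lambda>s. x' (vproj E' ((\<Phi> \<circ> a) s)) i) has_real_derivative anchor_deriv E (a t) (\<lambda>q. x' (\<phi> q) i)) (at t within ?J)"
        by (rule has_field_derivative_transform_within[where d = 1]) (use t pr in \<open>simp_all del: o_apply\<close>)
      moreover have "anchor_deriv E (a t) (\<lambda>q. x' (\<phi> q) i) =
          (\<Sum>\<alpha><R.k. anchor_coeff E' x' e' i \<alpha> (vproj E' ((\<Phi> \<circ> a) t)) * basis_coord E' e' ((\<Phi> \<circ> a) t) \<alpha>)"
        using anchor_morphism[OF v R.local_basis_open[OF e'] m'(1) smooth_fun_on_coord[OF R.base_manifold x', of i]]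
          R.anchor_deriv_frame[OF fr' map_fibre[OF v], of "\<lambda>q. x' q i"]
        unfolding m'(2) by (simp add: v_def anchor_coeff_def mult.commute)
      ultimately show "((\<lambda>s. x' (vproj E' ((\<Phi> \<circ> a) s)) i) has_real_derivative
          (\<Sum>\<alpha><R.k. anchor_coeff E' x' e' i \<alpha> (vproj E' ((\<Phi> \<circ> a) t)) * basis_coord E' e' ((\<Phi> \<circ> a) t) \<alpha>)) (at t within ?J)"
        by simp
    next
      fix \<alpha>' assume \<alpha>': "\<alpha>' < R.k"
      obtain U x e where U: "m \<in> U" "S.trivialization U x e" by (rule S.trivialization_at[OF S.fibre_base[OF v]])
      then have x: "local_coords S.B U x" and e: "local_basis E U e" by (auto simp: S.trivialization_def)
      note fr = S.local_basis_frame[OF e U(1)]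
      let ?A = "\<lambda>\<alpha> \<gamma> q. basis_coord E' e' (\<Phi> (e \<alpha> q)) \<gamma>"
      let ?y = "basis_coord E e v"
      let ?p = "\<lambda>\<alpha>. dL_dy E U x e L \<alpha>" and ?p' = "\<lambda>\<gamma>. dL_dy E' U' x' e' L' \<gamma>"
      have "\<exists>D. ((\<lambda>s. ?p \<alpha> (a s)) has_real_derivative D) (at t within ?J) \<and>
          D + (\<Sum>\<gamma><S.k. \<Sum>\<beta><S.k. ?p \<gamma> v * structure_fun E e \<gamma> \<alpha> \<beta> m * ?y \<beta>) =
          (\<Sum>i<S.n. anchor_coeff E x e i \<alpha> m * dL_dx E U x e L i v)" if \<alpha>: "\<alpha> < S.k" for \<alpha>
      proof -
        have "\<forall>U x e. local_coords S.B U x \<and> local_basis E U e \<longrightarrow> (\<forall>t\<in>{t\<in>?J. vproj E (a t) \<in> U}.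
           (\<forall>\<alpha><S.k. \<exists>D. ((\<lambda>s. dL_dy E U x e L \<alpha> (a s)) has_real_derivative D) (at t within ?J) \<and>
              D + (\<Sum>\<gamma><S.k. \<Sum>\<beta><S.k. dL_dy E U x e L \<gamma> (a t) * structure_fun E e \<gamma> \<alpha> \<beta> (vproj E (a t)) * basis_coord E e (a t) \<beta>) =
                (\<Sum>i<S.n. anchor_coeff E x e i \<alpha> (vproj E (a t)) * dL_dx E U x e L i (a t))) \<and>
           (\<forall>i<S.n. ((\<lambda>s. x (vproj E (a s)) i) has_real_derivative
                     (\<Sum>\<alpha><S.k. anchor_coeff E x e i \<alpha> (vproj E (a t)) * basis_coord E e (a t) \<alpha>)) (at t within ?J)))"
          using sol unfolding lagrange_solution_def Let_def by (rule conjunct2)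
        from this[rule_format, OF conjI[OF x e], of t] show ?thesis
          using t U(1) \<alpha> unfolding v_def m_def by simp
      qed
      then have "\<forall>\<alpha>. \<exists>D. \<alpha> < S.k \<longrightarrow> ((\<lambda>s. ?p \<alpha> (a s)) has_real_derivative D) (at t within ?J) \<and>
          D + (\<Sum>\<gamma><S.k. \<Sum>\<beta><S.k. ?p \<gamma> v * structure_fun E e \<gamma> \<alpha> \<beta> m * ?y \<beta>) =
          (\<Sum>i<S.n. anchor_coeff E x e i \<alpha> m * dL_dx E U x e L i v)" by simp
      from choice[OF this] obtain D where D: "\<forall>\<alpha>. \<alpha> < S.k \<longrightarrow> ((\<lambda>s. ?p \<alpha> (a s)) has_real_derivative D \<alpha>) (at t within ?J) \<and>
          D \<alpha> + (\<Sum>\<gamma><S.k. \<Sum>\<beta><S.k. ?p \<gamma> v * structure_fun E e \<gamma> \<alpha> \<beta> m * ?y \<beta>) =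
          (\<Sum>i<S.n. anchor_coeff E x e i \<alpha> m * dL_dx E U x e L i v)" ..
      have vU': "\<Phi> v \<in> over E' U'" using R.fibre_over[OF map_fibre[OF v]] m'(1) by simp
      \<comment> \<open>Derivatives of the momenta of L' exist because the momenta are smooth on E'
        and \<Phi> o a is a C1 curve. Only then can the product rule be applied to p = A p'.\<close>
      have "\<exists>d. ((\<lambda>s. ?p' \<gamma> ((\<Phi> \<circ> a) s)) has_real_derivative d) (at t within ?J)" if \<gamma>: "\<gamma> < R.k" for \<gamma>
      proof -
        have C: "C1_curve R.T ?J (\<Phi> \<circ> a)" using adm' by (simp add: admissible_curve_def)
        obtain h where "\<forall>t\<in>{t\<in>?J. (\<Phi> \<circ> a) t \<in> over E' U'}. ((\<lambda>s. ?p' \<gamma> ((\<Phi> \<circ> a) s)) has_real_derivative h t) (at t within ?J)"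
          using C1_curve_component[OF R.total_manifold C lt R.over_open[OF R.local_basis_open[OF e']] R.dL_dy_smooth[OF x' e' L' \<gamma>]]
          by (elim exE conjE) (rule that)
        moreover have "t \<in> {t\<in>?J. (\<Phi> \<circ> a) t \<in> over E' U'}" using t vU' by (simp add: v_def)
        ultimately have "((\<lambda>s. ?p' \<gamma> ((\<Phi> \<circ> a) s)) has_real_derivative h t) (at t within ?J)" by (rule bspec)
        then show ?thesis ..
      qed
      then have "\<forall>\<gamma>. \<exists>d. \<gamma> < R.k \<longrightarrow> ((\<lambda>s. ?p' \<gamma> ((\<Phi> \<circ> a) s)) has_real_derivative d) (at t within ?J)" by simp
      from choice[OF this] obtain D' where D': "\<forall>\<gamma>. \<gamma> < R.k \<longrightarrow> ((\<lambda>s. ?p' \<gamma> ((\<Phi> \<circ> a) s)) has_real_derivative D' \<gamma>) (at t within ?J)" ..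
      define W where "W = U \<inter> {q \<in> points S.B. \<phi> q \<in> U'}"
      have W: "openin (mtop S.B) W" "m \<in> W"
        unfolding W_def using S.local_basis_open[OF e] base_preimage_open[OF R.local_basis_open[OF e']] U(1) m'(1) S.fibre_base[OF v] by auto
      have As: "smooth_fun_on S.B W (?A \<alpha> \<gamma>)" if "\<alpha> < S.k" for \<alpha> \<gamma>
        by (rule smooth_fun_on_subset[OF matrix_smooth[OF e e' that]]) (auto simp: W_def)
      \<comment> \<open>\<open>D \<alpha>\<close> and the right-hand side are derivatives of the
        same function of s, because p = A p' along the curve; derivatives on a nondegenerate
        interval are unique.\<close>
      have Dform: "D \<alpha> = (\<Sum>\<gamma><R.k. anchor_deriv E v (?A \<alpha> \<gamma>) * ?p' \<gamma> (\<Phi> v) + ?A \<alpha> \<gamma> m * D' \<gamma>)" if \<alpha>: "\<alpha> < S.k" for \<alpha>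
      proof (rule interval_DERIV_unique[OF lt t])
        show "((\<lambda>s. ?p \<alpha> (a s)) has_real_derivative D \<alpha>) (at t within ?J)" using D \<alpha> by simp
        have d1: "((\<lambda>s. \<Sum>\<gamma><R.k. ?A \<alpha> \<gamma> (vproj E (a s)) * ?p' \<gamma> ((\<Phi> \<circ> a) s)) has_real_derivative
            (\<Sum>\<gamma><R.k. anchor_deriv E v (?A \<alpha> \<gamma>) * ?p' \<gamma> ((\<Phi> \<circ> a) t) + D' \<gamma> * ?A \<alpha> \<gamma> (vproj E (a t)))) (at t within ?J)"
        proof (rule DERIV_sum, rule DERIV_mult)
          fix \<gamma> assume \<gamma>: "\<gamma> \<in> {..<R.k}"
          have "vproj E (a t) \<in> W" using W(2) by (simp add: m_def v_def)
          then show "((\<lambda>s. ?A \<alpha> \<gamma> (vproj E (a s))) has_real_derivative anchor_deriv E v (?A \<alpha> \<gamma>)) (at t within ?J)"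
            unfolding v_def by (rule S.admissible_DERIV[OF adm lt t W(1) _ As[OF \<alpha>]])
          show "((\<lambda>s. ?p' \<gamma> ((\<Phi> \<circ> a) s)) has_real_derivative D' \<gamma>) (at t within ?J)" using D' \<gamma> by simp
        qed
        \<comment> \<open>The relation between the momenta is available while the curve stays over
          W, that is, for s near t.\<close>
        have ev: "\<forall>\<^sub>F s in at t within ?J. (\<Sum>\<gamma><R.k. ?A \<alpha> \<gamma> (vproj E (a s)) * ?p' \<gamma> ((\<Phi> \<circ> a) s)) = ?p \<alpha> (a s)"
        proof -
          have "a t \<in> over E W" using W(2) aT[OF t] by (simp add: over_def m_def v_def)
          from curve_eventually[OF ac S.over_open[OF W(1)] t this] show ?thesis
          proof (rule eventually_mono)
            fix s assume s: "s \<in> ?J \<and> a s \<in> over E W"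
            then have "vproj E (a s) \<in> U" "\<phi> (vproj E (a s)) \<in> U'" by (auto simp: over_def W_def)
            from dL_dy_morphism[OF x e x' e' L L' LL' af this \<alpha>] s
            show "(\<Sum>\<gamma><R.k. ?A \<alpha> \<gamma> (vproj E (a s)) * ?p' \<gamma> ((\<Phi> \<circ> a) s)) = ?p \<alpha> (a s)" by simp
          qed
        qed
        have eq: "(\<Sum>\<gamma><R.k. ?A \<alpha> \<gamma> (vproj E (a t)) * ?p' \<gamma> ((\<Phi> \<circ> a) t)) = ?p \<alpha> (a t)"
          using dL_dy_morphism[OF x e x' e' L L' LL' v U(1) m'(1) \<alpha>] by (simp add: v_def m_def)
        have "((\<lambda>s. ?p \<alpha> (a s)) has_real_derivative
            (\<Sum>\<gamma><R.k. anchor_deriv E v (?A \<alpha> \<gamma>) * ?p' \<gamma> ((\<Phi> \<circ> a) t) + D' \<gamma> * ?A \<alpha> \<gamma> (vproj E (a t)))) (at t within ?J)"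
          by (rule has_field_derivative_cong_eventually[THEN iffD1, OF ev eq d1])
        then show "((\<lambda>s. ?p \<alpha> (a s)) has_real_derivative
            (\<Sum>\<gamma><R.k. anchor_deriv E v (?A \<alpha> \<gamma>) * ?p' \<gamma> (\<Phi> v) + ?A \<alpha> \<gamma> m * D' \<gamma>)) (at t within ?J)"
          by (simp add: v_def m_def mult.commute)
      qed
      \<comment> \<open>The one use of fibrewise surjectivity.\<close>
      have "e' \<alpha>' (\<phi> m) \<in> fibre E' (\<phi> m)" by (rule R.frame_fibre[OF fr' \<alpha>'])
      then have "e' \<alpha>' (\<phi> m) \<in> \<Phi> ` fibre E m"
        using surj S.fibre_base[OF v] unfolding fibrewise_surjective_def by simp
      then obtain u where u: "u \<in> fibre E m" "\<Phi> u = e' \<alpha>' (\<phi> m)" by (elim imageE) (rule that[OF _ sym])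
      let ?u = "basis_coord E e u"
      have delta: "basis_coord E' e' (\<Phi> u) \<gamma> = (if \<gamma> = \<alpha>' then 1 else 0)" if "\<gamma> < R.k" for \<gamma>
        unfolding u(2) by (rule R.basis_coord_basis[OF base_map_points[OF S.fibre_base[OF v]] fr' \<alpha>' that])
      have main: "D' \<alpha>' + (\<Sum>\<gamma><R.k. \<Sum>\<beta><R.k. ?p' \<gamma> (\<Phi> v) * structure_fun E' e' \<gamma> \<alpha>' \<beta> (\<phi> m) * basis_coord E' e' (\<Phi> v) \<beta>) =
          (\<Sum>i<R.n. anchor_coeff E' x' e' i \<alpha>' (\<phi> m) * dL_dx E' U' x' e' L' i (\<Phi> v))"
      proof (rule lagrange_contraction[where k = S.k and k' = R.k and n = S.n and D = D and p = "\<lambda>\<alpha>. ?p \<alpha> v" and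
            C = "\<lambda>\<gamma> \<alpha> \<beta>. structure_fun E e \<gamma> \<alpha> \<beta> m" and y = ?y and \<rho> = "\<lambda>i \<alpha>. anchor_coeff E x e i \<alpha> m" and
            Lx = "\<lambda>i. dL_dx E U x e L i v" and rA = "\<lambda>\<alpha> \<gamma>. anchor_deriv E v (?A \<alpha> \<gamma>)" and A = "\<lambda>\<alpha> \<gamma>. ?A \<alpha> \<gamma> m" and u = ?u and
            uA = "\<lambda>\<alpha> \<gamma>. anchor_deriv E u (?A \<alpha> \<gamma>)" and p' = "\<lambda>\<gamma>. ?p' \<gamma> (\<Phi> v)" and D' = D' and
            C' = "\<lambda>\<gamma> \<alpha> \<beta>. structure_fun E' e' \<gamma> \<alpha> \<beta> (\<phi> m)" and y' = "basis_coord E' e' (\<Phi> v)" and \<alpha>' = \<alpha>'])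
        show "D \<alpha> + (\<Sum>\<gamma><S.k. \<Sum>\<beta><S.k. ?p \<gamma> v * structure_fun E e \<gamma> \<alpha> \<beta> m * ?y \<beta>) =
          (\<Sum>i<S.n. anchor_coeff E x e i \<alpha> m * dL_dx E U x e L i v)" if "\<alpha> < S.k" for \<alpha> using D that by simp
        show "?p \<delta> v = (\<Sum>\<gamma><R.k. ?A \<delta> \<gamma> m * ?p' \<gamma> (\<Phi> v))" if "\<delta> < S.k" for \<delta>
          by (rule dL_dy_morphism[OF x e x' e' L L' LL' v U(1) m'(1) that])
        show "(\<Sum>\<alpha><S.k. ?u \<alpha> * ?A \<alpha> \<gamma> m) = (if \<gamma> = \<alpha>' then 1 else 0)" if "\<gamma> < R.k" for \<gamma>
          using map_coord[OF fr fr' u(1), of \<gamma>] delta[OF that] by simp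
        show "(\<Sum>i<S.n. dL_dx E U x e L i v * (\<Sum>\<alpha><S.k. ?u \<alpha> * anchor_coeff E x e i \<alpha> m)) =
          (\<Sum>i<R.n. anchor_coeff E' x' e' i \<alpha>' (\<phi> m) * dL_dx E' U' x' e' L' i (\<Phi> v)) +
          (\<Sum>\<gamma><R.k. ?p' \<gamma> (\<Phi> v) * (\<Sum>\<beta><S.k. ?y \<beta> * anchor_deriv E u (?A \<beta> \<gamma>)))"
          using dL_dx_morphism[OF x e x' e' L L' LL' u(1) v U(1) m'(1)]
          unfolding S.anchor_deriv_frame[OF fr u(1)] u(2) anchor_coeff_def by (simp add: mult.commute)
        show "- (\<Sum>\<beta><R.k. structure_fun E' e' \<gamma> \<alpha>' \<beta> (\<phi> m) * basis_coord E' e' (\<Phi> v) \<beta>) =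
          (\<Sum>\<beta><S.k. anchor_deriv E u (?A \<beta> \<gamma>) * ?y \<beta>) - (\<Sum>\<alpha><S.k. anchor_deriv E v (?A \<alpha> \<gamma>) * ?u \<alpha>)
          - (\<Sum>\<delta><S.k. ?A \<delta> \<gamma> m * (\<Sum>\<alpha><S.k. \<Sum>\<beta><S.k. structure_fun E e \<delta> \<alpha> \<beta> m * ?u \<alpha> * ?y \<beta>))" if \<gamma>: "\<gamma> < R.k" for \<gamma>
        proof -
          \<comment> \<open>The components of \<Phi> u are Kronecker deltas, so the double sum over
            the structure functions of E' reduces to a single one.\<close>
          have "(\<Sum>\<alpha><R.k. \<Sum>\<beta><R.k. structure_fun E' e' \<gamma> \<alpha> \<beta> (\<phi> m) * basis_coord E' e' (\<Phi> u) \<alpha> * basis_coord E' e' (\<Phi> v) \<beta>)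
            = (\<Sum>\<alpha><R.k. if \<alpha> = \<alpha>' then (\<Sum>\<beta><R.k. structure_fun E' e' \<gamma> \<alpha> \<beta> (\<phi> m) * basis_coord E' e' (\<Phi> v) \<beta>) else 0)"
            by (rule sum.cong[OF refl]) (simp add: delta)
          also have "\<dots> = (\<Sum>\<beta><R.k. structure_fun E' e' \<gamma> \<alpha>' \<beta> (\<phi> m) * basis_coord E' e' (\<Phi> v) \<beta>)"
            using \<alpha>' by simp
          finally show ?thesis using bracket_morphism[OF e U(1) e' m'(1) u(1) v \<gamma>] by simp
        qed
      qed (rule \<alpha>' Dform | assumption)+
      show "\<exists>D. ((\<lambda>s. ?p' \<alpha>' ((\<Phi> \<circ> a) s)) has_real_derivative D) (at t within ?J) \<and>
          D + (\<Sum>\<gamma><R.k. \<Sum>\<beta><R.k. ?p' \<gamma> ((\<Phi> \<circ> a) t) * structure_fun E' e' \<gamma> \<alpha>' \<beta> (vproj E' ((\<Phi> \<circ> a) t)) * basis_coord E' e' ((\<Phi> \<circ> a) t) \<beta>) =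
          (\<Sum>i<R.n. anchor_coeff E' x' e' i \<alpha>' (vproj E' ((\<Phi> \<circ> a) t)) * dL_dx E' U' x' e' L' i ((\<Phi> \<circ> a) t))"
        unfolding m'(2) using main D' \<alpha>' by (intro exI[of _ "D' \<alpha>'"]) (simp add: v_def)
    }
  qed
qed

end

theorem theorem6:
  fixes E :: "('m, 'e) algebroid" and E' :: "('n, 'f) algebroid"
    and \<phi> :: "'m \<Rightarrow> 'n" and \<Phi> :: "'e \<Rightarrow> 'f"
    and L :: "'e \<Rightarrow> real" and L' :: "'f \<Rightarrow> real"
    and t0 t1 :: real and a :: "real \<Rightarrow> 'e"
  assumes "lie_algebroid E" and "lie_algebroid E'"
    and "algebroid_morphism E E' \<phi> \<Phi>" and "fibrewise_surjective E E' \<phi> \<Phi>"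
    and "smooth_fun_on (vtotal E) (points (vtotal E)) L"
    and "smooth_fun_on (vtotal E') (points (vtotal E')) L'"
    and "\<forall>v\<in>points (vtotal E). L v = L' (\<Phi> v)"
    and "t0 < t1"
    and "lagrange_solution E L {t0..t1} a"
  shows "lagrange_solution E' L' {t0..t1} (\<Phi> \<circ> a)"
proof -
  interpret lie_alg_morphism E E' \<phi> \<Phi>
    using assms(1-3) by unfold_locales
  show ?thesis
    by (rule lagrange_morphism[OF assms(4-6) _ assms(8,9)]) (use assms(7) in blast)
qed

end
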